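(* Let $N\ge 2$ and let $M, M'\subset\mathbb{C}^{N}$ be smooth ($C^\infty$) real hypersurfaces. Let $f,g\colon U\to \mathbb{C}^N$, where $U\subset \mathbb{C}^N$ is an open connected subset with $M$ in its boundary, be holomorphic mappings which extend smoothly ($C^\infty$) to $M$ and send $M$ diffeomorphically into $M'$. If $M$ is $k_0$-nondegenerate at a point $p_0\in M$ and $$(\partial_z^\alpha f)(p_0)=(\partial_z^\alpha g)(p_0)\quad\text{for all } \alpha\in\mathbb{Z}_+^N \text{ with } |\alpha|\leq 2k_0,$$ then $f\equiv g$ in $U$.
   Context: $k_0$-nondegeneracy: let $M\subset\mathbb{C}^N$ be a smooth real hypersurface given near $p_0\in M$ by $\rho(z,\bar z)=0$, where $\rho$ is a smooth real-valued function with $\rho(p_0,\bar p_0)=0$ and $d\rho(p_0,\bar p_0)\neq 0$. Let $L_{\bar 1},\ldots,L_{\bar n}$, $n=N-1$, be a basis for the CR vector fields on $M$ near $p_0$ (the $(0,1)$ vector fields tangent to $M$). For a multi-index $\alpha=(\alpha_1,\dots,\alpha_n)$ put $L^{\bar\alpha}:=L_{\bar 1}^{\alpha_1}\cdots L_{\bar n}^{\alpha_n}$, and put $\rho_z:=(\partial\rho/\partial z_j)_{1\le j\le N}$. Then $M$ is called $k_0$-nondegenerate at $p_0$ if $$\mathrm{Span}_{\mathbb{C}}\{L^{\bar\alpha}\rho_z(p_0,\bar p_0)\colon |\alpha|\le k_0\}=\mathbb{C}^N.$$ The derivatives of $f$ and $g$ at $p_0\in M$ are those of the smooth extensions to $M$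 (i.e. boundary values of the holomorphic derivatives $\partial_z^\alpha f$, $\partial_z^\alpha g$).
   Formalization: "With M in its boundary" is taken to mean that near each point of M the set U contains at least one full side of M; with only M contained in the topological boundary of U the claim fails, e.g. for a domain U spiralling towards a piece of the sphere. *)

theory Defs
  imports "HOL-Analysis.Analysis"
begin

section \<open>Smooth maps\<close>

text \<open>
  For open \<open>S\<close> in a Euclidean space, \<open>k_smooth_on k S f\<close> is the class \<open>C\<^sup>k\<close> in the real sense.
  All directional derivatives are taken at interior points, so these two predicates are only meant
  for open \<open>S\<close>; arbitrary subsets are treated by \<open>smooth_on_subset\<close>.
\<close>

primrec k_smooth_on ::
  "nat \<Rightarrow> 'a::real_normed_vector set \<Rightarrow> ('a \<Rightarrow> 'b::real_normed_vector) \<Rightarrow> bool" where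
  "k_smooth_on 0 S f \<longleftrightarrow> continuous_on S f"
| "k_smooth_on (Suc k) S f \<longleftrightarrow>
     (\<forall>x\<in>S. f differentiable (at x)) \<and>
     (\<forall>v. k_smooth_on k S (\<lambda>x. frechet_derivative f (at x) v))"

definition smooth_on :: "'a::real_normed_vector set \<Rightarrow> ('a \<Rightarrow> 'b::real_normed_vector) \<Rightarrow> bool" where
  "smooth_on S f \<longleftrightarrow> (\<forall>k. k_smooth_on k S f)"

text \<open>
  A map on an arbitrary subset of a Euclidean space is smooth if it is locally the restriction of
  a smooth map defined on an open set of the ambient space.
\<close>

definition smooth_on_subset ::
  "'a::real_normed_vector set \<Rightarrow> ('a \<Rightarrow> 'b::real_normed_vector) \<Rightarrow> bool" where
  "smooth_on_subset S f \<longleftrightarrow>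
     (\<forall>p\<in>S. \<exists>V F. open V \<and> p \<in> V \<and> smooth_on V F \<and> (\<forall>z\<in>S \<inter> V. F z = f z))"

definition maps_diffeomorphically_into ::
  "('a::real_normed_vector \<Rightarrow> 'b::real_normed_vector) \<Rightarrow> 'a set \<Rightarrow> 'b set \<Rightarrow> bool" where
  "maps_diffeomorphically_into f M M' \<longleftrightarrow>
     f ` M \<subseteq> M' \<and> inj_on f M \<and> smooth_on_subset M f \<and> smooth_on_subset (f ` M) (inv_into M f)"


section \<open>Complex derivatives in several variables\<close>

text \<open>The scalar multiplication \<open>*s\<close> is the complex one, so \<open>D\<close> is required to be complex linear.\<close>

definition holomorphic_map_on ::
  "(complex ^ 'n) set \<Rightarrow> (complex ^ 'n \<Rightarrow> complex ^ 'm) \<Rightarrow> bool" where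
  "holomorphic_map_on U f \<longleftrightarrow>
     (\<forall>z\<in>U. \<exists>D. (f has_derivative D) (at z) \<and> (\<forall>c v. D (c *s v) = c *s D v))"

text \<open>
  The Wirtinger derivatives \<open>\<partial>/\<partial>z\<^sub>j\<close> and \<open>\<partial>/\<partial>\<bar>z\<^sub>j\<close>. With \<open>z\<^sub>j = x\<^sub>j + \<i> y\<^sub>j\<close>, the directions
  \<open>axis j 1\<close> and \<open>axis j \<i>\<close> are those of \<open>\<partial>/\<partial>x\<^sub>j\<close> and \<open>\<partial>/\<partial>y\<^sub>j\<close>.
\<close>

definition dz :: "'n::finite \<Rightarrow> (complex ^ 'n \<Rightarrow> complex) \<Rightarrow> complex ^ 'n \<Rightarrow> complex" where
  "dz j h z = (frechet_derivative h (at z) (axis j 1)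
               - \<i> * frechet_derivative h (at z) (axis j \<i>)) / 2"

definition dzbar :: "'n::finite \<Rightarrow> (complex ^ 'n \<Rightarrow> complex) \<Rightarrow> complex ^ 'n \<Rightarrow> complex" where
  "dzbar j h z = (frechet_derivative h (at z) (axis j 1)
                  + \<i> * frechet_derivative h (at z) (axis j \<i>)) / 2"

text \<open>
  The index type carries no order, so an enumeration of the coordinates is chosen to define
  \<open>\<partial>\<^sub>z\<^sup>\<alpha>\<close>; the partial derivatives of a smooth function commute, so the choice is immaterial.
\<close>

definition coords :: "'n::finite list" where
  "coords = (SOME js. distinct js \<and> set js = UNIV)"

definition dz_multi :: "('n::finite \<Rightarrow> nat) \<Rightarrow> (complex ^ 'n \<Rightarrow> complex) \<Rightarrow> complex ^ 'n \<Rightarrow> complex" where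
  "dz_multi \<alpha> h = foldr (\<lambda>j. dz j ^^ \<alpha> j) coords h"

definition dz_multi_map ::
  "('n::finite \<Rightarrow> nat) \<Rightarrow> (complex ^ 'n \<Rightarrow> complex ^ 'm) \<Rightarrow> complex ^ 'n \<Rightarrow> complex ^ 'm" where
  "dz_multi_map \<alpha> f z = (\<chi> i. dz_multi \<alpha> (\<lambda>w. f w $ i) z)"


section \<open>Real hypersurfaces\<close>

definition local_defining_function ::
  "(complex ^ 'n) set \<Rightarrow> complex ^ 'n \<Rightarrow> (complex ^ 'n) set \<Rightarrow> (complex ^ 'n \<Rightarrow> real) \<Rightarrow> bool" where
  "local_defining_function M p V \<rho> \<longleftrightarrow>
     open V \<and> p \<in> V \<and> smooth_on V \<rho> \<and> M \<inter> V = {z \<in> V. \<rho> z = 0} \<and>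
     \<rho> p = 0 \<and> frechet_derivative \<rho> (at p) \<noteq> (\<lambda>v. 0)"

definition smooth_real_hypersurface :: "(complex ^ 'n) set \<Rightarrow> bool" where
  "smooth_real_hypersurface M \<longleftrightarrow> (\<forall>p\<in>M. \<exists>V \<rho>. local_defining_function M p V \<rho>)"

text \<open>
  A hypersurface \<open>M\<close> in the boundary of the open set \<open>U\<close>: locally \<open>U\<close> contains (at least) one of
  the two sides of \<open>M\<close>. The inclusion \<open>M \<subseteq> frontier U\<close> alone would also admit sets \<open>U\<close> that
  spiral towards \<open>M\<close>, on which a nonzero holomorphic function can be flat along \<open>M\<close>.
  The sign of \<open>\<rho>\<close> is no restriction, since \<open>-\<rho>\<close> is a defining function as well.
\<close>

definition hypersurface_in_boundary :: "(complex ^ 'n) set \<Rightarrow> (complex ^ 'n) set \<Rightarrow> bool" where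
  "hypersurface_in_boundary M U \<longleftrightarrow>
     M \<subseteq> frontier U \<and>
     (\<forall>p\<in>M. \<exists>V \<rho>. local_defining_function M p V \<rho> \<and> {z \<in> V. \<rho> z < 0} \<subseteq> U)"

text \<open>
  \<open>F\<close> is the smooth extension of \<open>f : U \<rightarrow> \<complex>\<^sup>m\<close> to \<open>U \<union> M\<close>; for \<open>M\<close> in the closure of \<open>U\<close> its
  values on \<open>U \<union> M\<close> are determined by \<open>f\<close>.
\<close>

definition smooth_extension_to ::
  "(complex ^ 'n) set \<Rightarrow> (complex ^ 'n) set \<Rightarrow> (complex ^ 'n \<Rightarrow> complex ^ 'm) \<Rightarrow>
   (complex ^ 'n \<Rightarrow> complex ^ 'm) \<Rightarrow> bool" where
  "smooth_extension_to U M f F \<longleftrightarrow> smooth_on_subset (U \<union> M) F \<and> (\<forall>z\<in>U. F z = f z)"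

definition boundary_value ::
  "'a::topological_space set \<Rightarrow> ('a \<Rightarrow> 'b::t2_space) \<Rightarrow> 'a \<Rightarrow> 'b" where
  "boundary_value U h p = Lim (at p within U) h"


section \<open>CR vector fields and nondegeneracy\<close>

text \<open>
  A \<open>(0,1)\<close> vector field \<open>\<Sum>\<^sub>j a\<^sub>j \<partial>/\<partial>\<bar>z\<^sub>j\<close> is represented by its coefficient map \<open>a\<close>.
\<close>

definition apply_01 ::
  "(complex ^ 'n \<Rightarrow> complex ^ 'n) \<Rightarrow> (complex ^ 'n \<Rightarrow> complex) \<Rightarrow> complex ^ 'n \<Rightarrow> complex" where
  "apply_01 a h z = (\<Sum>j\<in>UNIV. a z $ j * dzbar j h z)"

definition tangent_01 :: "(complex ^ 'n \<Rightarrow> real) \<Rightarrow> complex ^ 'n \<Rightarrow> (complex ^ 'n) set" where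
  "tangent_01 \<rho> z = {v. (\<Sum>j\<in>UNIV. v $ j * dzbar j (\<lambda>w. complex_of_real (\<rho> w)) z) = 0}"

text \<open>
  A basis \<open>L 0, \<dots>, L (n - 1)\<close>, \<open>n = N - 1\<close>, of the CR vector fields on \<open>M \<inter> V\<close>. The coefficients
  are given on \<open>V\<close>, but tangency is only required along \<open>M\<close>; the fields being tangent to \<open>M\<close>,
  their iterated derivatives at points of \<open>M\<close> depend only on the coefficients along \<open>M\<close>.
\<close>

definition CR_basis_on ::
  "(complex ^ 'n) set \<Rightarrow> (complex ^ 'n) set \<Rightarrow> (complex ^ 'n \<Rightarrow> real) \<Rightarrow>
   (nat \<Rightarrow> complex ^ 'n \<Rightarrow> complex ^ 'n) \<Rightarrow> bool" where
  "CR_basis_on M V \<rho> L \<longleftrightarrow>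
     (\<forall>k<CARD('n) - 1. smooth_on V (L k)) \<and>
     (\<forall>z\<in>M \<inter> V.
        inj_on (\<lambda>k. L k z) {..<CARD('n) - 1} \<and>
        vec.independent ((\<lambda>k. L k z) ` {..<CARD('n) - 1}) \<and>
        vec.span ((\<lambda>k. L k z) ` {..<CARD('n) - 1}) = tangent_01 \<rho> z)"

definition CR_multi ::
  "(nat \<Rightarrow> complex ^ 'n \<Rightarrow> complex ^ 'n) \<Rightarrow> (nat \<Rightarrow> nat) \<Rightarrow> (complex ^ 'n \<Rightarrow> complex) \<Rightarrow>
   complex ^ 'n \<Rightarrow> complex" where
  "CR_multi L \<alpha> h = foldr (\<lambda>k. apply_01 (L k) ^^ \<alpha> k) [0..<CARD('n) - 1] h"

text \<open>
  The notion does not depend on the choice of \<open>\<rho>\<close> and of the basis \<open>L\<close>. Only the values of the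
  multi-index \<open>\<alpha>\<close> below \<open>N - 1\<close> matter.
\<close>

definition nondegenerate_at :: "nat \<Rightarrow> (complex ^ 'n) set \<Rightarrow> complex ^ 'n \<Rightarrow> bool" where
  "nondegenerate_at k\<^sub>0 M p \<longleftrightarrow>
     (\<exists>V \<rho> L. local_defining_function M p V \<rho> \<and> CR_basis_on M V \<rho> L \<and>
        vec.span {(\<chi> j. CR_multi L \<alpha> (dz j (\<lambda>w. complex_of_real (\<rho> w))) p) | \<alpha>.
                    (\<Sum>k<CARD('n) - 1. \<alpha> k) \<le> k\<^sub>0} = UNIV)"

end

theory Submission
  imports Defs "HOL-Complex_Analysis.Conformal_Mappings"
begin

text \<open>
  Let \<open>h = f - g\<close>. Subtracting the equations \<open>\<rho>'(f) = 0\<close> and \<open>\<rho>'(g) = 0\<close> and applying Hadamard's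
  lemma gives a linear identity \<open>\<Sum> P\<^sub>k h\<^sub>k + \<Sum> cnj P\<^sub>k cnj h\<^sub>k = 0\<close> on \<open>M\<close> with smooth coefficients. The CR
  fields annihilate \<open>h\<close>, so applying words of length at most \<open>k\<^sub>0\<close> in them and using
  \<open>k\<^sub>0\<close>-nondegeneracy (transported from \<open>M\<close> to \<open>P\<close>) expresses \<open>h\<close> linearly through the conjugates of
  its derivatives of order at most \<open>k\<^sub>0\<close>. The \<open>(1,0)\<close> fields \<open>L\<close> annihilate these conjugates, so every
  \<open>L\<^sup>\<gamma> h\<close> is a combination of them, and hence, by the conjugate reflection identity, of
  the derivatives of \<open>h\<close> of order at most \<open>2 k\<^sub>0\<close>. The CR fields preserve the module generated by
  the latter. Nondegeneracy makes \<open>M\<close> of finite type at \<open>p\<^sub>0\<close>, so applying CR fields to the \<open>L\<^sup>\<gamma> h\<close>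
  yields all derivatives of \<open>h\<close>. Thus the \<open>2 k\<^sub>0\<close>-jet of \<open>h\<close> solves a homogeneous linear first-order
  system along \<open>M\<close> and vanishes near \<open>p\<^sub>0\<close> because it vanishes at \<open>p\<^sub>0\<close>. Then \<open>h\<close> and its
  differential vanish on \<open>M\<close>, the extension of \<open>h\<close> by \<open>0\<close> across \<open>M\<close> is holomorphic, and \<open>h = 0\<close>.
\<close>

section \<open>Calculus of smooth maps\<close>

text \<open>As \<open>M\<close> is merely smooth, no complexification is available; all algebra
  takes place over smooth germs restricted to \<open>M\<close>, a local ring that is not Noetherian,
  so every module is generated by an explicit finite set of jets. The obstacle is the transversal
  direction. In a word of \<open>(1,0)\<close> fields applied to \<open>h\<close>, each transversal
  derivative carries a factor \<open>\<phi>\<close> that vanishes at the base point, so the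
  top-order part shows only tangential derivatives there. Finite type supplies a
  \<open>(0,1)\<close> field \<open>K\<close> along which these factors vanish to a finite order
  \<open>s\<close>. Since \<open>K\<close> kills all holomorphic derivatives of \<open>h\<close>,
  its power \<open>s d\<close> differentiates only the coefficients: transversal degree
  \<open>d\<close> acquires a nonzero coefficient at the point, higher degrees keep a vanishing one,
  lower degrees are already treated. What remains lies in the maximal ideal times jets of the same
  order, and Nakayama's lemma absorbs it. On the target side, Hadamard's coefficients at
  \<open>(f, g)\<close> differ from the gradient of \<open>\<rho>'\<close> along \<open>f\<close> by
  combinations of \<open>h\<close> and its conjugate, whose CR derivatives at the point vanish by
  the jet hypothesis; that gradient inherits nondegeneracy from \<open>M\<close>.\<close>

lemma frechet_derivative_cong_open:
  assumes "open S" "x \<in> S" "\<And>y. y \<in> S \<Longrightarrow> f y = g y"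
  shows "frechet_derivative f (at x) = frechet_derivative g (at x)"
proof -
  have "(f has_derivative D) (at x) \<longleftrightarrow> (g has_derivative D) (at x)" for D
    using assms has_derivative_transform_within_open[of f D x UNIV S g]
      has_derivative_transform_within_open[of g D x UNIV S f] by metis
  then show ?thesis by (simp add: frechet_derivative_def)
qed

lemma frechet_derivativeI: "(f has_derivative D) (at x) \<Longrightarrow> frechet_derivative f (at x) = D"
  using frechet_derivative_at by metis

lemma differentiable_cong_open:
  assumes "open S" "x \<in> S" "\<And>y. y \<in> S \<Longrightarrow> f y = g y" "f differentiable (at x)"
  shows "g differentiable (at x)"
  using assms has_derivative_transform_within_open[of f _ x UNIV S g]
  unfolding differentiable_def by metis

lemma k_smooth_on_cong:
  assumes "open S" "\<And>x. x \<in> S \<Longrightarrow> f x = g x" "k_smooth_on k S f"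
  shows "k_smooth_on k S g"
  using assms
proof (induction k arbitrary: f g)
  case 0
  then show ?case by (simp cong: continuous_on_cong)
next
  case (Suc k)
  have "k_smooth_on k S (\<lambda>x. frechet_derivative g (at x) v)" for v
    by (rule Suc.IH[of "\<lambda>x. frechet_derivative f (at x) v"])
      (use Suc.prems frechet_derivative_cong_open[of S _ f g] in auto)
  then show ?case
    using Suc.prems differentiable_cong_open[of S _ f g] by auto
qed

lemma k_smooth_on_subset: "k_smooth_on k S f \<Longrightarrow> T \<subseteq> S \<Longrightarrow> k_smooth_on k T f"
  by (induction k arbitrary: f) (auto intro: continuous_on_subset)

lemma k_smooth_on_SucD: "k_smooth_on (Suc k) S f \<Longrightarrow> k_smooth_on k S f"
proof (induction k arbitrary: f)
  case 0
  then show ?case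
    by (auto intro!: continuous_at_imp_continuous_on differentiable_imp_continuous_within)
qed auto

lemma k_smooth_on_SucI:
  assumes "open S" "\<And>x. x \<in> S \<Longrightarrow> (f has_derivative D x) (at x)"
    "\<And>v. k_smooth_on k S (\<lambda>x. D x v)"
  shows "k_smooth_on (Suc k) S f"
proof -
  have "k_smooth_on k S (\<lambda>x. frechet_derivative f (at x) v)" for v
    by (rule k_smooth_on_cong[of S "\<lambda>x. D x v"])
      (use assms frechet_derivativeI[OF assms(2)] in auto)
  then show ?thesis using assms by (auto simp: differentiable_def)
qed

lemma k_smooth_on_has_derivative:
  "k_smooth_on (Suc k) S f \<Longrightarrow> x \<in> S \<Longrightarrow> (f has_derivative frechet_derivative f (at x)) (at x)"
  by (simp add: frechet_derivative_works)

lemma k_smooth_on_continuous: "k_smooth_on k S f \<Longrightarrow> continuous_on S f"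
  by (induction k) (use k_smooth_on_SucD in \<open>auto simp del: k_smooth_on.simps(2)\<close>)

lemma k_smooth_on_const: "k_smooth_on k S (\<lambda>x. c)"
  by (induction k arbitrary: c) (auto simp: frechet_derivative_const)

lemma k_smooth_on_linear:
  assumes "bounded_linear T" "open S"
  shows "k_smooth_on k S f \<Longrightarrow> k_smooth_on k S (\<lambda>x. T (f x))"
proof (induction k arbitrary: f)
  case 0
  then show ?case using bounded_linear.continuous_on[OF assms(1)] by simp
next
  case (Suc k)
  then have "k_smooth_on k S (\<lambda>x. T (frechet_derivative f (at x) v))" for v
    by simp
  then show ?case
    using bounded_linear.has_derivative[OF assms(1) k_smooth_on_has_derivative[OF Suc.prems]]
    by (intro k_smooth_on_SucI[OF assms(2), of _ "\<lambda>x v. T (frechet_derivative f (at x) v)"]) blast+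
qed

lemma k_smooth_on_add:
  assumes "open S"
  shows "k_smooth_on k S f \<Longrightarrow> k_smooth_on k S g \<Longrightarrow> k_smooth_on k S (\<lambda>x. f x + g x)"
proof (induction k arbitrary: f g)
  case 0
  then show ?case by (auto intro: continuous_intros)
next
  case (Suc k)
  then have "k_smooth_on k S (\<lambda>x. frechet_derivative f (at x) v + frechet_derivative g (at x) v)" for v
    by simp
  then show ?case
    using has_derivative_add[OF k_smooth_on_has_derivative[OF Suc.prems(1)] k_smooth_on_has_derivative[OF Suc.prems(2)]]
    by (intro k_smooth_on_SucI[OF assms, of _ "\<lambda>x v. frechet_derivative f (at x) v + frechet_derivative g (at x) v"]) blast+
qed

lemma k_smooth_on_bilinear:
  assumes "bounded_bilinear B" "open S"
  shows "k_smooth_on k S f \<Longrightarrow> k_smooth_on k S g \<Longrightarrow> k_smooth_on k S (\<lambda>x. B (f x) (g x))"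
proof (induction k arbitrary: f g)
  case 0
  then show ?case using bounded_bilinear.continuous_on[OF assms(1)] by simp
next
  case (Suc k)
  have "k_smooth_on k S (\<lambda>x. B (f x) (frechet_derivative g (at x) v) + B (frechet_derivative f (at x) v) (g x))" for v
    using Suc k_smooth_on_SucD[OF Suc.prems(1)] k_smooth_on_SucD[OF Suc.prems(2)]
    by (intro k_smooth_on_add[OF assms(2)] Suc.IH) auto
  then show ?case
    using bounded_bilinear.FDERIV[OF assms(1) k_smooth_on_has_derivative[OF Suc.prems(1)] k_smooth_on_has_derivative[OF Suc.prems(2)]]
    by (intro k_smooth_on_SucI[OF assms(2), of _ "\<lambda>x v. B (f x) (frechet_derivative g (at x) v) + B (frechet_derivative f (at x) v) (g x)"]) blast+
qed

lemma k_smooth_on_sum: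
  assumes "open S" "\<And>i. i \<in> I \<Longrightarrow> k_smooth_on k S (f i)"
  shows "k_smooth_on k S (\<lambda>x. \<Sum>i\<in>I. f i x)"
  using assms(2)
  by (induction I rule: infinite_finite_induct) (auto intro!: k_smooth_on_const k_smooth_on_add assms(1))

lemma k_smooth_on_compose:
  fixes f :: "'a::real_normed_vector \<Rightarrow> 'b::euclidean_space"
  assumes "open S" "open T" "f ` S \<subseteq> T"
  shows "k_smooth_on k S f \<Longrightarrow> k_smooth_on k T g \<Longrightarrow> k_smooth_on k S (\<lambda>x. g (f x))"
proof (induction k arbitrary: g)
  case 0
  then show ?case using assms by (auto intro: continuous_on_compose2)
next
  case (Suc k)
  \<comment> \<open>The direction fed to the derivative of \<open>g\<close> varies with
    \<open>x\<close>, while \<open>k_smooth_on\<close> speaks of fixed directions; the expansion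
    over \<open>Basis\<close> leaves fixed directions with smooth coefficients.\<close>
  define D where "D x v = (\<Sum>b\<in>Basis. (frechet_derivative f (at x) v \<bullet> b) *\<^sub>R frechet_derivative g (at (f x)) b)" for x v
  have D: "frechet_derivative g (at (f x)) (frechet_derivative f (at x) v) = D x v" if "x \<in> S" for x v
  proof -
    have "linear (frechet_derivative g (at (f x)))"
      using Suc.prems(2) assms(3) that
      by (auto intro!: linear_frechet_derivative)
    then show ?thesis
      unfolding D_def by (subst (1) euclidean_representation[symmetric], simp add: linear_sum linear_scale)
  qed
  have "k_smooth_on k S (\<lambda>x. D x v)" for v
    unfolding D_def
    using Suc k_smooth_on_SucD[OF Suc.prems(1)]
    by (intro k_smooth_on_sum[OF assms(1)] k_smooth_on_bilinear[OF bounded_bilinear_scaleR assms(1)]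
        k_smooth_on_linear[OF bounded_linear_inner_left assms(1)] Suc.IH) auto
  moreover have "((\<lambda>x. g (f x)) has_derivative (\<lambda>v. D x v)) (at x)" if "x \<in> S" for x
    using diff_chain_at[OF k_smooth_on_has_derivative[OF Suc.prems(1) that] k_smooth_on_has_derivative[OF Suc.prems(2), of "f x"]]
      assms(3) that D by (auto simp: o_def)
  ultimately show ?case
    by (intro k_smooth_on_SucI[OF assms(1)]) auto
qed

lemma k_smooth_on_inverse: "k_smooth_on k (- {0}) (inverse :: complex \<Rightarrow> complex)"
proof (induction k)
  case 0
  then show ?case by (auto intro!: continuous_intros)
next
  case (Suc k)
  have "k_smooth_on k (-{0}) (\<lambda>x::complex. - (inverse x * v * inverse x))" for v
    by (intro k_smooth_on_linear[of uminus] k_smooth_on_bilinear[of "(*)"] Suc k_smooth_on_const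
      bounded_linear_minus bounded_linear_ident bounded_bilinear_mult) auto
  then show ?case
    by (intro k_smooth_on_SucI[of _ _ "\<lambda>x v. - (inverse x * v * inverse x)"])
      (auto intro!: has_derivative_inverse')
qed

lemma smooth_on_has_derivative:
  "smooth_on S f \<Longrightarrow> x \<in> S \<Longrightarrow> (f has_derivative frechet_derivative f (at x)) (at x)"
  using k_smooth_on_has_derivative unfolding smooth_on_def by blast

lemma smooth_on_continuous: "smooth_on S f \<Longrightarrow> continuous_on S f"
  using k_smooth_on_continuous unfolding smooth_on_def by blast

lemma smooth_on_frechet: "smooth_on S f \<Longrightarrow> smooth_on S (\<lambda>x. frechet_derivative f (at x) v)"
  unfolding smooth_on_def using k_smooth_on.simps(2) by blast

lemma smooth_on_subset: "smooth_on S f \<Longrightarrow> T \<subseteq> S \<Longrightarrow> smooth_on T f"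
  unfolding smooth_on_def using k_smooth_on_subset by blast

lemma smooth_on_const: "smooth_on S (\<lambda>x. c)"
  unfolding smooth_on_def using k_smooth_on_const by blast

lemma smooth_on_linear: "bounded_linear T \<Longrightarrow> open S \<Longrightarrow> smooth_on S f \<Longrightarrow> smooth_on S (\<lambda>x. T (f x))"
  unfolding smooth_on_def using k_smooth_on_linear by blast

lemma smooth_on_add: "open S \<Longrightarrow> smooth_on S f \<Longrightarrow> smooth_on S g \<Longrightarrow> smooth_on S (\<lambda>x. f x + g x)"
  unfolding smooth_on_def using k_smooth_on_add by blast

lemma smooth_on_minus:
  "open S \<Longrightarrow> smooth_on S f \<Longrightarrow> smooth_on S (\<lambda>x. - f x)"
  by (rule smooth_on_linear[of uminus]) (auto intro: bounded_linear_minus bounded_linear_ident)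

lemma smooth_on_diff:
  assumes "open S" "smooth_on S f" "smooth_on S g" shows "smooth_on S (\<lambda>x. f x - g x)"
  using smooth_on_add[OF assms(1,2) smooth_on_minus[OF assms(1,3)]] by simp

lemma smooth_on_bilinear:
  "bounded_bilinear B \<Longrightarrow> open S \<Longrightarrow> smooth_on S f \<Longrightarrow> smooth_on S g \<Longrightarrow> smooth_on S (\<lambda>x. B (f x) (g x))"
  unfolding smooth_on_def using k_smooth_on_bilinear by blast

lemma smooth_on_mult:
  fixes f g :: "'a::real_normed_vector \<Rightarrow> 'b::real_normed_algebra"
  shows "open S \<Longrightarrow> smooth_on S f \<Longrightarrow> smooth_on S g \<Longrightarrow> smooth_on S (\<lambda>x. f x * g x)"
  by (rule smooth_on_bilinear[OF bounded_bilinear_mult])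

lemma smooth_on_compose:
  fixes f :: "'a::real_normed_vector \<Rightarrow> 'b::euclidean_space"
  shows "open S \<Longrightarrow> open T \<Longrightarrow> f ` S \<subseteq> T \<Longrightarrow> smooth_on S f \<Longrightarrow> smooth_on T g \<Longrightarrow> smooth_on S (\<lambda>x. g (f x))"
  unfolding smooth_on_def using k_smooth_on_compose by blast

lemma smooth_on_Pair:
  fixes f :: "'a::real_normed_vector \<Rightarrow> 'b::real_normed_vector" and g :: "'a \<Rightarrow> 'c::real_normed_vector"
  assumes "open S" "smooth_on S f" "smooth_on S g"
  shows "smooth_on S (\<lambda>x. (f x, g x))"
proof -
  have "bounded_linear (\<lambda>x::'b. (x, 0::'c))" "bounded_linear (\<lambda>x::'c. (0::'b, x))"
    by (auto intro: bounded_linear_Pair bounded_linear_ident bounded_linear_zero)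
  note lin = this
  have "smooth_on S (\<lambda>x. (f x, 0) + (0, g x))"
    using smooth_on_add[OF assms(1) smooth_on_linear[OF lin(1) assms(1,2)] smooth_on_linear[OF lin(2) assms(1,3)]] .
  then show ?thesis by simp
qed

lemma open_line_preimage:
  fixes x v :: "'a::real_normed_vector"
  assumes "open S"
  shows "open {t::real. x + t *\<^sub>R v \<in> S}"
proof -
  have "continuous_on UNIV (\<lambda>t::real. x + t *\<^sub>R v)" by (intro continuous_intros)
  from open_vimage[OF assms this] show ?thesis by (simp add: vimage_def)
qed

lemma line_has_vector_derivative:
  assumes "(f has_derivative D) (at (x + t *\<^sub>R v))"
  shows "((\<lambda>t. f (x + t *\<^sub>R v)) has_vector_derivative D v) (at t within A)"
proof -
  have "((\<lambda>t. x + t *\<^sub>R v) has_derivative (\<lambda>s. s *\<^sub>R v)) (at t within A)"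
    by (auto intro!: derivative_eq_intros)
  from has_derivative_compose[OF this, of f D] assms
  have "((\<lambda>t. f (x + t *\<^sub>R v)) has_derivative (\<lambda>s. D (s *\<^sub>R v))) (at t within A)" by simp
  moreover have "linear D" using assms has_derivative_linear by blast
  ultimately show ?thesis by (simp add: has_vector_derivative_def linear_scale)
qed

text \<open>Symmetry: differentiate \<open>f (x + s u + t v) - f (x + s u)\<close>, written as the integral of the
  derivative along \<open>v\<close>, first in \<open>s\<close> and then in \<open>t\<close>.\<close>

lemma second_derivative_symmetric:
  fixes f :: "'a::real_normed_vector \<Rightarrow> 'b::banach"
  assumes S: "open S" and f: "smooth_on S f" and x: "x \<in> S"
  shows "frechet_derivative (\<lambda>y. frechet_derivative f (at y) u) (at x) v
       = frechet_derivative (\<lambda>y. frechet_derivative f (at y) v) (at x) u"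
proof -
  define P where "P w y = frechet_derivative f (at y) w" for w y
  have smP: "smooth_on S (P w)" for w
    unfolding P_def by (rule smooth_on_frechet[OF f])
  define Q where "Q y = frechet_derivative (P v) (at y) u" for y
  have smQ: "smooth_on S Q" unfolding Q_def by (rule smooth_on_frechet[OF smP])
  obtain r where r: "r > 0" "ball x r \<subseteq> S" using S x open_contains_ball by blast
  \<comment> \<open>All points with both parameters of size at most \<open>d\<close> must stay in
    the ball; halving \<open>r\<close> makes the bound strict, and \<open>+ 1\<close> keeps the
    denominator positive.\<close>
  define d where "d = (r / 2) / (norm u + norm v + 1)"
  have pos: "norm u + norm v + 1 > 0" by (simp add: add_nonneg_pos)
  have "d * (norm u + norm v + 1) = r / 2"
    using pos by (metis d_def nonzero_divide_eq_eq less_irrefl)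
  then have "d * (norm u + norm v + 1) < r" using r(1) by linarith
  moreover have "d > 0" unfolding d_def using r(1) pos by (intro divide_pos_pos) auto
  ultimately have d: "d > 0" "d * (norm u + norm v + 1) < r" by auto
  have inS: "x + s *\<^sub>R u + t *\<^sub>R v \<in> S" if "\<bar>s\<bar> \<le> d" "\<bar>t\<bar> \<le> d" for s t
  proof -
    have "norm (s *\<^sub>R u + t *\<^sub>R v) \<le> \<bar>s\<bar> * norm u + \<bar>t\<bar> * norm v"
      by (metis norm_scaleR norm_triangle_ineq)
    also have "\<dots> \<le> d * norm u + d * norm v" using that by (intro add_mono mult_right_mono) auto
    also have "\<dots> < r" using d by (auto simp: algebra_simps)
    finally have "x + s *\<^sub>R u + t *\<^sub>R v \<in> ball x r"
      by (metis add.assoc add_diff_cancel_left' dist_commute dist_norm mem_ball)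
    then show ?thesis using r by auto
  qed
  have ftc: "((\<lambda>\<tau>. P v (x + s *\<^sub>R u + \<tau> *\<^sub>R v)) has_integral f (x + s *\<^sub>R u + t *\<^sub>R v) - f (x + s *\<^sub>R u)) {0..t}"
    if "\<bar>s\<bar> \<le> d" "0 \<le> t" "t \<le> d" for s t
  proof -
    have "((\<lambda>t. f ((x + s *\<^sub>R u) + t *\<^sub>R v)) has_vector_derivative P v (x + s *\<^sub>R u + \<tau> *\<^sub>R v)) (at \<tau> within {0..t})"
      if "\<tau> \<in> {0..t}" for \<tau>
      unfolding P_def using that \<open>\<bar>s\<bar> \<le> d\<close> \<open>t \<le> d\<close>
      by (intro line_has_vector_derivative smooth_on_has_derivative[OF f] inS) auto
    from fundamental_theorem_of_calculus[OF that(2) this] show ?thesis by simp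
  qed
  have key: "((\<lambda>\<tau>. Q (x + \<tau> *\<^sub>R v)) has_integral P u (x + t *\<^sub>R v) - P u x) {0..t}"
    if t: "0 \<le> t" "t \<le> d" for t
  proof -
    have ct: "continuous_on ({-d..d} \<times> cbox 0 t) (\<lambda>(s, \<tau>). Q (x + s *\<^sub>R u + \<tau> *\<^sub>R v))"
      unfolding split_def using inS t
      by (intro continuous_on_compose2[OF smooth_on_continuous[OF smQ]] continuous_intros) auto
    have "((\<lambda>s. integral (cbox 0 t) (\<lambda>\<tau>. P v (x + s *\<^sub>R u + \<tau> *\<^sub>R v))) has_vector_derivative
        integral (cbox 0 t) (\<lambda>\<tau>. Q (x + 0 *\<^sub>R u + \<tau> *\<^sub>R v))) (at 0 within {-d..d})"
    proof (rule leibniz_rule_vector_derivative[OF _ _ ct])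
      fix s \<tau> :: real assume *: "s \<in> {-d..d}" "\<tau> \<in> cbox 0 t"
      have "((\<lambda>s. P v ((x + \<tau> *\<^sub>R v) + s *\<^sub>R u)) has_vector_derivative Q (x + \<tau> *\<^sub>R v + s *\<^sub>R u)) (at s within {-d..d})"
        unfolding Q_def using * t inS[of s \<tau>]
        by (intro line_has_vector_derivative smooth_on_has_derivative[OF smP]) (auto simp: algebra_simps)
      then show "((\<lambda>s. P v (x + s *\<^sub>R u + \<tau> *\<^sub>R v)) has_vector_derivative Q (x + s *\<^sub>R u + \<tau> *\<^sub>R v)) (at s within {-d..d})"
        by (simp add: algebra_simps)
    next
      fix s assume "s \<in> {-d..d}"
      then show "(\<lambda>\<tau>. P v (x + s *\<^sub>R u + \<tau> *\<^sub>R v)) integrable_on cbox 0 t"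
        using has_integral_integrable[OF ftc[of s t]] t by auto
    qed (use d in auto)
    then have "((\<lambda>s. integral (cbox 0 t) (\<lambda>\<tau>. P v (x + s *\<^sub>R u + \<tau> *\<^sub>R v))) has_vector_derivative
        integral (cbox 0 t) (\<lambda>\<tau>. Q (x + \<tau> *\<^sub>R v))) (at 0 within {-d..d})" by simp
    then have 1: "((\<lambda>s. f (x + s *\<^sub>R u + t *\<^sub>R v) - f (x + s *\<^sub>R u)) has_vector_derivative
        integral (cbox 0 t) (\<lambda>\<tau>. Q (x + \<tau> *\<^sub>R v))) (at 0 within {-d..d})"
      by (rule has_vector_derivative_transform[rotated 2])
        (use d ftc t in \<open>auto intro!: integral_unique[symmetric]\<close>)
    have "((\<lambda>s. f ((x + t *\<^sub>R v) + s *\<^sub>R u) - f (x + s *\<^sub>R u)) has_vector_derivative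
        P u (x + t *\<^sub>R v) - P u x) (at 0 within {-d..d})"
      unfolding P_def using inS[of 0 t] t d x
      by (intro has_vector_derivative_diff line_has_vector_derivative) (auto intro!: smooth_on_has_derivative[OF f])
    then have 2: "((\<lambda>s. f (x + s *\<^sub>R u + t *\<^sub>R v) - f (x + s *\<^sub>R u)) has_vector_derivative
        P u (x + t *\<^sub>R v) - P u x) (at 0 within {-d..d})"
      by (simp add: algebra_simps)
    have "integral (cbox 0 t) (\<lambda>\<tau>. Q (x + \<tau> *\<^sub>R v)) = P u (x + t *\<^sub>R v) - P u x"
      using vector_derivative_unique_within_closed_interval[of "-d" d 0] 1 2 d by auto
    moreover have "(\<lambda>\<tau>. Q (x + \<tau> *\<^sub>R v)) integrable_on cbox 0 t"
      using inS[of 0] t d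
      by (intro integrable_continuous continuous_on_compose2[OF smooth_on_continuous[OF smQ]] continuous_intros)
         auto
    ultimately show ?thesis using integrable_integral by fastforce
  qed
  have cQ: "continuous_on {0..d} (\<lambda>\<tau>. Q (x + \<tau> *\<^sub>R v))"
    using inS[of 0] d
    by (intro continuous_on_compose2[OF smooth_on_continuous[OF smQ]] continuous_intros) auto
  have "((\<lambda>t. integral {0..t} (\<lambda>\<tau>. Q (x + \<tau> *\<^sub>R v))) has_vector_derivative Q x) (at 0 within {0..d})"
    using integral_has_vector_derivative[OF cQ, of 0] d by simp
  moreover have "integral {0..t} (\<lambda>\<tau>. Q (x + \<tau> *\<^sub>R v)) = P u (x + t *\<^sub>R v) - P u x" if "t \<in> {0..d}" for t
    using key that by (intro integral_unique) auto
  ultimately have "((\<lambda>t. P u (x + t *\<^sub>R v) - P u x) has_vector_derivative Q x) (at 0 within {0..d})"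
    using d has_vector_derivative_transform[of 0 "{0..d}" "\<lambda>t. P u (x + t *\<^sub>R v) - P u x"
      "\<lambda>t. integral {0..t} (\<lambda>\<tau>. Q (x + \<tau> *\<^sub>R v))" "Q x"] by simp
  then have 1: "((\<lambda>t. P u (x + t *\<^sub>R v)) has_vector_derivative Q x) (at 0 within {0..d})"
    using has_vector_derivative_add_const[of "\<lambda>t. P u (x + t *\<^sub>R v)" "- P u x"] by simp
  have 2: "((\<lambda>t. P u (x + t *\<^sub>R v)) has_vector_derivative frechet_derivative (P u) (at x) v) (at 0 within {0..d})"
    using x by (intro line_has_vector_derivative) (auto intro!: smooth_on_has_derivative[OF smP])
  have "frechet_derivative (P u) (at x) v = Q x"
    using vector_derivative_unique_within_closed_interval[of 0 d 0] 1 2 d by auto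
  then show ?thesis unfolding Q_def P_def .
qed

section \<open>Hadamard's lemma\<close>

text \<open>Average over the segment from \<open>snd p\<close> to \<open>fst p\<close>.
  Differentiating in the first endpoint brings out a factor \<open>t\<close>; with the weights
  \<open>t ^ i\<close> the family is closed under differentiation.\<close>

definition segment_integral ::
  "nat \<Rightarrow> ('a::real_normed_vector \<Rightarrow> 'b::banach) \<Rightarrow> 'a \<times> 'a \<Rightarrow> 'b" where
  "segment_integral i r = (\<lambda>p. integral (cbox 0 1) (\<lambda>t. t ^ i *\<^sub>R r (snd p + t *\<^sub>R (fst p - snd p))))"

lemma segment_in_convex:
  assumes "convex B" "p \<in> B \<times> B" "t \<in> cbox 0 (1::real)"
  shows "snd p + t *\<^sub>R (fst p - snd p) \<in> B"
proof -
  have "(1 - t) *\<^sub>R snd p + t *\<^sub>R fst p \<in> B"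
    using assms by (intro convexD) auto
  then show ?thesis by (simp add: algebra_simps)
qed

lemma continuous_on_segment_integrand:
  fixes r :: "'a::real_normed_vector \<Rightarrow> 'b::banach"
  assumes "convex B" "continuous_on B r"
  shows "continuous_on ((B \<times> B) \<times> cbox 0 1)
           (\<lambda>(p, t). t ^ i *\<^sub>R r (snd p + t *\<^sub>R (fst p - snd p)))"
  unfolding split_def
  by (rule continuous_on_scaleR[OF _ continuous_on_compose2[OF assms(2)]])
     (use segment_in_convex[OF assms(1)] in \<open>auto intro!: continuous_intros\<close>)

lemma integrable_segment:
  fixes r :: "'a::real_normed_vector \<Rightarrow> 'b::banach"
  assumes "convex B" "continuous_on B r" "p \<in> B \<times> B"
  shows "(\<lambda>t. t ^ i *\<^sub>R r (snd p + t *\<^sub>R (fst p - snd p))) integrable_on cbox 0 1"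
  by (rule integrable_continuous[OF continuous_on_scaleR[OF _ continuous_on_compose2[OF assms(2)]]])
     (use segment_in_convex[OF assms(1,3)] in \<open>auto intro!: continuous_intros\<close>)

text \<open>Differentiation under the integral sign turns weight \<open>i\<close> into the weights
  \<open>i\<close> and \<open>Suc i\<close> of directional derivatives of \<open>r\<close>; hence
  the induction with \<open>r\<close> and \<open>i\<close> arbitrary.\<close>

lemma k_smooth_on_segment_integral:
  fixes r :: "'a::euclidean_space \<Rightarrow> 'b::banach"
  assumes B: "convex B" "open B"
  shows "k_smooth_on k B r \<Longrightarrow> k_smooth_on k (B \<times> B) (segment_integral i r)"
proof (induction k arbitrary: r i)
  case 0
  then have "continuous_on B r" by simp
  from integral_continuous_on_param[OF continuous_on_segment_integrand[OF B(1) this]]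
  show ?case by (simp add: segment_integral_def)
next
  case (Suc k)
  have cr: "continuous_on B r" using Suc.prems k_smooth_on_continuous by blast
  have dr: "(r has_derivative frechet_derivative r (at x)) (at x)" if "x \<in> B" for x
    using k_smooth_on_has_derivative[OF Suc.prems that] .
  have cdr: "continuous_on B (\<lambda>x. frechet_derivative r (at x) v)" for v
    by (rule k_smooth_on_continuous[of k]) (use Suc.prems in simp)
  define D where "D p t v = t ^ i *\<^sub>R frechet_derivative r (at (snd p + t *\<^sub>R (fst p - snd p)))
      (snd v + t *\<^sub>R (fst v - snd v))" for p :: "'a \<times> 'a" and t :: real and v :: "'a \<times> 'a"
  have der: "((\<lambda>p. t ^ i *\<^sub>R r (snd p + t *\<^sub>R (fst p - snd p))) has_derivative D p t) (at p within B \<times> B)"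
    if "p \<in> B \<times> B" "t \<in> cbox 0 1" for p t
  proof -
    have "((\<lambda>p. snd p + t *\<^sub>R (fst p - snd p)) has_derivative (\<lambda>v. snd v + t *\<^sub>R (fst v - snd v))) (at p within B \<times> B)"
      by (auto intro!: derivative_eq_intros)
    from has_derivative_compose[OF this dr[OF segment_in_convex[OF B(1) that]]]
    have "((\<lambda>p. r (snd p + t *\<^sub>R (fst p - snd p))) has_derivative
       (\<lambda>v. frechet_derivative r (at (snd p + t *\<^sub>R (fst p - snd p))) (snd v + t *\<^sub>R (fst v - snd v))))
       (at p within B \<times> B)" .
    then show ?thesis unfolding D_def by (rule has_derivative_scaleR_right)
  qed
  have bl: "bounded_linear (D p t)" if "p \<in> B \<times> B" "t \<in> cbox 0 1" for p t
    using der[OF that] has_derivative_bounded_linear by blast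
  \<comment> \<open>The Leibniz rule for integrals wants the derivative as a continuous map into
    bounded linear operators.\<close>
  define fx where "fx p t = Blinfun (D p t)" for p t
  have fx: "blinfun_apply (fx p t) = D p t" if "p \<in> B \<times> B" "t \<in> cbox 0 1" for p t
    unfolding fx_def using bounded_linear_Blinfun_apply[OF bl[OF that]] .
  define dir where "dir p v = segment_integral i (\<lambda>x. frechet_derivative r (at x) (snd v)) p
     + segment_integral (Suc i) (\<lambda>x. frechet_derivative r (at x) (fst v - snd v)) p" for p v :: "'a \<times> 'a"
  have D_eq: "D p t v = t ^ i *\<^sub>R frechet_derivative r (at (snd p + t *\<^sub>R (fst p - snd p))) (snd v)
     + t ^ Suc i *\<^sub>R frechet_derivative r (at (snd p + t *\<^sub>R (fst p - snd p))) (fst v - snd v)"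
    if "p \<in> B \<times> B" "t \<in> cbox 0 1" for p t v
  proof -
    have "linear (frechet_derivative r (at (snd p + t *\<^sub>R (fst p - snd p))))"
      using has_derivative_linear[OF dr[OF segment_in_convex[OF B(1) that]]] .
    then show ?thesis unfolding D_def by (simp add: linear_add linear_scale scaleR_add_right mult.commute)
  qed
  have intD: "integral (cbox 0 1) (\<lambda>t. D p t v) = dir p v" if "p \<in> B \<times> B" for p v
  proof -
    have "integral (cbox 0 1) (\<lambda>t. D p t v) = integral (cbox 0 1)
      (\<lambda>t. t ^ i *\<^sub>R frechet_derivative r (at (snd p + t *\<^sub>R (fst p - snd p))) (snd v)
     + t ^ Suc i *\<^sub>R frechet_derivative r (at (snd p + t *\<^sub>R (fst p - snd p))) (fst v - snd v))"
      using D_eq[OF that] by (intro integral_cong) auto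
    also have "\<dots> = dir p v"
      unfolding dir_def segment_integral_def
      by (intro integral_add integrable_segment[OF B(1) cdr that])
    finally show ?thesis .
  qed
  have cont: "continuous_on ((B \<times> B) \<times> cbox 0 1) (\<lambda>(p, t). fx p t)"
  proof (rule continuous_on_blinfun_componentwise)
    fix v :: "'a \<times> 'a" assume "v \<in> Basis"
    have "continuous_on ((B \<times> B) \<times> cbox 0 1) (\<lambda>(p, t). t ^ i *\<^sub>R frechet_derivative r (at (snd p + t *\<^sub>R (fst p - snd p))) (snd v))"
      "continuous_on ((B \<times> B) \<times> cbox 0 1) (\<lambda>(p, t). t ^ Suc i *\<^sub>R frechet_derivative r (at (snd p + t *\<^sub>R (fst p - snd p))) (fst v - snd v))"
      by (rule continuous_on_segment_integrand[OF B(1) cdr])+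
    from continuous_on_add[OF this]
    show "continuous_on ((B \<times> B) \<times> cbox 0 1) (\<lambda>x. blinfun_apply (case x of (p, t) \<Rightarrow> fx p t) v)"
      by (rule continuous_on_eq) (auto simp: fx D_eq split_def)
  qed
  have "(segment_integral i r has_derivative dir p) (at p)" if "p \<in> B \<times> B" for p
  proof -
    have der_int: "(segment_integral i r has_derivative integral (cbox 0 1) (fx p)) (at p within B \<times> B)"
      unfolding segment_integral_def
      by (rule leibniz_rule[OF _ _ cont that])
         (use der fx integrable_segment[OF B(1) cr] B in \<open>auto simp: convex_Times\<close>)
    have "fx p integrable_on cbox 0 1"
    proof (rule integrable_continuous)
      have "continuous_on (cbox 0 (1::real)) (\<lambda>t. (p, t))" by (intro continuous_intros)
      from continuous_on_compose2[OF cont this] that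
      show "continuous_on (cbox 0 1) (fx p)" by auto
    qed
    then have "blinfun_apply (integral (cbox 0 1) (fx p)) v = integral (cbox 0 1) (\<lambda>t. fx p t v)" for v
      by (rule blinfun_apply_integral)
    moreover have "integral (cbox 0 1) (\<lambda>t. fx p t v) = integral (cbox 0 1) (\<lambda>t. D p t v)" for v
      by (intro integral_cong) (simp add: fx that)
    ultimately have "blinfun_apply (integral (cbox 0 1) (fx p)) v = dir p v" for v
      using intD[OF that, of v] by simp
    then have "blinfun_apply (integral (cbox 0 1) (fx p)) = dir p" by auto
    with der_int show ?thesis
      using B at_within_open[OF that open_Times] by auto
  qed
  moreover have "k_smooth_on k (B \<times> B) (\<lambda>p. dir p v)" for v
    unfolding dir_def using Suc.prems
    by (intro k_smooth_on_add open_Times B Suc.IH) auto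
  ultimately show ?case
    by (intro k_smooth_on_SucI[where D = dir] open_Times B)
qed

lemma segment_integral_diagonal: "segment_integral 0 r (u, u) = r u"
  by (simp add: segment_integral_def)

text \<open>\<open>q e\<close> is the mean of a partial derivative along the segment. Both endpoints
  stay variable, so that vector fields can later be applied to \<open>q e (F z, G z)\<close>; on the
  diagonal the integrand is constant, which recovers the gradient.\<close>

lemma Hadamard_lemma:
  fixes r :: "'a::euclidean_space \<Rightarrow> 'b::banach"
  assumes "convex B" "open B" "smooth_on B r"
  obtains q where "\<And>e. smooth_on (B \<times> B) (q e)"
    "\<And>u v. u \<in> B \<Longrightarrow> v \<in> B \<Longrightarrow> r u - r v = (\<Sum>e\<in>Basis. ((u - v) \<bullet> e) *\<^sub>R q e (u, v))"
    "\<And>e u. q e (u, u) = frechet_derivative r (at u) e"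
proof
  define q where "q e = segment_integral 0 (\<lambda>x. frechet_derivative r (at x) e)" for e
  show "smooth_on (B \<times> B) (q e)" for e
    using smooth_on_frechet[OF assms(3), of e] k_smooth_on_segment_integral[OF assms(1,2)]
    unfolding smooth_on_def q_def by blast
  show "q e (u, u) = frechet_derivative r (at u) e" for e u
    by (simp add: q_def segment_integral_diagonal)
  fix u v assume uv: "u \<in> B" "v \<in> B"
  define d where "d t e = frechet_derivative r (at (v + t *\<^sub>R (u - v))) e" for t e
  have inB: "v + t *\<^sub>R (u - v) \<in> B" if "t \<in> cbox 0 1" for t
    using segment_in_convex[OF assms(1), of "(u, v)"] uv that by auto
  have "((\<lambda>t. r (v + t *\<^sub>R (u - v))) has_vector_derivative d t (u - v)) (at t within {0..1})" if "t \<in> {0..1}" for t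
    unfolding d_def using that inB
    by (intro line_has_vector_derivative smooth_on_has_derivative[OF assms(3)]) auto
  from fundamental_theorem_of_calculus[OF _ this]
  have "((\<lambda>t. d t (u - v)) has_integral r u - r v) (cbox 0 1)" by simp
  moreover have "integral (cbox 0 1) (\<lambda>t. d t (u - v)) = integral (cbox 0 1) (\<lambda>t. \<Sum>e\<in>Basis. ((u - v) \<bullet> e) *\<^sub>R d t e)"
  proof (intro integral_cong)
    fix t :: real assume "t \<in> cbox 0 1"
    then have "linear (d t)"
      unfolding d_def using has_derivative_linear smooth_on_has_derivative[OF assms(3)] inB by blast
    then show "d t (u - v) = (\<Sum>e\<in>Basis. ((u - v) \<bullet> e) *\<^sub>R d t e)"
      by (subst (1) euclidean_representation[symmetric]) (simp add: linear_sum linear_scale)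
  qed
  moreover have "(\<lambda>t. d t e) integrable_on cbox 0 1" for e
    using integrable_segment[OF assms(1) smooth_on_continuous[OF smooth_on_frechet[OF assms(3), of e]], of "(u, v)" 0] uv
    by (simp add: d_def)
  then have "integral (cbox 0 1) (\<lambda>t. \<Sum>e\<in>Basis. ((u - v) \<bullet> e) *\<^sub>R d t e)
      = (\<Sum>e\<in>Basis. ((u - v) \<bullet> e) *\<^sub>R integral (cbox 0 1) (\<lambda>t. d t e))"
    by (subst integral_sum) (auto intro!: integrable_cmul)
  ultimately show "r u - r v = (\<Sum>e\<in>Basis. ((u - v) \<bullet> e) *\<^sub>R q e (u, v))"
    by (simp add: integral_unique q_def segment_integral_def d_def)
qed

section \<open>Germs of smooth functions and Wirtinger derivatives\<close>

text \<open>Domains are left implicit, so that finitely many germs can be combined without tracking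
  neighbourhoods.\<close>

definition smooth_near ::
  "'a::real_normed_vector \<Rightarrow> ('a \<Rightarrow> 'b::real_normed_vector) \<Rightarrow> bool" where
  "smooth_near p f \<longleftrightarrow> (\<exists>W. open W \<and> p \<in> W \<and> smooth_on W f)"

lemma smooth_nearI: "open W \<Longrightarrow> p \<in> W \<Longrightarrow> smooth_on W f \<Longrightarrow> smooth_near p f"
  by (auto simp: smooth_near_def)

lemma smooth_near_eventually: "smooth_near p f \<Longrightarrow> \<forall>\<^sub>F z in nhds p. smooth_near z f"
  unfolding smooth_near_def eventually_nhds by blast

lemma smooth_near_differentiable: "smooth_near z f \<Longrightarrow> f differentiable (at z)"
  unfolding smooth_near_def using smooth_on_has_derivative differentiable_def by blast

lemma smooth_near_has_derivative:
  "smooth_near z f \<Longrightarrow> (f has_derivative frechet_derivative f (at z)) (at z)"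
  using smooth_near_differentiable frechet_derivative_works by blast

lemma smooth_near_isCont: "smooth_near z f \<Longrightarrow> isCont f z"
  by (simp add: smooth_near_differentiable differentiable_imp_continuous_within)

lemma smooth_near_tendsto: "smooth_near z f \<Longrightarrow> (f \<longlongrightarrow> f z) (nhds z)"
  using smooth_near_isCont isCont_def tendsto_at_iff_tendsto_nhds by blast

lemma smooth_near_nonzero:
  "smooth_near p f \<Longrightarrow> f p \<noteq> 0 \<Longrightarrow> \<forall>\<^sub>F z in nhds p. f z \<noteq> 0"
  using smooth_near_tendsto tendsto_imp_eventually_ne by blast

lemma smooth_near_binop:
  assumes "\<And>S. open S \<Longrightarrow> smooth_on S f \<Longrightarrow> smooth_on S g \<Longrightarrow> smooth_on S h"
    and "smooth_near p f" "smooth_near p g"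
  shows "smooth_near p h"
proof -
  obtain W V where "open W" "p \<in> W" "smooth_on W f" "open V" "p \<in> V" "smooth_on V g"
    using assms by (auto simp: smooth_near_def)
  then show ?thesis
    using smooth_on_subset[of W f "W \<inter> V"] smooth_on_subset[of V g "W \<inter> V"]
    by (intro smooth_nearI[of "W \<inter> V"] assms(1)) auto
qed

lemma smooth_near_const [simp]: "smooth_near p (\<lambda>z. c)"
  using smooth_on_const smooth_nearI[of UNIV] by blast

lemma smooth_near_add: "smooth_near p f \<Longrightarrow> smooth_near p g \<Longrightarrow> smooth_near p (\<lambda>z. f z + g z)"
  by (rule smooth_near_binop[where f = f and g = g]) (auto intro: smooth_on_add)

lemma smooth_near_diff: "smooth_near p f \<Longrightarrow> smooth_near p g \<Longrightarrow> smooth_near p (\<lambda>z. f z - g z)"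
  by (rule smooth_near_binop[where f = f and g = g]) (auto intro: smooth_on_diff)

lemma smooth_near_minus: "smooth_near p f \<Longrightarrow> smooth_near p (\<lambda>z. - f z)"
  by (rule smooth_near_binop[where f = f and g = f]) (auto intro: smooth_on_minus)

lemma smooth_near_mult:
  fixes f g :: "'a::real_normed_vector \<Rightarrow> 'b::real_normed_algebra"
  shows "smooth_near p f \<Longrightarrow> smooth_near p g \<Longrightarrow> smooth_near p (\<lambda>z. f z * g z)"
  by (rule smooth_near_binop[where f = f and g = g]) (auto intro: smooth_on_mult)

lemma smooth_near_Pair:
  "smooth_near p f \<Longrightarrow> smooth_near p g \<Longrightarrow> smooth_near p (\<lambda>z. (f z, g z))"
  by (rule smooth_near_binop[where f = f and g = g]) (auto intro: smooth_on_Pair)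

lemma smooth_near_linear:
  "bounded_linear T \<Longrightarrow> smooth_near p f \<Longrightarrow> smooth_near p (\<lambda>z. T (f z))"
  by (rule smooth_near_binop[where f = f and g = f]) (auto intro: smooth_on_linear)

lemma smooth_near_cnj: "smooth_near p f \<Longrightarrow> smooth_near p (\<lambda>z. cnj (f z))"
  by (rule smooth_near_linear[OF bounded_linear_cnj])

lemma smooth_near_of_real:
  "smooth_near p f \<Longrightarrow> smooth_near p (\<lambda>z. of_real (f z) :: 'b::real_normed_algebra_1)"
  by (rule smooth_near_linear[OF bounded_linear_of_real])

lemma smooth_near_nth: "smooth_near p f \<Longrightarrow> smooth_near p (\<lambda>z. f z $ i)"
  by (rule smooth_near_linear[OF bounded_linear_vec_nth])

lemma smooth_near_sum:
  assumes "\<And>i. i \<in> I \<Longrightarrow> smooth_near p (f i)"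
  shows "smooth_near p (\<lambda>z. \<Sum>i\<in>I. f i z)"
  using assms by (induction I rule: infinite_finite_induct) (auto intro!: smooth_near_add)

lemma smooth_near_power:
  fixes f :: "'a::real_normed_vector \<Rightarrow> 'b::real_normed_algebra_1"
  shows "smooth_near p f \<Longrightarrow> smooth_near p (\<lambda>z. f z ^ k)"
  by (induction k) (auto intro: smooth_near_mult)

lemma smooth_near_compose:
  fixes f :: "'a::real_normed_vector \<Rightarrow> 'b::euclidean_space"
  assumes "smooth_near p f" "smooth_near (f p) g"
  shows "smooth_near p (\<lambda>z. g (f z))"
proof -
  obtain W where W: "open W" "p \<in> W" "smooth_on W f" using assms by (auto simp: smooth_near_def)
  obtain V where V: "open V" "f p \<in> V" "smooth_on V g" using assms by (auto simp: smooth_near_def)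
  have o: "open (W \<inter> f -` V)"
    using continuous_open_preimage[OF smooth_on_continuous[OF W(3)] W(1) V(1)] .
  have "smooth_on (W \<inter> f -` V) (\<lambda>z. g (f z))"
    by (rule smooth_on_compose[OF o V(1) _ smooth_on_subset[OF W(3)] V(3)]) auto
  then show ?thesis using o W V smooth_nearI[of "W \<inter> f -` V"] by auto
qed

lemma smooth_near_inverse:
  fixes f :: "'a::real_normed_vector \<Rightarrow> complex"
  assumes "smooth_near p f" "f p \<noteq> 0"
  shows "smooth_near p (\<lambda>z. inverse (f z))"
proof (rule smooth_near_compose[OF assms(1)])
  show "smooth_near (f p) (inverse :: complex \<Rightarrow> complex)"
    using assms(2) by (intro smooth_nearI[of "-{0}"]) (auto simp: smooth_on_def k_smooth_on_inverse)
qed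

lemma smooth_near_divide:
  fixes f g :: "'a::real_normed_vector \<Rightarrow> complex"
  assumes "smooth_near p f" "smooth_near p g" "g p \<noteq> 0"
  shows "smooth_near p (\<lambda>z. f z / g z)"
  unfolding divide_inverse by (intro smooth_near_mult smooth_near_inverse assms)

lemma smooth_near_frechet: "smooth_near p f \<Longrightarrow> smooth_near p (\<lambda>z. frechet_derivative f (at z) v)"
  unfolding smooth_near_def using smooth_on_frechet by blast

lemma smooth_near_dz: "smooth_near p f \<Longrightarrow> smooth_near p (dz j f)"
  and smooth_near_dzbar: "smooth_near p f \<Longrightarrow> smooth_near p (dzbar j f)"
proof -
  assume f: "smooth_near p f"
  note d = smooth_near_frechet[OF f, of "axis j 1"] smooth_near_mult[OF smooth_near_const smooth_near_frechet[OF f, of "axis j \<i>"], of \<i>]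
  from smooth_near_mult[OF smooth_near_diff[OF d] smooth_near_const, of "1 / 2"] show "smooth_near p (dz j f)"
    by (simp add: dz_def[abs_def])
  from smooth_near_mult[OF smooth_near_add[OF d] smooth_near_const, of "1 / 2"] show "smooth_near p (dzbar j f)"
    by (simp add: dzbar_def[abs_def])
qed

lemma foldr_dz_smooth: "smooth_near p f \<Longrightarrow> smooth_near p (foldr dz w f)"
  by (induction w) (auto intro: smooth_near_dz)

section \<open>Wirtinger calculus: product rule, conjugation, symmetry of second derivatives\<close>

lemma frechet_derivative_cong:
  assumes "\<forall>\<^sub>F y in nhds z. f y = g y"
  shows "frechet_derivative f (at z) = frechet_derivative g (at z)"
  using assms frechet_derivative_cong_open[of _ z f g] unfolding eventually_nhds by blast

lemma dz_cong: "\<forall>\<^sub>F y in nhds z. f y = g y \<Longrightarrow> dz j f z = dz j g z"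
  and dzbar_cong: "\<forall>\<^sub>F y in nhds z. f y = g y \<Longrightarrow> dzbar j f z = dzbar j g z"
  using frechet_derivative_cong[of f g z] by (simp_all add: dz_def dzbar_def)

lemma dz_const [simp]: "dz j (\<lambda>z. c) z = 0" and dzbar_const [simp]: "dzbar j (\<lambda>z. c) z = 0"
  by (simp_all add: dz_def dzbar_def frechet_derivative_const)

context
  fixes f g :: "complex ^ 'n \<Rightarrow> complex" and z :: "complex ^ 'n"
  assumes f: "f differentiable (at z)" and g: "g differentiable (at z)"
begin

lemma frechet_derivative_addC:
  "frechet_derivative (\<lambda>z. f z + g z) (at z) = (\<lambda>v. frechet_derivative f (at z) v + frechet_derivative g (at z) v)"
  using f g by (intro frechet_derivativeI has_derivative_add) (simp_all add: frechet_derivative_works)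

lemma frechet_derivative_diffC:
  "frechet_derivative (\<lambda>z. f z - g z) (at z) = (\<lambda>v. frechet_derivative f (at z) v - frechet_derivative g (at z) v)"
  using f g by (intro frechet_derivativeI has_derivative_diff) (simp_all add: frechet_derivative_works)

lemma frechet_derivative_multC:
  "frechet_derivative (\<lambda>z. f z * g z) (at z) = (\<lambda>v. f z * frechet_derivative g (at z) v + frechet_derivative f (at z) v * g z)"
  using f g by (intro frechet_derivativeI has_derivative_mult) (simp_all add: frechet_derivative_works)

lemma dz_add: "dz j (\<lambda>z. f z + g z) z = dz j f z + dz j g z"
  and dzbar_add: "dzbar j (\<lambda>z. f z + g z) z = dzbar j f z + dzbar j g z"
  and dz_diff: "dz j (\<lambda>z. f z - g z) z = dz j f z - dz j g z"
  and dzbar_diff: "dzbar j (\<lambda>z. f z - g z) z = dzbar j f z - dzbar j g z"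
  and dz_mult: "dz j (\<lambda>z. f z * g z) z = dz j f z * g z + f z * dz j g z"
  and dzbar_mult: "dzbar j (\<lambda>z. f z * g z) z = dzbar j f z * g z + f z * dzbar j g z"
  unfolding dz_def dzbar_def frechet_derivative_addC frechet_derivative_diffC frechet_derivative_multC
  by (simp_all add: field_simps)

end

lemma frechet_derivative_cnj:
  assumes "f differentiable (at z)"
  shows "frechet_derivative (\<lambda>z. cnj (f z)) (at z) = (\<lambda>v. cnj (frechet_derivative f (at z) v))"
  using assms by (intro frechet_derivativeI bounded_linear.has_derivative[OF bounded_linear_cnj]) (simp_all add: frechet_derivative_works)

lemma dz_cnj: "f differentiable (at z) \<Longrightarrow> dz j (\<lambda>z. cnj (f z)) z = cnj (dzbar j f z)"
  and dzbar_cnj: "f differentiable (at z) \<Longrightarrow> dzbar j (\<lambda>z. cnj (f z)) z = cnj (dz j f z)"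
  by (simp_all add: dz_def dzbar_def frechet_derivative_cnj)

lemma vec_real_decomposition:
  fixes w :: "complex ^ 'n"
  shows "w = (\<Sum>k\<in>UNIV. Re (w $ k) *\<^sub>R axis k 1 + Im (w $ k) *\<^sub>R axis k \<i>)"
  by (simp add: vec_eq_iff axis_def if_distrib[of "\<lambda>x. _ *\<^sub>R x"] sum.distrib complex_eq_iff cong: if_cong)

lemma frechet_derivative_wirtinger:
  fixes f :: "complex ^ 'n \<Rightarrow> complex"
  assumes "f differentiable (at z)"
  shows "frechet_derivative f (at z) v = (\<Sum>j\<in>UNIV. v $ j * dz j f z) + (\<Sum>j\<in>UNIV. cnj (v $ j) * dzbar j f z)"
proof -
  let ?D = "frechet_derivative f (at z)"
  have lin: "linear ?D" using assms by (rule linear_frechet_derivative)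
  have "?D v = ?D (\<Sum>j\<in>UNIV. Re (v $ j) *\<^sub>R axis j 1 + Im (v $ j) *\<^sub>R axis j \<i>)"
    by (rule arg_cong[OF vec_real_decomposition])
  also have "\<dots> = (\<Sum>j\<in>UNIV. Re (v $ j) *\<^sub>R ?D (axis j 1) + Im (v $ j) *\<^sub>R ?D (axis j \<i>))"
    using lin by (simp add: linear_sum linear_add linear_scale)
  also have "\<dots> = (\<Sum>j\<in>UNIV. v $ j * dz j f z + cnj (v $ j) * dzbar j f z)"
    by (intro sum.cong) (simp_all add: dz_def dzbar_def complex_eq_iff field_simps)
  finally show ?thesis by (simp add: sum.distrib)
qed

lemma frechet_derivative_dz:
  fixes f :: "complex ^ 'n \<Rightarrow> complex"
  assumes "smooth_near z f"
  shows "frechet_derivative (dz j f) (at z) v =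
      (frechet_derivative (\<lambda>y. frechet_derivative f (at y) (axis j 1)) (at z) v
       - \<i> * frechet_derivative (\<lambda>y. frechet_derivative f (at y) (axis j \<i>)) (at z) v) / 2"
    and "frechet_derivative (dzbar j f) (at z) v =
      (frechet_derivative (\<lambda>y. frechet_derivative f (at y) (axis j 1)) (at z) v
       + \<i> * frechet_derivative (\<lambda>y. frechet_derivative f (at y) (axis j \<i>)) (at z) v) / 2"
proof -
  note d = smooth_near_has_derivative[OF smooth_near_frechet[OF assms]]
  have "(dz j f has_derivative (\<lambda>v. (frechet_derivative (\<lambda>y. frechet_derivative f (at y) (axis j 1)) (at z) v
       - \<i> * frechet_derivative (\<lambda>y. frechet_derivative f (at y) (axis j \<i>)) (at z) v) / 2)) (at z)"
    unfolding dz_def[abs_def] divide_inverse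
    by (intro has_derivative_mult_left has_derivative_diff has_derivative_mult_right d)
  from frechet_derivativeI[OF this] show "frechet_derivative (dz j f) (at z) v =
      (frechet_derivative (\<lambda>y. frechet_derivative f (at y) (axis j 1)) (at z) v
       - \<i> * frechet_derivative (\<lambda>y. frechet_derivative f (at y) (axis j \<i>)) (at z) v) / 2" by simp
  have "(dzbar j f has_derivative (\<lambda>v. (frechet_derivative (\<lambda>y. frechet_derivative f (at y) (axis j 1)) (at z) v
       + \<i> * frechet_derivative (\<lambda>y. frechet_derivative f (at y) (axis j \<i>)) (at z) v) / 2)) (at z)"
    unfolding dzbar_def[abs_def] divide_inverse
    by (intro has_derivative_mult_left has_derivative_add has_derivative_mult_right d)
  from frechet_derivativeI[OF this] show "frechet_derivative (dzbar j f) (at z) v =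
      (frechet_derivative (\<lambda>y. frechet_derivative f (at y) (axis j 1)) (at z) v
       + \<i> * frechet_derivative (\<lambda>y. frechet_derivative f (at y) (axis j \<i>)) (at z) v) / 2" by simp
qed

lemma smooth_near_second_derivative_symmetric:
  fixes f :: "complex ^ 'n \<Rightarrow> complex"
  assumes "smooth_near z f"
  shows "frechet_derivative (\<lambda>y. frechet_derivative f (at y) u) (at z) v
       = frechet_derivative (\<lambda>y. frechet_derivative f (at y) v) (at z) u"
  using assms second_derivative_symmetric unfolding smooth_near_def by blast

lemma dz_dz_commute:
  fixes f :: "complex ^ 'n \<Rightarrow> complex"
  assumes "smooth_near z f"
  shows "dz i (dz j f) z = dz j (dz i f) z"
    and "dz i (dzbar j f) z = dzbar j (dz i f) z"
    and "dzbar i (dzbar j f) z = dzbar j (dzbar i f) z"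
proof -
  note s = smooth_near_second_derivative_symmetric[OF assms]
  show "dz i (dz j f) z = dz j (dz i f) z"
    unfolding dz_def[of _ "dz _ f"] frechet_derivative_dz[OF assms]
      s[of "axis j 1" "axis i 1"] s[of "axis j \<i>" "axis i 1"] s[of "axis j 1" "axis i \<i>"] s[of "axis j \<i>" "axis i \<i>"]
    by (simp add: field_simps)
  show "dz i (dzbar j f) z = dzbar j (dz i f) z"
    unfolding dz_def[of _ "dzbar _ f"] dzbar_def[of _ "dz _ f"] frechet_derivative_dz[OF assms]
      s[of "axis j 1" "axis i 1"] s[of "axis j \<i>" "axis i 1"] s[of "axis j 1" "axis i \<i>"] s[of "axis j \<i>" "axis i \<i>"]
    by (simp add: field_simps)
  show "dzbar i (dzbar j f) z = dzbar j (dzbar i f) z"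
    unfolding dzbar_def[of _ "dzbar _ f"] frechet_derivative_dz[OF assms]
      s[of "axis j 1" "axis i 1"] s[of "axis j \<i>" "axis i 1"] s[of "axis j 1" "axis i \<i>"] s[of "axis j \<i>" "axis i \<i>"]
    by (simp add: field_simps)
qed

section \<open>Germs along a real hypersurface\<close>

text \<open>The derivative of \<open>f\<close> in a tangential direction \<open>v\<close> is estimated along points
  \<open>z + t (v + s n)\<close> of the hypersurface with \<open>s\<close> small, found by the intermediate value theorem.\<close>

lemma derivative_tangential_eq_0:
  fixes \<rho> :: "'a::real_normed_vector \<Rightarrow> real" and f :: "'a \<Rightarrow> 'b::real_normed_vector"
  assumes ev: "\<forall>\<^sub>F y in nhds z. \<rho> y = 0 \<longrightarrow> f y = 0" and z: "\<rho> z = 0" and s: "smooth_near z \<rho>"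
    and D: "(f has_derivative D) (at z)"
    and n: "frechet_derivative \<rho> (at z) n \<noteq> 0" and v: "frechet_derivative \<rho> (at z) v = 0"
  shows "D v = 0"
proof -
  define d where "d = frechet_derivative \<rho> (at z)"
  have d: "(\<rho> has_derivative d) (at z)"
    unfolding d_def by (rule smooth_near_has_derivative[OF s])
  have lind: "linear d" and linD: "linear D" using d D has_derivative_linear by blast+
  define m where "m = n /\<^sub>R d n"
  have dm: "d m = 1" using n lind by (simp add: m_def d_def linear_scale)
  have fz: "f z = 0" using eventually_nhds_x_imp_x[OF ev] z by simp
  obtain W0 where W0: "open W0" "z \<in> W0" "smooth_on W0 \<rho>" using s by (auto simp: smooth_near_def)
  obtain W1 where W1: "open W1" "z \<in> W1" "\<And>y. y \<in> W1 \<Longrightarrow> \<rho> y = 0 \<longrightarrow> f y = 0"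
    using ev unfolding eventually_nhds by blast
  obtain r where r: "r > 0" "ball z r \<subseteq> W0 \<inter> W1"
    using W0 W1 open_contains_ball[of "W0 \<inter> W1"] by (metis IntI open_Int)
  have main: "norm (D v) \<le> e * (norm v + norm m + norm (D m))" if e: "0 < e" "e \<le> 1" for e
  proof -
    define K where "K = norm v + norm m"
    have K: "K \<ge> 0" by (simp add: K_def)
    have w: "norm (v + s *\<^sub>R m) \<le> K" if "\<bar>s\<bar> \<le> e" for s
    proof -
      have "norm (v + s *\<^sub>R m) \<le> norm v + \<bar>s\<bar> * norm m" by (metis norm_scaleR norm_triangle_ineq)
      also have "\<dots> \<le> norm v + 1 * norm m" using that e by (intro add_left_mono mult_right_mono) auto
      finally show ?thesis by (simp add: K_def)
    qed
    \<comment> \<open>On steps of length at most \<open>t * K\<close> the linearisation error of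
      \<open>\<rho>\<close> must stay below \<open>t * e\<close>, the size of its linear part at
      \<open>s = e\<close> and \<open>s = -e\<close>; this forces the change of sign.\<close>
    define \<eta> where "\<eta> = e / (2 * (K + 1))"
    have \<eta>: "\<eta> > 0" using e K by (simp add: \<eta>_def)
    have "\<eta> * K \<le> \<eta> * (K + 1)" using \<eta> by (intro mult_left_mono) auto
    also have "\<dots> = e / 2" using K by (simp add: \<eta>_def field_simps)
    finally have \<eta>K: "\<eta> * K < e" using e by linarith
    obtain d1 where d1: "d1 > 0" "\<And>y. norm (y - z) < d1 \<Longrightarrow> norm (\<rho> y - \<rho> z - d (y - z)) \<le> \<eta> * norm (y - z)"
      using d \<eta> unfolding has_derivative_at_alt by blast
    obtain d2 where d2: "d2 > 0" "\<And>y. norm (y - z) < d2 \<Longrightarrow> norm (f y - f z - D (y - z)) \<le> e * norm (y - z)"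
      using D e unfolding has_derivative_at_alt by blast
    define t where "t = min r (min d1 d2) / (K + 1)"
    have t: "t > 0" using r d1 d2 K by (simp add: t_def)
    have "t * K < t * (K + 1)" using t by simp
    also have "\<dots> = min r (min d1 d2)" using K by (simp add: t_def)
    finally have tK: "t * K < r" "t * K < d1" "t * K < d2" by auto
    have nt: "norm (t *\<^sub>R (v + s *\<^sub>R m)) \<le> t * K" if "\<bar>s\<bar> \<le> e" for s
      using w[OF that] t by simp
    define a where "a s = \<rho> (z + t *\<^sub>R (v + s *\<^sub>R m))" for s
    have inr: "z + t *\<^sub>R (v + s *\<^sub>R m) \<in> ball z r" if "\<bar>s\<bar> \<le> e" for s
      using nt[OF that] tK(1) by (metis add_diff_cancel_left' dist_commute dist_norm le_less_trans mem_ball)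
    have as: "\<bar>a s - t * s\<bar> < t * e" if "\<bar>s\<bar> \<le> e" for s
    proof -
      have "norm (\<rho> (z + t *\<^sub>R (v + s *\<^sub>R m)) - \<rho> z - d (t *\<^sub>R (v + s *\<^sub>R m))) \<le> \<eta> * norm (t *\<^sub>R (v + s *\<^sub>R m))"
        using d1(2)[of "z + t *\<^sub>R (v + s *\<^sub>R m)"] nt[OF that] tK by simp
      also have "\<dots> \<le> \<eta> * (t * K)" using nt[OF that] \<eta> by (intro mult_left_mono) auto
      also have "\<dots> < t * e" using mult_strict_left_mono[OF \<eta>K t] by (simp add: mult_ac)
      finally show ?thesis using z v lind dm by (simp add: a_def d_def linear_add linear_scale)
    qed
    have "continuous_on {-e..e} a"
      unfolding a_def
    proof (rule continuous_on_compose2[OF smooth_on_continuous[OF W0(3)]])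
      show "continuous_on {-e..e} (\<lambda>s. z + t *\<^sub>R (v + s *\<^sub>R m))" by (intro continuous_intros)
    next
      have "z + t *\<^sub>R (v + s *\<^sub>R m) \<in> W0" if "s \<in> {-e..e}" for s
        using inr[of s] that r(2) by (metis IntE abs_le_iff atLeastAtMost_iff minus_le_iff subsetD)
      then show "(\<lambda>s. z + t *\<^sub>R (v + s *\<^sub>R m)) ` {-e..e} \<subseteq> W0" by blast
    qed
    moreover have "a (-e) \<le> 0" "a e \<ge> 0" using as[of e] as[of "-e"] e by auto
    ultimately obtain s where s: "-e \<le> s" "s \<le> e" "a s = 0"
      using IVT'[of a "-e" 0 e] e by auto
    let ?w = "v + s *\<^sub>R m"
    have se: "\<bar>s\<bar> \<le> e" using s by auto
    have "f (z + t *\<^sub>R ?w) = 0" using W1(3)[of "z + t *\<^sub>R ?w"] inr[OF se] r s(3) by (auto simp: a_def)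
    then have "norm (D (t *\<^sub>R ?w)) \<le> e * norm (t *\<^sub>R ?w)"
      using d2(2)[of "z + t *\<^sub>R ?w"] nt[OF se] tK fz by simp
    then have "t * norm (D ?w) \<le> t * (e * norm ?w)" using t linD by (simp add: linear_scale mult_ac)
    then have "norm (D ?w) \<le> e * norm ?w" using t by simp
    also have "\<dots> \<le> e * K" using w[OF se] e by (intro mult_left_mono) auto
    finally have 1: "norm (D ?w) \<le> e * K" .
    have "D v = D ?w - s *\<^sub>R D m" using linD by (simp add: linear_add linear_scale)
    then have "norm (D v) \<le> norm (D ?w) + \<bar>s\<bar> * norm (D m)" by (metis norm_scaleR norm_triangle_ineq4)
    also have "\<dots> \<le> e * K + e * norm (D m)" using 1 se by (intro add_mono mult_right_mono) auto
    finally show ?thesis by (simp add: K_def algebra_simps)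
  qed
  let ?C = "norm v + norm m + norm (D m)"
  have C: "?C \<ge> 0" by simp
  have "norm (D v) \<le> 0 + \<epsilon>" if "\<epsilon> > 0" for \<epsilon>
  proof -
    define e where "e = min 1 (\<epsilon> / (?C + 1))"
    have e: "0 < e" "e \<le> 1" using that C by (auto simp: e_def add_nonneg_pos)
    have "norm (D v) \<le> e * ?C" by (rule main[OF e])
    also have "\<dots> \<le> e * (?C + 1)" using e by (intro mult_left_mono) auto
    also have "\<dots> \<le> \<epsilon> / (?C + 1) * (?C + 1)" using C by (intro mult_right_mono) (auto simp: e_def)
    also have "\<dots> = \<epsilon>" using C by (simp add: add_nonneg_eq_0_iff)
    finally show ?thesis by simp
  qed
  then have "norm (D v) \<le> 0" by (rule field_le_epsilon)
  then show ?thesis by simp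
qed

lemma frechet_derivative_of_real:
  fixes \<rho> :: "'a::real_normed_vector \<Rightarrow> real"
  assumes "\<rho> differentiable (at z)"
  shows "frechet_derivative (\<lambda>z. complex_of_real (\<rho> z)) (at z) = (\<lambda>v. of_real (frechet_derivative \<rho> (at z) v))"
  using assms
  by (intro frechet_derivativeI bounded_linear.has_derivative[OF bounded_linear_of_real]) (simp_all add: frechet_derivative_works)

lemma dzbar_of_real:
  fixes \<rho> :: "complex ^ 'n \<Rightarrow> real"
  assumes "\<rho> differentiable (at z)"
  shows "dzbar k (\<lambda>z. complex_of_real (\<rho> z)) z = cnj (dz k (\<lambda>z. complex_of_real (\<rho> z)) z)"
  by (simp add: dz_def dzbar_def frechet_derivative_of_real[OF assms])

text \<open>The differential of \<open>f\<close> kills the tangent space of the level set, that is,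
  the kernel of the differential of \<open>\<rho>\<close>, so it is a complex multiple of the
  latter. One factor serves all \<open>dz\<close> and \<open>dzbar\<close> at once.\<close>

lemma wirtinger_proportional:
  fixes \<rho> :: "complex ^ 'n \<Rightarrow> real" and f :: "complex ^ 'n \<Rightarrow> complex"
  assumes ev: "\<forall>\<^sub>F y in nhds z. \<rho> y = 0 \<longrightarrow> f y = 0" and z: "\<rho> z = 0" and s: "smooth_near z \<rho>"
    and D: "f differentiable (at z)" and n: "frechet_derivative \<rho> (at z) n \<noteq> 0"
  shows "\<exists>\<kappa>. \<forall>j. dz j f z = \<kappa> * dz j (\<lambda>z. complex_of_real (\<rho> z)) z
            \<and> dzbar j f z = \<kappa> * dzbar j (\<lambda>z. complex_of_real (\<rho> z)) z"
proof -
  define d where "d = frechet_derivative \<rho> (at z)"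
  define E where "E = frechet_derivative f (at z)"
  have E: "(f has_derivative E) (at z)" using D unfolding E_def by (simp add: frechet_derivative_works)
  have lin: "linear d" "linear E"
    unfolding d_def E_def using s D smooth_near_differentiable linear_frechet_derivative by blast+
  have dn: "d n \<noteq> 0" using n by (simp add: d_def)
  \<comment> \<open>Subtracting a suitable multiple of \<open>n\<close> makes \<open>v\<close>
    tangent.\<close>
  have Ev: "E v = E n / of_real (d n) * of_real (d v)" for v
  proof -
    have "d (v - (d v / d n) *\<^sub>R n) = 0" using lin dn by (simp add: linear_diff linear_scale)
    then have "E (v - (d v / d n) *\<^sub>R n) = 0"
      using derivative_tangential_eq_0[OF ev z s E n] by (simp add: d_def)
    then have "E v = (d v / d n) *\<^sub>R E n" using lin by (simp add: linear_diff linear_scale)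
    then show ?thesis by (simp add: scaleR_conv_of_real)
  qed
  have "\<forall>j. dz j f z = (E n / of_real (d n)) * dz j (\<lambda>z. complex_of_real (\<rho> z)) z
            \<and> dzbar j f z = (E n / of_real (d n)) * dzbar j (\<lambda>z. complex_of_real (\<rho> z)) z"
    unfolding dz_def dzbar_def frechet_derivative_of_real[OF smooth_near_differentiable[OF s]]
      E_def[symmetric] d_def[symmetric] Ev[of "axis _ _"]
    by (simp add: algebra_simps diff_divide_distrib add_divide_distrib)
  then show ?thesis by blast
qed

section \<open>Complexified vector fields and germs restricted to the hypersurface\<close>

definition vector_field ::
  "('n::finite \<Rightarrow> complex ^ 'n \<Rightarrow> complex) \<Rightarrow> ('n \<Rightarrow> complex ^ 'n \<Rightarrow> complex) \<Rightarrow>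
   (complex ^ 'n \<Rightarrow> complex) \<Rightarrow> complex ^ 'n \<Rightarrow> complex" where
  "vector_field a b f z = (\<Sum>j\<in>UNIV. a j z * dz j f z) + (\<Sum>j\<in>UNIV. b j z * dzbar j f z)"

lemma vector_field_add:
  "f differentiable (at z) \<Longrightarrow> g differentiable (at z) \<Longrightarrow>
    vector_field a b (\<lambda>z. f z + g z) z = vector_field a b f z + vector_field a b g z"
  by (simp add: vector_field_def dz_add dzbar_add algebra_simps sum.distrib)

lemma vector_field_diff:
  "f differentiable (at z) \<Longrightarrow> g differentiable (at z) \<Longrightarrow>
    vector_field a b (\<lambda>z. f z - g z) z = vector_field a b f z - vector_field a b g z"
  by (simp add: vector_field_def dz_diff dzbar_diff algebra_simps sum_subtractf)

lemma vector_field_mult: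
  "f differentiable (at z) \<Longrightarrow> g differentiable (at z) \<Longrightarrow>
    vector_field a b (\<lambda>z. f z * g z) z = vector_field a b f z * g z + f z * vector_field a b g z"
  by (simp add: vector_field_def dz_mult dzbar_mult algebra_simps sum.distrib sum_distrib_left)

lemma vector_field_const [simp]: "vector_field a b (\<lambda>z. c) z = 0"
  by (simp add: vector_field_def)

lemma vector_field_smooth:
  assumes "\<And>j. smooth_near p (a j)" "\<And>j. smooth_near p (b j)" "smooth_near p f"
  shows "smooth_near p (vector_field a b f)"
  unfolding vector_field_def[abs_def]
  by (intro smooth_near_add smooth_near_sum smooth_near_mult smooth_near_dz smooth_near_dzbar assms)

text \<open>The index \<open>N\<close> singles out a coordinate in which \<open>\<rho>\<close> has
  nonzero complex derivative at \<open>p\<close>; dividing by that derivative takes the place of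
  normalised coordinates.\<close>

locale hypersurface_germ =
  fixes M :: "(complex ^ 'n) set" and \<rho> :: "complex ^ 'n \<Rightarrow> real" and p :: "complex ^ 'n" and N :: 'n
  assumes p_in_M: "p \<in> M" and M_eq: "\<forall>\<^sub>F z in nhds p. z \<in> M \<longleftrightarrow> \<rho> z = 0"
    and smooth_rho: "smooth_near p \<rho>" and dz_N: "dz N (\<lambda>z. complex_of_real (\<rho> z)) p \<noteq> 0"
begin

abbreviation R :: "complex ^ 'n \<Rightarrow> complex" where "R \<equiv> \<lambda>z. complex_of_real (\<rho> z)"

lemma smooth_R: "smooth_near p R"
  by (rule smooth_near_of_real[OF smooth_rho])

text \<open>Germs on \<open>M\<close> are represented by ambient germs modulo this relation.
  Tangential fields respect it; \<open>dz\<close> and \<open>dzbar\<close> in general do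
  not.\<close>

definition eqM :: "(complex ^ 'n \<Rightarrow> complex) \<Rightarrow> (complex ^ 'n \<Rightarrow> complex) \<Rightarrow> bool" where
  "eqM f g \<longleftrightarrow> (\<forall>\<^sub>F z in nhds p. z \<in> M \<longrightarrow> f z = g z)"

lemma eqM_refl [simp]: "eqM f f" by (simp add: eqM_def)

lemma eqM_sym: "eqM f g \<Longrightarrow> eqM g f" by (simp add: eqM_def eq_commute)

lemma eqM_trans [trans]: "eqM f g \<Longrightarrow> eqM g h \<Longrightarrow> eqM f h"
  unfolding eqM_def by (auto elim: eventually_elim2)

lemma eqM_near: "\<forall>\<^sub>F z in nhds p. f z = g z \<Longrightarrow> eqM f g"
  unfolding eqM_def by (auto elim: eventually_mono)

lemma eqM_at: "eqM f g \<Longrightarrow> f p = g p"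
  unfolding eqM_def using eventually_nhds_x_imp_x p_in_M by fastforce

lemma eqM_add: "eqM f f' \<Longrightarrow> eqM g g' \<Longrightarrow> eqM (\<lambda>z. f z + g z) (\<lambda>z. f' z + g' z)"
  unfolding eqM_def by (auto elim: eventually_elim2)

lemma eqM_diff: "eqM f f' \<Longrightarrow> eqM g g' \<Longrightarrow> eqM (\<lambda>z. f z - g z) (\<lambda>z. f' z - g' z)"
  unfolding eqM_def by (auto elim: eventually_elim2)

lemma eqM_mult: "eqM f f' \<Longrightarrow> eqM g g' \<Longrightarrow> eqM (\<lambda>z. f z * g z) (\<lambda>z. f' z * g' z)"
  unfolding eqM_def by (auto elim: eventually_elim2)

lemma eqM_cnj: "eqM f g \<Longrightarrow> eqM (\<lambda>z. cnj (f z)) (\<lambda>z. cnj (g z))"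
  unfolding eqM_def by (auto elim: eventually_mono)

lemma eqM_sum:
  assumes "\<And>i. i \<in> I \<Longrightarrow> eqM (f i) (g i)"
  shows "eqM (\<lambda>z. \<Sum>i\<in>I. f i z) (\<lambda>z. \<Sum>i\<in>I. g i z)"
  using assms by (induction I rule: infinite_finite_induct) (auto intro: eqM_add)

lemma rho_near:
  "\<forall>\<^sub>F z in nhds p. (\<forall>\<^sub>F y in nhds z. y \<in> M \<longleftrightarrow> \<rho> y = 0) \<and> smooth_near z \<rho> \<and> dz N R z \<noteq> 0"
  by (intro eventually_conj smooth_near_eventually smooth_rho smooth_near_nonzero smooth_near_dz smooth_R dz_N)
     (use M_eq in \<open>simp add: eventually_eventually\<close>)

text \<open>The pointwise proportionality holds at all points of \<open>M\<close> near
  \<open>p\<close>, since vanishing on \<open>M\<close> near \<open>p\<close> is inherited by nearby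
  points. The factor is chosen point by point, without regularity.\<close>

lemma eqM_0_proportional:
  assumes "eqM f (\<lambda>z. 0)" "smooth_near p f"
  shows "\<forall>\<^sub>F z in nhds p. z \<in> M \<longrightarrow> (\<exists>\<kappa>. \<forall>j. dz j f z = \<kappa> * dz j R z \<and> dzbar j f z = \<kappa> * dzbar j R z)"
proof -
  have "\<forall>\<^sub>F z in nhds p. \<forall>\<^sub>F y in nhds z. y \<in> M \<longrightarrow> f y = 0"
    using assms(1) by (simp add: eqM_def eventually_eventually)
  with rho_near smooth_near_eventually[OF assms(2)] show ?thesis
  proof eventually_elim
    case (elim z)
    show ?case
    proof
      assume "z \<in> M"
      then have z: "\<rho> z = 0" using eventually_nhds_x_imp_x[OF conjunct1[OF elim(1)]] by simp
      have d: "\<rho> differentiable (at z)" using elim smooth_near_differentiable by blast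
      obtain n where "frechet_derivative \<rho> (at z) n \<noteq> 0"
      proof (rule ccontr)
        assume "\<not> thesis"
        with that have "frechet_derivative \<rho> (at z) n = 0" for n by blast
        then have "dz N R z = 0" by (simp add: dz_def frechet_derivative_of_real[OF d])
        then show False using elim by blast
      qed
      moreover have "\<forall>\<^sub>F y in nhds z. \<rho> y = 0 \<longrightarrow> f y = 0"
        by (rule eventually_elim2[OF conjunct1[OF elim(1)] elim(3)]) auto
      ultimately show "\<exists>\<kappa>. \<forall>j. dz j f z = \<kappa> * dz j R z \<and> dzbar j f z = \<kappa> * dzbar j R z"
        using wirtinger_proportional z elim smooth_near_differentiable by blast
    qed
  qed
qed

definition tangential :: "((complex ^ 'n \<Rightarrow> complex) \<Rightarrow> complex ^ 'n \<Rightarrow> complex) \<Rightarrow> bool" where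
  "tangential X \<longleftrightarrow> (\<exists>a b. (\<forall>j. smooth_near p (a j)) \<and> (\<forall>j. smooth_near p (b j)) \<and>
     X = vector_field a b \<and> eqM (X R) (\<lambda>z. 0))"

lemma tangential_smooth: "tangential X \<Longrightarrow> smooth_near p f \<Longrightarrow> smooth_near p (X f)"
  unfolding tangential_def using vector_field_smooth by blast

lemma tangential_const [simp]: "tangential X \<Longrightarrow> X (\<lambda>z. c) = (\<lambda>z. 0)"
  unfolding tangential_def by (auto simp: fun_eq_iff)

lemma tangential_near:
  assumes "tangential X" "smooth_near p f" "smooth_near p g"
  shows "\<forall>\<^sub>F z in nhds p. X (\<lambda>z. f z + g z) z = X f z + X g z"
    and "\<forall>\<^sub>F z in nhds p. X (\<lambda>z. f z - g z) z = X f z - X g z"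
    and "\<forall>\<^sub>F z in nhds p. X (\<lambda>z. f z * g z) z = X f z * g z + f z * X g z"
proof -
  obtain a b where X: "X = vector_field a b" using assms(1) unfolding tangential_def by blast
  note ev = smooth_near_eventually[OF assms(2)] smooth_near_eventually[OF assms(3)]
  show "\<forall>\<^sub>F z in nhds p. X (\<lambda>z. f z + g z) z = X f z + X g z"
    using ev by eventually_elim (simp add: X vector_field_add smooth_near_differentiable)
  show "\<forall>\<^sub>F z in nhds p. X (\<lambda>z. f z - g z) z = X f z - X g z"
    using ev by eventually_elim (simp add: X vector_field_diff smooth_near_differentiable)
  show "\<forall>\<^sub>F z in nhds p. X (\<lambda>z. f z * g z) z = X f z * g z + f z * X g z"
    using ev by eventually_elim (simp add: X vector_field_mult smooth_near_differentiable)
qed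

lemmas tangential_add = eqM_near[OF tangential_near(1)]
  and tangential_diff = eqM_near[OF tangential_near(2)]
  and tangential_mult = eqM_near[OF tangential_near(3)]

lemma tangential_cmult:
  assumes "tangential X" "smooth_near p f"
  shows "eqM (X (\<lambda>z. c * f z)) (\<lambda>z. c * X f z)"
  using tangential_mult[OF assms(1) smooth_near_const assms(2), of c] assms by simp

lemma tangential_sum:
  assumes "tangential X" "\<And>i. i \<in> I \<Longrightarrow> smooth_near p (f i)"
  shows "eqM (X (\<lambda>z. \<Sum>i\<in>I. f i z)) (\<lambda>z. \<Sum>i\<in>I. X (f i) z)"
  using assms(2)
proof (induction I rule: infinite_finite_induct)
  case (insert i I)
  then have "eqM (X (\<lambda>z. f i z + (\<Sum>i\<in>I. f i z))) (\<lambda>z. X (f i) z + X (\<lambda>z. \<Sum>i\<in>I. f i z) z)"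
    by (intro tangential_add assms(1) smooth_near_sum) auto
  also have "eqM \<dots> (\<lambda>z. X (f i) z + (\<Sum>i\<in>I. X (f i) z))"
    using insert.IH insert.prems by (intro eqM_add eqM_refl) blast
  finally show ?case using insert by simp
qed (use assms in auto)

text \<open>On \<open>M\<close> the differential of \<open>f - g\<close> is a multiple of that of
  \<open>\<rho>\<close>, which \<open>X\<close> kills. Tangential fields therefore act on germs
  restricted to \<open>M\<close>.\<close>

lemma tangential_eqM:
  assumes X: "tangential X" and f: "smooth_near p f" and g: "smooth_near p g" and eq: "eqM f g"
  shows "eqM (X f) (X g)"
proof -
  obtain a b where ab: "X = vector_field a b" and XR: "eqM (X R) (\<lambda>z. 0)"
    using X unfolding tangential_def by blast
  have s: "smooth_near p (\<lambda>z. f z - g z)" by (intro smooth_near_diff f g)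
  have "eqM (\<lambda>z. f z - g z) (\<lambda>z. 0)" using eq by (simp add: eqM_def)
  from eqM_0_proportional[OF this s] XR[unfolded eqM_def] smooth_near_eventually[OF f] smooth_near_eventually[OF g]
  show ?thesis unfolding eqM_def
  proof eventually_elim
    case (elim z)
    show ?case
    proof
      assume z: "z \<in> M"
      then obtain \<kappa> where \<kappa>: "\<And>j. dz j (\<lambda>z. f z - g z) z = \<kappa> * dz j R z"
        "\<And>j. dzbar j (\<lambda>z. f z - g z) z = \<kappa> * dzbar j R z" using elim by blast
      have "X f z - X g z = X (\<lambda>z. f z - g z) z"
        using elim by (simp add: ab vector_field_diff smooth_near_differentiable)
      also have "\<dots> = \<kappa> * X R z"
        by (simp add: ab vector_field_def \<kappa> sum_distrib_left algebra_simps)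
      also have "\<dots> = 0" using elim z by simp
      finally show "X f z = X g z" by simp
    qed
  qed
qed

section \<open>Modules over the ring of smooth germs along the hypersurface\<close>

text \<open>The module generated by \<open>G\<close> over smooth germs, read on \<open>M\<close>.
  Rule \<open>eq\<close> asks for smoothness of \<open>g\<close> because agreement on
  \<open>M\<close> says nothing about \<open>g\<close> elsewhere.\<close>

inductive mspan :: "(complex ^ 'n \<Rightarrow> complex) set \<Rightarrow> (complex ^ 'n \<Rightarrow> complex) \<Rightarrow> bool"
  for G where
  zero: "mspan G (\<lambda>z. 0)"
| gen: "g \<in> G \<Longrightarrow> mspan G g"
| add: "mspan G f \<Longrightarrow> mspan G g \<Longrightarrow> mspan G (\<lambda>z. f z + g z)"
| scale: "smooth_near p c \<Longrightarrow> mspan G f \<Longrightarrow> mspan G (\<lambda>z. c z * f z)"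
| eq: "mspan G f \<Longrightarrow> smooth_near p g \<Longrightarrow> eqM f g \<Longrightarrow> mspan G g"

lemma mspan_smooth:
  assumes "mspan G f" "\<And>g. g \<in> G \<Longrightarrow> smooth_near p g" shows "smooth_near p f"
  using assms(1) by induction (auto intro: smooth_near_add smooth_near_mult assms(2))

lemma mspan_trans:
  assumes "mspan G f" "\<And>g. g \<in> G \<Longrightarrow> mspan G' g" shows "mspan G' f"
  using assms(1) by induction (auto intro: mspan.intros assms(2))

lemma mspan_mono: "mspan G f \<Longrightarrow> G \<subseteq> G' \<Longrightarrow> mspan G' f"
  by (rule mspan_trans) (auto intro: mspan.gen)

lemma mspan_cmult: "mspan G f \<Longrightarrow> mspan G (\<lambda>z. c * f z)"
  by (rule mspan.scale) auto

lemma mspan_diff: "mspan G f \<Longrightarrow> mspan G g \<Longrightarrow> mspan G (\<lambda>z. f z - g z)"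
  using mspan.add[of G f "\<lambda>z. (-1) * g z"] mspan_cmult[of G g "-1"] by simp

lemma mspan_sum:
  assumes "\<And>i. i \<in> I \<Longrightarrow> mspan G (f i)" shows "mspan G (\<lambda>z. \<Sum>i\<in>I. f i z)"
  using assms by (induction I rule: infinite_finite_induct) (auto intro: mspan.intros)

text \<open>By the Leibniz rule \<open>X (c * g)\<close> involves only \<open>g\<close> and
  \<open>X g\<close>, so the target module has to contain the generators and their images. All
  bookkeeping of jet orders rests on this.\<close>

lemma mspan_derivation:
  assumes f: "mspan G f" and X: "tangential X"
    and G: "\<And>g. g \<in> G \<Longrightarrow> smooth_near p g" "\<And>g. g \<in> G \<Longrightarrow> mspan G' g" "\<And>g. g \<in> G \<Longrightarrow> mspan G' (X g)"
  shows "mspan G' (X f)"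
proof -
  have sm: "smooth_near p f" if "mspan G f" for f using mspan_smooth[OF that] G(1) by blast
  show ?thesis
    using f
  proof induction
    case zero
    then show ?case using X by (simp add: mspan.zero)
  next
    case (gen g)
    then show ?case by (rule G)
  next
    case (add f g)
    show ?case
      by (rule mspan.eq[OF mspan.add[OF add.IH] _ eqM_sym[OF tangential_add[OF X]]])
        (use X sm add.hyps in \<open>auto intro: tangential_smooth smooth_near_add\<close>)
  next
    case (scale c f)
    have "mspan G' (\<lambda>z. X c z * f z + c z * X f z)"
      by (rule mspan.add[OF mspan.scale[OF tangential_smooth[OF X scale(1)] mspan_trans[OF scale(2) G(2)]]
            mspan.scale[OF scale(1) scale.IH]])
    from mspan.eq[OF this _ eqM_sym[OF tangential_mult[OF X scale(1) sm[OF scale(2)]]]]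
    show ?case
      using tangential_smooth[OF X smooth_near_mult[OF scale(1) sm[OF scale(2)]]] .
  next
    case (eq f g)
    show ?case
      by (rule mspan.eq[OF eq.IH tangential_smooth[OF X eq(2)] tangential_eqM[OF X sm[OF eq(1)] eq(2,3)]])
  qed
qed

lemma mspan_eq_0_at:
  assumes "mspan G f" "\<And>g. g \<in> G \<Longrightarrow> g p = 0" shows "f p = 0"
  using assms(1) by induction (auto simp: assms(2) dest: eqM_at)

lemma mspan_cnj:
  assumes "mspan G f" shows "mspan ((\<lambda>g z. cnj (g z)) ` G) (\<lambda>z. cnj (f z))"
  using assms
proof induction
  case zero
  then show ?case by (simp add: mspan.zero)
next
  case (gen g)
  then show ?case by (intro mspan.gen) blast
next
  case (add f g)
  then show ?case using mspan.add[OF add.IH] by simp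
next
  case (scale c f)
  then show ?case using mspan.scale[OF smooth_near_cnj scale.IH] by simp
next
  case (eq f g)
  then show ?case by (intro mspan.eq[OF eq.IH] smooth_near_cnj eqM_cnj) auto
qed

text \<open>Smooth coefficients are bounded near \<open>p\<close>; module membership thus becomes
  the pointwise estimate that Gronwall's argument consumes.\<close>

lemma mspan_bound:
  assumes "finite G" "mspan G f"
  shows "\<exists>C\<ge>0. \<forall>\<^sub>F z in nhds p. z \<in> M \<longrightarrow> norm (f z) \<le> C * (\<Sum>g\<in>G. norm (g z))"
  using assms(2)
proof induction
  case zero
  then show ?case by (auto intro: exI[of _ 0])
next
  case (gen g)
  have "cmod (g z) \<le> (\<Sum>g\<in>G. cmod (g z))" for z
    using gen assms(1) member_le_sum[of g G "\<lambda>g. cmod (g z)"] by simp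
  then show ?case by (intro exI[of _ 1]) simp
next
  case (add f g)
  then obtain C C' where C: "C \<ge> 0" "\<forall>\<^sub>F z in nhds p. z \<in> M \<longrightarrow> norm (f z) \<le> C * (\<Sum>g\<in>G. norm (g z))"
    "C' \<ge> 0" "\<forall>\<^sub>F z in nhds p. z \<in> M \<longrightarrow> norm (g z) \<le> C' * (\<Sum>g\<in>G. norm (g z))" by blast
  have "\<forall>\<^sub>F z in nhds p. z \<in> M \<longrightarrow> norm (f z + g z) \<le> (C + C') * (\<Sum>g\<in>G. norm (g z))"
    using C(2,4) by eventually_elim (auto simp: algebra_simps intro: norm_triangle_le)
  then show ?case using C by (intro exI[of _ "C + C'"]) auto
next
  case (scale c f)
  then obtain C where C: "C \<ge> 0" "\<forall>\<^sub>F z in nhds p. z \<in> M \<longrightarrow> norm (f z) \<le> C * (\<Sum>g\<in>G. norm (g z))" by blast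
  have "((\<lambda>z. norm (c z)) \<longlongrightarrow> norm (c p)) (nhds p)"
    using scale(1) by (intro tendsto_norm smooth_near_tendsto)
  then have "\<forall>\<^sub>F z in nhds p. norm (c z) < norm (c p) + 1"
    by (rule order_tendstoD) simp
  then have "\<forall>\<^sub>F z in nhds p. z \<in> M \<longrightarrow> norm (c z * f z) \<le> ((norm (c p) + 1) * C) * (\<Sum>g\<in>G. norm (g z))"
    using C(2)
  proof eventually_elim
    case (elim z)
    then show ?case using C(1) mult_mono[of "norm (c z)" "norm (c p) + 1" "norm (f z)" "C * (\<Sum>g\<in>G. norm (g z))"]
      by (auto simp: norm_mult mult.assoc)
  qed
  then show ?case using C(1) by (intro exI[of _ "(norm (c p) + 1) * C"]) auto
next
  case (eq f g)
  then obtain C where C: "C \<ge> 0" "\<forall>\<^sub>F z in nhds p. z \<in> M \<longrightarrow> norm (f z) \<le> C * (\<Sum>g\<in>G. norm (g z))" by blast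
  have "\<forall>\<^sub>F z in nhds p. z \<in> M \<longrightarrow> norm (g z) \<le> C * (\<Sum>g\<in>G. norm (g z))"
    using C(2) eq(3)[unfolded eqM_def] by eventually_elim auto
  then show ?case using C by blast
qed

text \<open>Gaussian elimination gives Nakayama's lemma without determinants.\<close>

lemma mspan_eliminate:
  assumes "finite K" "\<And>k. k \<in> K \<Longrightarrow> smooth_near p (x k)"
    "\<And>k j. k \<in> K \<Longrightarrow> j \<in> K \<Longrightarrow> smooth_near p (c k j)"
    "\<And>k j. k \<in> K \<Longrightarrow> j \<in> K \<Longrightarrow> c k j p = (if k = j then 1 else 0)"
    "\<And>k. k \<in> K \<Longrightarrow> mspan G (\<lambda>z. \<Sum>j\<in>K. c k j z * x j z)"
  shows "k \<in> K \<Longrightarrow> mspan G (x k)"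
  using assms
proof (induction K arbitrary: c k)
  case (insert a K)
  have ca: "smooth_near p (c a a)" "c a a p \<noteq> 0" using insert.prems by auto
  \<comment> \<open>Schur complement of the pivot \<open>c a a\<close>. The entry
    \<open>c k a\<close> is \<open>0\<close> at \<open>p\<close>, so the reduced matrix is again the
    identity there.\<close>
  define c' where "c' k j z = c k j z - c k a z / c a a z * c a j z" for k j z
  have sc': "smooth_near p (c' k j)" if "k \<in> K" "j \<in> K" for k j
    unfolding c'_def[abs_def] using that insert.prems ca
    by (intro smooth_near_diff smooth_near_mult smooth_near_divide) auto
  have K: "mspan G (x k)" if "k \<in> K" for k
  proof (rule insert.IH[OF that, of c'])
    show "mspan G (\<lambda>z. \<Sum>j\<in>K. c' k j z * x j z)" if k: "k \<in> K" for k
    proof (rule mspan.eq)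
      show "mspan G (\<lambda>z. (\<Sum>j\<in>insert a K. c k j z * x j z) - (c k a z / c a a z) * (\<Sum>j\<in>insert a K. c a j z * x j z))"
        using insert.prems(5)[of a] insert.prems(5)[of k] k insert.prems ca
        by (intro mspan_diff mspan.scale smooth_near_divide) auto
      show "smooth_near p (\<lambda>z. \<Sum>j\<in>K. c' k j z * x j z)"
        using sc' k insert.prems by (intro smooth_near_sum smooth_near_mult) auto
      have "\<forall>\<^sub>F z in nhds p. (\<Sum>j\<in>insert a K. c k j z * x j z) - (c k a z / c a a z) * (\<Sum>j\<in>insert a K. c a j z * x j z)
         = (\<Sum>j\<in>K. c' k j z * x j z)"
        using smooth_near_nonzero[OF ca]
      proof eventually_elim
        case (elim z)
        then show ?case
          using insert.hyps by (simp add: c'_def sum_subtractf sum_distrib_left algebra_simps)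
      qed
      then show "eqM (\<lambda>z. (\<Sum>j\<in>insert a K. c k j z * x j z) - (c k a z / c a a z) * (\<Sum>j\<in>insert a K. c a j z * x j z))
         (\<lambda>z. \<Sum>j\<in>K. c' k j z * x j z)" by (rule eqM_near)
    qed
    show "c' k j p = (if k = j then 1 else 0)" if "k \<in> K" "j \<in> K" for k j
    proof -
      have "c k a p = 0" using that insert.prems(4)[of k a] insert.hyps by auto
      then show ?thesis using that insert.prems(4)[of k j] by (simp add: c'_def)
    qed
  qed (use sc' insert.prems in auto)
  \<comment> \<open>Back substitution in the row of \<open>a\<close>.\<close>
  have "mspan G (x a)"
  proof (rule mspan.eq)
    show "mspan G (\<lambda>z. inverse (c a a z) * ((\<Sum>j\<in>insert a K. c a j z * x j z) - (\<Sum>j\<in>K. c a j z * x j z)))"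
      by (rule mspan.scale[OF smooth_near_inverse[OF ca] mspan_diff[OF insert.prems(5) mspan_sum]])
        (use insert.prems(3) K in \<open>auto intro: mspan.scale\<close>)
    have "\<forall>\<^sub>F z in nhds p. inverse (c a a z) * ((\<Sum>j\<in>insert a K. c a j z * x j z) - (\<Sum>j\<in>K. c a j z * x j z)) = x a z"
      using smooth_near_nonzero[OF ca]
    proof eventually_elim
      case (elim z)
      then show ?case using insert.hyps by (simp add: field_simps)
    qed
    then show "eqM (\<lambda>z. inverse (c a a z) * ((\<Sum>j\<in>insert a K. c a j z * x j z) - (\<Sum>j\<in>K. c a j z * x j z))) (x a)"
      by (rule eqM_near)
  qed (use insert.prems in auto)
  with K show ?case using insert.prems(1) by auto
qed auto

section \<open>Tangential vector fields\<close>

text \<open>The index \<open>N\<close> is included for uniformity: near \<open>p\<close>, \<open>\<phi> N = -1\<close> and \<open>L N = 0\<close>.\<close>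

definition \<phi> :: "'n \<Rightarrow> complex ^ 'n \<Rightarrow> complex" where
  "\<phi> j z = - dz j R z / dz N R z"

definition L :: "'n \<Rightarrow> (complex ^ 'n \<Rightarrow> complex) \<Rightarrow> complex ^ 'n \<Rightarrow> complex" where
  "L j f z = dz j f z + \<phi> j z * dz N f z"

definition Lb :: "'n \<Rightarrow> (complex ^ 'n \<Rightarrow> complex) \<Rightarrow> complex ^ 'n \<Rightarrow> complex" where
  "Lb j f z = dzbar j f z + cnj (\<phi> j z) * dzbar N f z"

text \<open>\<open>X j\<close> acts as \<open>dz j\<close> on functions annihilated by all \<open>dzbar k\<close>.\<close>

definition X :: "'n \<Rightarrow> (complex ^ 'n \<Rightarrow> complex) \<Rightarrow> complex ^ 'n \<Rightarrow> complex" where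
  "X j f z = dz j f z - dz j R z / dzbar N R z * dzbar N f z"

lemma dzbar_R: "\<forall>\<^sub>F z in nhds p. \<forall>j. dzbar j R z = cnj (dz j R z)"
  using smooth_near_eventually[OF smooth_rho]
  by eventually_elim (simp add: dzbar_of_real smooth_near_differentiable)

lemma dzbar_N: "dzbar N R p \<noteq> 0"
  using eventually_nhds_x_imp_x[OF dzbar_R] dz_N by simp

lemma smooth_phi: "smooth_near p (\<phi> j)"
  unfolding \<phi>_def[abs_def] by (intro smooth_near_divide smooth_near_minus smooth_near_dz smooth_R dz_N)

lemma phi_N: "\<forall>\<^sub>F z in nhds p. \<phi> N z = -1"
  using smooth_near_nonzero[OF smooth_near_dz[OF smooth_R] dz_N] by eventually_elim (simp add: \<phi>_def)

lemma field_eq: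
  "L j = vector_field (\<lambda>k z. (if k = j then 1 else 0) + (if k = N then \<phi> j z else 0)) (\<lambda>k z. 0)"
  "Lb j = vector_field (\<lambda>k z. 0) (\<lambda>k z. (if k = j then 1 else 0) + (if k = N then cnj (\<phi> j z) else 0))"
  "X j = vector_field (\<lambda>k z. if k = j then 1 else 0) (\<lambda>k z. if k = N then - (dz j R z / dzbar N R z) else 0)"
  unfolding fun_eq_iff L_def Lb_def X_def vector_field_def
  by (simp_all add: distrib_right sum.distrib if_distrib[of "\<lambda>x. x * _"] cong: if_cong)

lemma L_R: "\<forall>\<^sub>F z in nhds p. L j R z = 0"
  using smooth_near_nonzero[OF smooth_near_dz[OF smooth_R] dz_N]
  by eventually_elim (simp add: L_def \<phi>_def)

lemma Lb_R: "\<forall>\<^sub>F z in nhds p. Lb j R z = 0"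
  using smooth_near_nonzero[OF smooth_near_dz[OF smooth_R] dz_N] dzbar_R
  by eventually_elim (simp add: Lb_def \<phi>_def)

lemma X_R: "\<forall>\<^sub>F z in nhds p. X j R z = 0"
  using smooth_near_nonzero[OF smooth_near_dzbar[OF smooth_R] dzbar_N]
  by eventually_elim (simp add: X_def)

lemma smooth_if: "(P \<Longrightarrow> smooth_near p f) \<Longrightarrow> (\<not> P \<Longrightarrow> smooth_near p g) \<Longrightarrow> smooth_near p (\<lambda>z. if P then f z else g z)"
  by (cases P) auto

lemma tangential_L: "tangential (L j)"
  unfolding tangential_def
  by (rule exI, rule exI, rule conjI[rotated], rule conjI[rotated], rule conjI, rule field_eq(1), rule eqM_near[OF L_R])
     (auto intro!: smooth_near_add smooth_if smooth_phi)

lemma tangential_Lb: "tangential (Lb j)"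
  unfolding tangential_def
  by (rule exI, rule exI, rule conjI[rotated], rule conjI[rotated], rule conjI, rule field_eq(2), rule eqM_near[OF Lb_R])
     (auto intro!: smooth_near_add smooth_if smooth_phi smooth_near_cnj)

lemma tangential_X: "tangential (X j)"
  unfolding tangential_def
  by (rule exI, rule exI, rule conjI[rotated], rule conjI[rotated], rule conjI, rule field_eq(3), rule eqM_near[OF X_R])
     (auto intro!: smooth_if smooth_near_minus smooth_near_divide smooth_near_dz smooth_near_dzbar smooth_R dzbar_N)

lemma tangential_lincomb:
  assumes "\<And>i. i \<in> I \<Longrightarrow> tangential (Y i)"
  shows "tangential (\<lambda>f z. \<Sum>i\<in>I. c i * Y i f z)"
proof -
  obtain a b where ab: "\<And>i. i \<in> I \<Longrightarrow> (\<forall>j. smooth_near p (a i j)) \<and> (\<forall>j. smooth_near p (b i j)) \<and>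
     Y i = vector_field (a i) (b i) \<and> eqM (Y i R) (\<lambda>z. 0)"
    using assms unfolding tangential_def by metis
  have "(\<lambda>f z. \<Sum>i\<in>I. c i * Y i f z)
      = vector_field (\<lambda>j z. \<Sum>i\<in>I. c i * a i j z) (\<lambda>j z. \<Sum>i\<in>I. c i * b i j z)"
  proof (intro ext)
    fix f z
    have "(\<Sum>i\<in>I. c i * Y i f z) = (\<Sum>i\<in>I. (\<Sum>j\<in>UNIV. c i * a i j z * dz j f z) + (\<Sum>j\<in>UNIV. c i * b i j z * dzbar j f z))"
      using ab by (intro sum.cong) (auto simp: vector_field_def sum_distrib_left distrib_left mult.assoc)
    also have "\<dots> = vector_field (\<lambda>j z. \<Sum>i\<in>I. c i * a i j z) (\<lambda>j z. \<Sum>i\<in>I. c i * b i j z) f z"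
      unfolding vector_field_def sum.distrib sum_distrib_right
      by (intro arg_cong2[where f = "(+)"] sum.swap)
    finally show "(\<Sum>i\<in>I. c i * Y i f z)
      = vector_field (\<lambda>j z. \<Sum>i\<in>I. c i * a i j z) (\<lambda>j z. \<Sum>i\<in>I. c i * b i j z) f z" .
  qed
  moreover have "eqM (\<lambda>z. \<Sum>i\<in>I. c i * Y i R z) (\<lambda>z. \<Sum>i\<in>I. c i * 0)"
    using ab by (intro eqM_sum eqM_mult) (metis eqM_refl)+
  ultimately show ?thesis
    unfolding tangential_def using ab
    by (intro exI conjI) (auto intro!: smooth_near_sum smooth_near_mult)
qed

lemma L_cnj: "f differentiable (at z) \<Longrightarrow> L j (\<lambda>z. cnj (f z)) z = cnj (Lb j f z)"
  and Lb_cnj: "f differentiable (at z) \<Longrightarrow> Lb j (\<lambda>z. cnj (f z)) z = cnj (L j f z)"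
  by (simp_all add: L_def Lb_def dz_cnj dzbar_cnj)

text \<open>The commutator is a multiple of \<open>dzbar N\<close>; as it annihilates \<open>\<rho>\<close>, the factor vanishes.\<close>

lemma Lb_commute:
  assumes "smooth_near p f"
  shows "\<forall>\<^sub>F z in nhds p. Lb i (Lb j f) z = Lb j (Lb i f) z"
proof -
  have exp: "\<forall>\<^sub>F z in nhds p. Lb i (Lb j f) z - Lb j (Lb i f) z
      = (Lb i (\<lambda>z. cnj (\<phi> j z)) z - Lb j (\<lambda>z. cnj (\<phi> i z)) z) * dzbar N f z"
    if f: "smooth_near p f" for f
    using smooth_near_eventually[OF f] smooth_near_eventually[OF smooth_near_dzbar[OF f, of i]]
      smooth_near_eventually[OF smooth_near_dzbar[OF f, of j]] smooth_near_eventually[OF smooth_near_dzbar[OF f, of N]]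
      smooth_near_eventually[OF smooth_near_cnj[OF smooth_phi[of i]]] smooth_near_eventually[OF smooth_near_cnj[OF smooth_phi[of j]]]
  proof eventually_elim
    case (elim z)
    have d: "dzbar i f differentiable (at z)" "dzbar j f differentiable (at z)" "dzbar N f differentiable (at z)"
      "(\<lambda>z. cnj (\<phi> i z)) differentiable (at z)" "(\<lambda>z. cnj (\<phi> j z)) differentiable (at z)"
      using elim smooth_near_differentiable by blast+
    then have m: "(\<lambda>z. cnj (\<phi> i z) * dzbar N f z) differentiable (at z)" "(\<lambda>z. cnj (\<phi> j z) * dzbar N f z) differentiable (at z)"
      by (auto intro: differentiable_mult)
    have "dzbar k (Lb l f) z = dzbar k (dzbar l f) z
        + (dzbar k (\<lambda>z. cnj (\<phi> l z)) z * dzbar N f z + cnj (\<phi> l z) * dzbar k (dzbar N f) z)"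
      if "l \<in> {i, j}" for k l
      unfolding Lb_def[abs_def] using that d m by (auto simp: dzbar_add dzbar_mult)
    then show ?case
      unfolding Lb_def[of i "Lb j f"] Lb_def[of j "Lb i f"] Lb_def[of i "\<lambda>z. cnj (\<phi> j z)"] Lb_def[of j "\<lambda>z. cnj (\<phi> i z)"]
      using dz_dz_commute(3)[OF elim(1), of i j] dz_dz_commute(3)[OF elim(1), of i N] dz_dz_commute(3)[OF elim(1), of j N]
      by (simp add: algebra_simps)
  qed
  have Lb0: "\<forall>\<^sub>F z in nhds p. Lb k (Lb l R) z = 0" for k l
  proof -
    have "\<forall>\<^sub>F z in nhds p. \<forall>\<^sub>F y in nhds z. Lb l R y = 0"
      using Lb_R by (simp add: eventually_eventually)
    then show ?thesis
    proof eventually_elim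
      case (elim z)
      then show ?case using dzbar_cong[OF elim] by (simp add: Lb_def[of k])
    qed
  qed
  have "\<forall>\<^sub>F z in nhds p. Lb i (\<lambda>z. cnj (\<phi> j z)) z - Lb j (\<lambda>z. cnj (\<phi> i z)) z = 0"
    using exp[OF smooth_R] Lb0[of i j] Lb0[of j i] smooth_near_nonzero[OF smooth_near_dzbar[OF smooth_R] dzbar_N]
    by eventually_elim auto
  with exp[OF assms] show ?thesis by eventually_elim auto
qed

text \<open>A \<open>(0,1)\<close> field with constant coefficients in the frame \<open>Lb\<close>.
  Constancy makes it commute with every \<open>Lb j\<close> along \<open>M\<close>, and varying
  \<open>c\<close> recovers all words by polarisation.\<close>

definition K :: "('n \<Rightarrow> complex) \<Rightarrow> (complex ^ 'n \<Rightarrow> complex) \<Rightarrow> complex ^ 'n \<Rightarrow> complex" where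
  "K c f z = (\<Sum>j\<in>UNIV. c j * Lb j f z)"

lemma tangential_K: "tangential (K c)"
  unfolding K_def[abs_def] by (rule tangential_lincomb[OF tangential_Lb])

lemma tangential_funpow_smooth:
  assumes "tangential Y" "smooth_near p f" shows "smooth_near p ((Y ^^ n) f)"
  using assms by (induction n) (auto intro: tangential_smooth)

lemma tangential_funpow_eqM:
  assumes "tangential Y" "smooth_near p f" "smooth_near p g" "eqM f g"
  shows "eqM ((Y ^^ n) f) ((Y ^^ n) g)"
  using tangential_eqM[OF assms(1) tangential_funpow_smooth[OF assms(1,2)] tangential_funpow_smooth[OF assms(1,3)]]
  by (induction n) (simp_all add: assms(4))

lemma tangential_foldr_smooth:
  assumes "\<And>j. tangential (Y j)" "smooth_near p f" shows "smooth_near p (foldr Y w f)"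
  using assms by (induction w) (auto intro: tangential_smooth)

lemma tangential_foldr_eqM:
  assumes "\<And>j. tangential (Y j)" "smooth_near p f" "smooth_near p g" "eqM f g"
  shows "eqM (foldr Y w f) (foldr Y w g)"
proof (induction w)
  case (Cons j w)
  from tangential_eqM[OF assms(1) tangential_foldr_smooth[OF assms(1,2)] tangential_foldr_smooth[OF assms(1,3)] this]
  show ?case by simp
qed (simp add: assms(4))

lemma tangential_foldr_sum:
  assumes Y: "\<And>j. tangential (Y j)" and f: "\<And>k. k \<in> I \<Longrightarrow> smooth_near p (f k)"
  shows "eqM (foldr Y w (\<lambda>z. \<Sum>k\<in>I. \<mu> k * f k z)) (\<lambda>z. \<Sum>k\<in>I. \<mu> k * foldr Y w (f k) z)"
proof (induction w)
  case (Cons j w)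
  have s: "smooth_near p (foldr Y w (\<lambda>z. \<Sum>k\<in>I. \<mu> k * f k z))"
    by (rule tangential_foldr_smooth[OF Y smooth_near_sum[OF smooth_near_mult[OF smooth_near_const f]]])
  have sk: "smooth_near p (foldr Y w (f k))" if "k \<in> I" for k using tangential_foldr_smooth[of Y, OF Y f[OF that]] .
  have sm: "smooth_near p (\<lambda>z. \<mu> k * foldr Y w (f k) z)" if "k \<in> I" for k
    by (rule smooth_near_mult[OF smooth_near_const sk[OF that]])
  have "eqM (Y j (foldr Y w (\<lambda>z. \<Sum>k\<in>I. \<mu> k * f k z))) (Y j (\<lambda>z. \<Sum>k\<in>I. \<mu> k * foldr Y w (f k) z))"
    by (rule tangential_eqM[OF Y s smooth_near_sum[OF sm] Cons])
  also have "eqM \<dots> (\<lambda>z. \<Sum>k\<in>I. Y j (\<lambda>z. \<mu> k * foldr Y w (f k) z) z)"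
    by (rule tangential_sum[OF Y sm])
  also have "eqM \<dots> (\<lambda>z. \<Sum>k\<in>I. \<mu> k * Y j (foldr Y w (f k)) z)"
    using sk by (intro eqM_sum tangential_cmult Y) auto
  finally show ?case by simp
qed simp

lemma K_Lb_commute:
  assumes "smooth_near p f"
  shows "eqM (Lb j (K c f)) (K c (Lb j f))"
proof -
  note s = tangential_smooth[OF tangential_Lb assms]
  have "eqM (Lb j (K c f)) (\<lambda>z. \<Sum>k\<in>UNIV. Lb j (\<lambda>z. c k * Lb k f z) z)"
    unfolding K_def[abs_def] using s by (intro tangential_sum tangential_Lb smooth_near_mult) auto
  also have "eqM \<dots> (\<lambda>z. \<Sum>k\<in>UNIV. c k * Lb j (Lb k f) z)"
    using s by (intro eqM_sum tangential_cmult tangential_Lb) auto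
  also have "eqM \<dots> (K c (Lb j f))"
    unfolding K_def[abs_def]
    using Lb_commute[OF assms] by (intro eqM_sum eqM_mult eqM_near) auto
  finally show ?thesis .
qed

lemma K_funpow_Lb_commute:
  assumes "smooth_near p f"
  shows "eqM (Lb j ((K c ^^ n) f)) ((K c ^^ n) (Lb j f))"
proof (induction n)
  case (Suc n)
  have "eqM (Lb j (K c ((K c ^^ n) f))) (K c (Lb j ((K c ^^ n) f)))"
    by (rule K_Lb_commute[OF tangential_funpow_smooth[OF tangential_K assms]])
  also have "eqM \<dots> (K c ((K c ^^ n) (Lb j f)))"
    by (rule tangential_eqM[OF tangential_K tangential_smooth[OF tangential_Lb tangential_funpow_smooth[OF tangential_K assms]]
          tangential_funpow_smooth[OF tangential_K tangential_smooth[OF tangential_Lb assms]] Suc])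
  finally show ?case by simp
qed simp

text \<open>Polarisation: the coefficient of \<open>t\<close> in \<open>(K c + t Lb j)\<^sup>n\<close> is \<open>n K c\<^sup>n\<^sup>-\<^sup>1 Lb j\<close>.\<close>

lemma K_funpow_expansion:
  assumes f: "smooth_near p f"
  shows "\<exists>e. (\<forall>i. smooth_near p (e i)) \<and> (\<forall>i>n. e i = (\<lambda>z. 0)) \<and> eqM (e 0) ((K c ^^ n) f)
    \<and> eqM (e 1) (\<lambda>z. of_nat n * (K c ^^ (n - 1)) (Lb j f) z)
    \<and> (\<forall>t. eqM ((K (\<lambda>k. c k + (if k = j then t else 0)) ^^ n) f) (\<lambda>z. \<Sum>i\<le>n. t ^ i * e i z))"
proof (induction n)
  case 0
  show ?case by (rule exI[of _ "\<lambda>i. if i = 0 then f else (\<lambda>z. 0)"]) (use f in auto)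
next
  case (Suc n)
  then obtain e where e: "\<And>i. smooth_near p (e i)" "\<And>i. i > n \<Longrightarrow> e i = (\<lambda>z. 0)" "eqM (e 0) ((K c ^^ n) f)"
    "eqM (e 1) (\<lambda>z. of_nat n * (K c ^^ (n - 1)) (Lb j f) z)"
    "\<And>t. eqM ((K (\<lambda>k. c k + (if k = j then t else 0)) ^^ n) f) (\<lambda>z. \<Sum>i\<le>n. t ^ i * e i z)" by blast
  \<comment> \<open>The coefficient of \<open>t ^ i\<close> in \<open>(K c + t Lb j)\<close> applied
    to the sum of the \<open>t ^ i * e i\<close>. The case \<open>i = 0\<close> is split off because
    \<open>i - 1\<close> would again be \<open>0\<close>.\<close>
  define e' where "e' i = (\<lambda>z. K c (e i) z + (if i = 0 then 0 else Lb j (e (i - 1)) z))" for i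
  note sK = tangential_funpow_smooth[OF tangential_K]
  have s': "smooth_near p (e' i)" for i
    unfolding e'_def by (cases i) (auto intro!: smooth_near_add tangential_smooth[OF tangential_K] tangential_smooth[OF tangential_Lb] e)
  have z': "e' i = (\<lambda>z. 0)" if "i > Suc n" for i
  proof -
    have "e i = (\<lambda>z. 0)" "e (i - 1) = (\<lambda>z. 0)" using that by (auto intro!: e(2))
    then show ?thesis
      using tangential_const[OF tangential_K, of c 0] tangential_const[OF tangential_Lb, of j 0]
      by (cases "i = 0") (simp_all add: e'_def)
  qed
  have e0: "eqM (e' 0) ((K c ^^ Suc n) f)"
    unfolding e'_def using tangential_eqM[OF tangential_K e(1) sK[OF f] e(3)] by simp
  have "eqM (e' 1) (\<lambda>z. K c (\<lambda>z. of_nat n * (K c ^^ (n - 1)) (Lb j f) z) z + Lb j ((K c ^^ n) f) z)"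
    unfolding e'_def
    using eqM_add[OF tangential_eqM[OF tangential_K e(1) smooth_near_mult[OF smooth_near_const sK[OF tangential_smooth[OF tangential_Lb f]]] e(4)]
        tangential_eqM[OF tangential_Lb e(1) sK[OF f] e(3)]] by simp
  also have "eqM \<dots> (\<lambda>z. of_nat n * K c ((K c ^^ (n - 1)) (Lb j f)) z + (K c ^^ n) (Lb j f) z)"
    by (rule eqM_add[OF tangential_cmult[OF tangential_K sK[OF tangential_smooth[OF tangential_Lb f]]] K_funpow_Lb_commute[OF f]])
  also have "(\<lambda>z. of_nat n * K c ((K c ^^ (n - 1)) (Lb j f)) z + (K c ^^ n) (Lb j f) z) = (\<lambda>z. of_nat (Suc n) * (K c ^^ (Suc n - 1)) (Lb j f) z)"
    by (cases n) (auto simp: algebra_simps)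
  finally have e1: "eqM (e' 1) (\<lambda>z. of_nat (Suc n) * (K c ^^ (Suc n - 1)) (Lb j f) z)" .
  have et: "eqM ((K (\<lambda>k. c k + (if k = j then t else 0)) ^^ Suc n) f) (\<lambda>z. \<Sum>i\<le>Suc n. t ^ i * e' i z)" for t
  proof -
    let ?K = "K (\<lambda>k. c k + (if k = j then t else 0))"
    have Kt: "?K g z = K c g z + t * Lb j g z" for g z
      by (simp add: K_def distrib_right sum.distrib if_distrib[of "\<lambda>x. x * _"] cong: if_cong)
    have "eqM (?K ((?K ^^ n) f)) (?K (\<lambda>z. \<Sum>i\<le>n. t ^ i * e i z))"
      by (rule tangential_eqM[OF tangential_K sK[OF f] smooth_near_sum[OF smooth_near_mult[OF smooth_near_const e(1)]] e(5)])
    also have "eqM \<dots> (\<lambda>z. \<Sum>i\<le>n. ?K (\<lambda>z. t ^ i * e i z) z)"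
      by (rule tangential_sum[OF tangential_K smooth_near_mult[OF smooth_near_const e(1)]])
    also have "eqM \<dots> (\<lambda>z. \<Sum>i\<le>n. t ^ i * ?K (e i) z)"
      by (rule eqM_sum[OF tangential_cmult[OF tangential_K e(1)]])
    also have "(\<lambda>z. \<Sum>i\<le>n. t ^ i * ?K (e i) z) = (\<lambda>z. \<Sum>i\<le>Suc n. t ^ i * e' i z)"
    proof
      fix z
      have "K c (e (Suc n)) z = 0" using e(2)[of "Suc n"] tangential_const[OF tangential_K, of c 0] by simp
      then have "(\<Sum>i\<le>n. t ^ i * ?K (e i) z) = (\<Sum>i\<le>Suc n. t ^ i * K c (e i) z) + (\<Sum>i\<le>n. t ^ Suc i * Lb j (e i) z)"
        unfolding Kt by (simp add: distrib_left sum.distrib mult_ac)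
      also have "(\<Sum>i\<le>n. t ^ Suc i * Lb j (e i) z) = (\<Sum>i\<le>Suc n. t ^ i * (if i = 0 then 0 else Lb j (e (i - 1)) z))"
        by (subst sum.atMost_Suc_shift) simp
      finally show "(\<Sum>i\<le>n. t ^ i * ?K (e i) z) = (\<Sum>i\<le>Suc n. t ^ i * e' i z)"
        by (simp only: e'_def distrib_left sum.distrib)
    qed
    finally show ?thesis by simp
  qed
  show ?case using s' z' e0 e1 et by blast
qed

text \<open>With \<open>c\<close> shifted by \<open>t\<close> in the entry \<open>j\<close>, the
  value at \<open>p\<close> is a polynomial in \<open>t\<close> that vanishes identically, so its
  linear coefficient vanishes. This strips the last letter \<open>j\<close> of the word and leaves
  the same hypothesis for \<open>Lb j f\<close>, one power lower.\<close>

lemma K_funpow_polarisation: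
  assumes "smooth_near p f" "\<And>c. (K c ^^ n) f p = 0" "length w = n"
  shows "foldr Lb w f p = 0"
  using assms
proof (induction n arbitrary: f w)
  case 0
  then show ?case by simp
next
  case (Suc n)
  obtain v j where w: "w = v @ [j]" "length v = n" using Suc.prems(3) by (metis length_append_singleton lessI rev_exhaust length_Suc_conv_rev Suc_inject)
  have "(K c ^^ n) (Lb j f) p = 0" for c
  proof -
    from K_funpow_expansion[OF Suc.prems(1), of "Suc n" c j]
    obtain e where e: "eqM (e 1) (\<lambda>z. of_nat (Suc n) * (K c ^^ n) (Lb j f) z)"
      "\<And>t. eqM ((K (\<lambda>k. c k + (if k = j then t else 0)) ^^ Suc n) f) (\<lambda>z. \<Sum>i\<le>Suc n. t ^ i * e i z)" by auto
    have "(\<Sum>i\<le>Suc n. e i p * t ^ i) = 0" for t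
      using eqM_at[OF e(2)[of t]] Suc.prems(2) by (simp add: mult.commute)
    then have "\<forall>i\<le>Suc n. e i p = 0" using polyfun_eq_0[of "\<lambda>i. e i p" "Suc n"] by blast
    then have "e 1 p = 0" by simp
    with eqM_at[OF e(1)] have "of_nat (Suc n) * (K c ^^ n) (Lb j f) p = 0" by metis
    then show ?thesis by (metis mult_eq_0_iff of_nat_neq_0)
  qed
  then show ?case
    using Suc.IH[OF tangential_smooth[OF tangential_Lb Suc.prems(1)] _ w(2)] w(1) by simp
qed

section \<open>Order of vanishing along a vector field\<close>

definition ord_ge :: "('n \<Rightarrow> complex) \<Rightarrow> nat \<Rightarrow> (complex ^ 'n \<Rightarrow> complex) \<Rightarrow> bool" where
  "ord_ge c s f \<longleftrightarrow> smooth_near p f \<and> (\<forall>b<s. (K c ^^ b) f p = 0)"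

lemma ord_ge_smooth: "ord_ge c s f \<Longrightarrow> smooth_near p f" by (simp add: ord_ge_def)

lemma ord_ge_K: "ord_ge c (Suc s) f \<Longrightarrow> ord_ge c s (K c f)"
  unfolding ord_ge_def using tangential_smooth[OF tangential_K] by (metis Suc_mono comp_apply funpow_Suc_right)

lemma K_funpow_add:
  assumes "smooth_near p f" "smooth_near p g"
  shows "eqM ((K c ^^ n) (\<lambda>z. f z + g z)) (\<lambda>z. (K c ^^ n) f z + (K c ^^ n) g z)"
proof (induction n)
  case (Suc n)
  note s = tangential_funpow_smooth[OF tangential_K assms(1)] tangential_funpow_smooth[OF tangential_K assms(2)]
  have "eqM (K c ((K c ^^ n) (\<lambda>z. f z + g z))) (K c (\<lambda>z. (K c ^^ n) f z + (K c ^^ n) g z))"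
    by (rule tangential_eqM[OF tangential_K tangential_funpow_smooth[OF tangential_K smooth_near_add[OF assms]] smooth_near_add[OF s] Suc])
  also have "eqM \<dots> (\<lambda>z. K c ((K c ^^ n) f) z + K c ((K c ^^ n) g) z)"
    by (intro tangential_add tangential_K s)
  finally show ?case by simp
qed simp

lemma K_funpow_Suc_mult:
  assumes "smooth_near p f" "smooth_near p g"
  shows "(K c ^^ Suc n) (\<lambda>z. f z * g z) p = (K c ^^ n) (\<lambda>z. K c f z * g z) p + (K c ^^ n) (\<lambda>z. f z * K c g z) p"
proof -
  note s = tangential_smooth[OF tangential_K[of c]]
  have "eqM ((K c ^^ n) (K c (\<lambda>z. f z * g z))) ((K c ^^ n) (\<lambda>z. K c f z * g z + f z * K c g z))"
    by (intro tangential_funpow_eqM tangential_K tangential_mult s smooth_near_mult smooth_near_add assms)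
  also have "eqM \<dots> (\<lambda>z. (K c ^^ n) (\<lambda>z. K c f z * g z) z + (K c ^^ n) (\<lambda>z. f z * K c g z) z)"
    by (intro K_funpow_add smooth_near_mult s assms)
  finally have eq: "eqM ((K c ^^ n) (K c (\<lambda>z. f z * g z)))
    (\<lambda>z. (K c ^^ n) (\<lambda>z. K c f z * g z) z + (K c ^^ n) (\<lambda>z. f z * K c g z) z)" .
  show ?thesis using eqM_at[OF eq] by (simp add: funpow_swap1)
qed

text \<open>Induction on the total order; the two Leibniz terms combine by Pascal's rule. The exact
  leading coefficient is tracked because powers of \<open>\<phi>v v\<close> must keep a nonzero
  one.\<close>

lemma ord_ge_mult_aux:
  assumes "ord_ge c s f" "ord_ge c s' g" "n = s + s'"
  shows "(\<forall>b<n. (K c ^^ b) (\<lambda>z. f z * g z) p = 0) \<and>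
    (K c ^^ n) (\<lambda>z. f z * g z) p = of_nat (n choose s) * (K c ^^ s) f p * (K c ^^ s') g p"
  using assms
proof (induction n arbitrary: s s' f g)
  case 0
  then show ?case by simp
next
  case (Suc n)
  note sm = ord_ge_smooth[OF Suc.prems(1)] ord_ge_smooth[OF Suc.prems(2)]
  have 1: "(\<forall>b<n. (K c ^^ b) (\<lambda>z. K c f z * g z) p = 0) \<and>
    (K c ^^ n) (\<lambda>z. K c f z * g z) p = (if s = 0 then 0 else of_nat (n choose (s - 1)) * (K c ^^ s) f p * (K c ^^ s') g p)"
  proof (cases s)
    \<comment> \<open>Here the order of \<open>g\<close> is the full \<open>Suc n\<close>, more than
      the \<open>n\<close> derivatives left, so this Leibniz term contributes nothing.\<close>
    case 0
    have "ord_ge c 0 (K c f)" "ord_ge c n g"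
      using Suc.prems 0 sm tangential_smooth[OF tangential_K] by (auto simp: ord_ge_def)
    from Suc.IH[OF this] 0 Suc.prems show ?thesis by (auto simp: ord_ge_def)
  next
    case (Suc a)
    with Suc.prems have "ord_ge c a (K c f)" by (intro ord_ge_K) simp
    from Suc.IH[OF this Suc.prems(2)] Suc Suc.prems(3) show ?thesis by (simp add: funpow_swap1)
  qed
  have 2: "(\<forall>b<n. (K c ^^ b) (\<lambda>z. f z * K c g z) p = 0) \<and>
    (K c ^^ n) (\<lambda>z. f z * K c g z) p = (if s' = 0 then 0 else of_nat (n choose s) * (K c ^^ s) f p * (K c ^^ s') g p)"
  proof (cases s')
    case 0
    have "ord_ge c 0 (K c g)" "ord_ge c n f"
      using Suc.prems 0 sm tangential_smooth[OF tangential_K] by (auto simp: ord_ge_def)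
    from Suc.IH[OF this(2,1)] 0 Suc.prems show ?thesis by (auto simp: ord_ge_def)
  next
    case (Suc a)
    with Suc.prems have "ord_ge c a (K c g)" by (intro ord_ge_K) simp
    from Suc.IH[OF Suc.prems(1) this] Suc Suc.prems(3) show ?thesis by (simp add: funpow_swap1)
  qed
  have "(K c ^^ b) (\<lambda>z. f z * g z) p = 0" if "b < Suc n" for b
  proof (cases b)
    case 0
    then show ?thesis using Suc.prems by (cases s) (auto simp: ord_ge_def)
  next
    case (Suc b')
    then show ?thesis using 1 2 that K_funpow_Suc_mult[OF sm, where c = c and n = b'] by simp
  qed
  moreover have "(K c ^^ Suc n) (\<lambda>z. f z * g z) p = of_nat (Suc n choose s) * (K c ^^ s) f p * (K c ^^ s') g p"
    using K_funpow_Suc_mult[OF sm, where c = c and n = n] 1 2 Suc.prems(3)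
    by (cases s; cases s') (auto simp: algebra_simps)
  ultimately show ?case by blast
qed

lemma ord_ge_mult:
  assumes "ord_ge c s f" "ord_ge c s' g"
  shows "ord_ge c (s + s') (\<lambda>z. f z * g z)"
    and "(K c ^^ (s + s')) (\<lambda>z. f z * g z) p = of_nat ((s + s') choose s) * (K c ^^ s) f p * (K c ^^ s') g p"
  using ord_ge_mult_aux[OF assms refl] ord_ge_smooth[OF assms(1)] ord_ge_smooth[OF assms(2)]
  by (auto simp: ord_ge_def intro: smooth_near_mult)

text \<open>Binomial coefficients are nonzero in characteristic \<open>0\<close>, so the leading
  coefficient survives.\<close>

lemma ord_ge_power:
  assumes "ord_ge c s f"
  shows "ord_ge c (s * d) (\<lambda>z. f z ^ d) \<and> ((K c ^^ s) f p \<noteq> 0 \<longrightarrow> (K c ^^ (s * d)) (\<lambda>z. f z ^ d) p \<noteq> 0)"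
proof (induction d)
  case (Suc d)
  from ord_ge_mult[OF assms conjunct1[OF Suc]] Suc show ?case by (auto simp: binomial_eq_0_iff)
qed (simp add: ord_ge_def)

end

section \<open>The reflection identity\<close>

text \<open>A nonzero vector orthogonal to a proper \<open>S\<close> for the real inner product
  yields, after conjugation, a complex functional annihilating \<open>S\<close>. This turns
  nondegeneracy in dual form into a spanning statement.\<close>

lemma complex_subspace_eq_UNIV:
  fixes S :: "(complex ^ 'n) set"
  assumes S: "0 \<in> S" "\<And>u v. u \<in> S \<Longrightarrow> v \<in> S \<Longrightarrow> u + v \<in> S" "\<And>c v. v \<in> S \<Longrightarrow> c *s v \<in> S"
    and ann: "\<And>\<mu> :: complex ^ 'n. (\<And>v. v \<in> S \<Longrightarrow> (\<Sum>k\<in>UNIV. \<mu> $ k * v $ k) = 0) \<Longrightarrow> \<mu> = 0"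
  shows "S = UNIV"
proof (rule ccontr)
  assume ne: "S \<noteq> UNIV"
  have sc: "c *\<^sub>R v = complex_of_real c *s v" for c and v :: "complex ^ 'n"
    by (simp add: vec_eq_iff complex_eq_iff)
  have sub: "subspace S" using S by (auto simp: subspace_def sc)
  then have "span S = S" by (simp add: span_eq_iff)
  with ne have "dim S \<noteq> DIM(complex ^ 'n)" using dim_eq_full by metis
  then have "dim S < DIM(complex ^ 'n)" using dim_subset_UNIV[of S] by linarith
  then obtain a where a: "a \<noteq> 0" "\<And>y. y \<in> span S \<Longrightarrow> orthogonal a y"
    using orthogonal_to_subspace_exists by blast
  have re: "Re (\<Sum>k\<in>UNIV. cnj (a $ k) * v $ k) = 0" if "v \<in> S" for v
    using a(2)[of v] span_base[OF that]
    by (simp add: orthogonal_def inner_vec_def inner_complex_def)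
  \<comment> \<open>Only the real part is known to vanish; applying that to \<open>\<i> *s v\<close>
    gives the imaginary part.\<close>
  have "(\<Sum>k\<in>UNIV. cnj (a $ k) * v $ k) = 0" if v: "v \<in> S" for v
  proof -
    have "Re (\<i> * (\<Sum>k\<in>UNIV. cnj (a $ k) * v $ k)) = 0"
      using re[OF S(3)[OF v, of \<i>]] by (simp add: sum_distrib_left mult_ac)
    then show ?thesis using re[OF v] by (simp add: complex_eq_iff)
  qed
  then have "(\<chi> k. cnj (a $ k)) = 0" by (intro ann) simp
  then show False using a(1) by (simp add: vec_eq_iff)
qed

context hypersurface_germ begin

text \<open>Equality on a full neighbourhood, in contrast to \<open>eqM\<close>: this is what
  \<open>dz\<close> and \<open>dzbar\<close> preserve.\<close>

definition near :: "(complex ^ 'n \<Rightarrow> complex) \<Rightarrow> (complex ^ 'n \<Rightarrow> complex) \<Rightarrow> bool" where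
  "near f g \<longleftrightarrow> (\<forall>\<^sub>F z in nhds p. f z = g z)"

lemma near_refl [simp]: "near f f" by (simp add: near_def)
lemma near_sym: "near f g \<Longrightarrow> near g f" by (simp add: near_def eq_commute)
lemma near_trans [trans]: "near f g \<Longrightarrow> near g h \<Longrightarrow> near f h"
  unfolding near_def by (auto elim: eventually_elim2)
lemma near_eqM: "near f g \<Longrightarrow> eqM f g" unfolding near_def by (rule eqM_near)
lemma near_add: "near f f' \<Longrightarrow> near g g' \<Longrightarrow> near (\<lambda>z. f z + g z) (\<lambda>z. f' z + g' z)"
  unfolding near_def by (auto elim: eventually_elim2)
lemma near_cmult: "near f f' \<Longrightarrow> near (\<lambda>z. c * f z) (\<lambda>z. c * f' z)"
  unfolding near_def by (auto elim: eventually_mono)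

lemma near_dz: assumes "near f g" shows "near (dz j f) (dz j g)"
  and "near (dzbar j f) (dzbar j g)"
proof -
  have e: "\<forall>\<^sub>F z in nhds p. \<forall>\<^sub>F y in nhds z. f y = g y"
    using assms by (simp add: near_def eventually_eventually)
  show "near (dz j f) (dz j g)" using e unfolding near_def by eventually_elim (rule dz_cong)
  show "near (dzbar j f) (dzbar j g)" using e unfolding near_def by eventually_elim (rule dzbar_cong)
qed

lemma near_dz_add:
  assumes "smooth_near p f" "smooth_near p g"
  shows "near (dz j (\<lambda>z. f z + g z)) (\<lambda>z. dz j f z + dz j g z)"
    "near (dzbar j (\<lambda>z. f z + g z)) (\<lambda>z. dzbar j f z + dzbar j g z)"
  using smooth_near_eventually[OF assms(1)] smooth_near_eventually[OF assms(2)]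
  unfolding near_def
  by (eventually_elim, simp add: dz_add dzbar_add smooth_near_differentiable)+

lemma near_dz_cmult:
  assumes "smooth_near p f"
  shows "near (dz j (\<lambda>z. c * f z)) (\<lambda>z. c * dz j f z)"
    "near (dzbar j (\<lambda>z. c * f z)) (\<lambda>z. c * dzbar j f z)"
proof -
  have e: "dz j (\<lambda>z. c * f z) z = c * dz j f z" "dzbar j (\<lambda>z. c * f z) z = c * dzbar j f z" if "smooth_near z f" for z
    using dz_mult[OF differentiable_const smooth_near_differentiable[OF that], of j c]
      dzbar_mult[OF differentiable_const smooth_near_differentiable[OF that], of j c] by simp_all
  show "near (dz j (\<lambda>z. c * f z)) (\<lambda>z. c * dz j f z)"
    using smooth_near_eventually[OF assms] unfolding near_def by eventually_elim (rule e(1))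
  show "near (dzbar j (\<lambda>z. c * f z)) (\<lambda>z. c * dzbar j f z)"
    using smooth_near_eventually[OF assms] unfolding near_def by eventually_elim (rule e(2))
qed

lemma foldr_dz_add:
  assumes "smooth_near p f" "smooth_near p g"
  shows "near (foldr dz w (\<lambda>z. f z + g z)) (\<lambda>z. foldr dz w f z + foldr dz w g z)"
proof (induction w)
  case (Cons j w)
  from near_trans[OF near_dz(1)[OF this] near_dz_add(1)[OF foldr_dz_smooth[OF assms(1)] foldr_dz_smooth[OF assms(2)]]]
  show ?case by simp
qed simp

lemma foldr_dz_cmult:
  assumes "smooth_near p f"
  shows "near (foldr dz w (\<lambda>z. c * f z)) (\<lambda>z. c * foldr dz w f z)"
proof (induction w)
  case (Cons j w)
  from near_trans[OF near_dz(1)[OF this] near_dz_cmult(1)[OF foldr_dz_smooth[OF assms(1)]]]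
  show ?case by simp
qed simp

text \<open>Smooth germs that behave like boundary values of holomorphic functions.\<close>

definition hol :: "(complex ^ 'n \<Rightarrow> complex) \<Rightarrow> bool" where
  "hol f \<longleftrightarrow> smooth_near p f \<and> (\<forall>w j. eqM (dzbar j (foldr dz w f)) (\<lambda>z. 0))"

lemma hol_smooth: "hol f \<Longrightarrow> smooth_near p f" by (simp add: hol_def)

lemma hol_dzbar: "hol f \<Longrightarrow> eqM (dzbar j f) (\<lambda>z. 0)"
  unfolding hol_def by (drule conjunct2, drule spec[of _ "[]"]) simp

lemma hol_dz: "hol f \<Longrightarrow> hol (dz j f)"
  unfolding hol_def
proof (intro conjI allI)
  fix w i assume "smooth_near p f \<and> (\<forall>w j. eqM (dzbar j (foldr dz w f)) (\<lambda>z. 0))"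
  then have "eqM (dzbar i (foldr dz (w @ [j]) f)) (\<lambda>z. 0)" by blast
  then show "eqM (dzbar i (foldr dz w (dz j f))) (\<lambda>z. 0)" by simp
qed (auto intro: smooth_near_dz)

lemma hol_foldr_dz: "hol f \<Longrightarrow> hol (foldr dz w f)"
  by (induction w) (auto intro: hol_dz)

lemma hol_add: assumes "hol f" "hol g" shows "hol (\<lambda>z. f z + g z)"
proof -
  note s = hol_smooth[OF assms(1)] hol_smooth[OF assms(2)]
  have "eqM (dzbar j (foldr dz w (\<lambda>z. f z + g z))) (\<lambda>z. 0)" for w j
  proof -
    have "near (dzbar j (foldr dz w (\<lambda>z. f z + g z))) (\<lambda>z. dzbar j (foldr dz w f) z + dzbar j (foldr dz w g) z)"
      by (rule near_trans[OF near_dz(2)[OF foldr_dz_add[OF s]] near_dz_add(2)[OF foldr_dz_smooth[OF s(1)] foldr_dz_smooth[OF s(2)]]])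
    from eqM_trans[OF near_eqM[OF this] eqM_add[OF hol_dzbar[OF hol_foldr_dz[OF assms(1)]] hol_dzbar[OF hol_foldr_dz[OF assms(2)]]]]
    show ?thesis by simp
  qed
  then show ?thesis using s by (auto simp: hol_def intro: smooth_near_add)
qed

lemma hol_cmult: assumes "hol f" shows "hol (\<lambda>z. c * f z)"
proof -
  note s = hol_smooth[OF assms(1)]
  have "eqM (dzbar j (foldr dz w (\<lambda>z. c * f z))) (\<lambda>z. 0)" for w j
  proof -
    have "near (dzbar j (foldr dz w (\<lambda>z. c * f z))) (\<lambda>z. c * dzbar j (foldr dz w f) z)"
      by (rule near_trans[OF near_dz(2)[OF foldr_dz_cmult[OF s]] near_dz_cmult(2)[OF foldr_dz_smooth[OF s]]])
    from eqM_trans[OF near_eqM[OF this] eqM_mult[OF eqM_refl hol_dzbar[OF hol_foldr_dz[OF assms]]]]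
    show ?thesis by simp
  qed
  then show ?thesis using s by (auto simp: hol_def intro: smooth_near_mult)
qed

lemma hol_0: "hol (\<lambda>z. 0)"
proof -
  have "foldr dz w (\<lambda>z. 0) = (\<lambda>z. 0 :: complex)" for w :: "'n list" by (induction w) auto
  moreover have "dzbar j (\<lambda>z. 0) = (\<lambda>z. 0)" for j :: 'n by auto
  ultimately show ?thesis by (simp add: hol_def)
qed

lemma hol_sum: "(\<And>i. i \<in> I \<Longrightarrow> hol (f i)) \<Longrightarrow> hol (\<lambda>z. \<Sum>i\<in>I. f i z)"
  by (induction I rule: infinite_finite_induct) (auto intro: hol_add hol_0)

lemma hol_Lb: assumes "hol f" shows "eqM (Lb j f) (\<lambda>z. 0)"
  using eqM_add[OF hol_dzbar[OF assms, of j] eqM_mult[OF eqM_refl hol_dzbar[OF assms, of N]]]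
  by (simp add: Lb_def[abs_def])

lemma hol_K: assumes "hol f" shows "eqM (K c f) (\<lambda>z. 0)"
proof -
  have "eqM (\<lambda>z. \<Sum>j\<in>UNIV. c j * Lb j f z) (\<lambda>z. \<Sum>j\<in>(UNIV :: 'n set). c j * 0)"
    by (rule eqM_sum[OF eqM_mult[OF eqM_refl hol_Lb[OF assms]]])
  then show ?thesis by (simp add: K_def[abs_def])
qed

lemma hol_X: assumes "hol f" shows "eqM (X j f) (dz j f)"
  using eqM_diff[OF eqM_refl[of "dz j f"] eqM_mult[OF eqM_refl[of "\<lambda>z. dz j R z / dzbar N R z"] hol_dzbar[OF assms, of N]]]
  by (simp add: X_def[abs_def])

lemma L_cnj_near: "smooth_near p f \<Longrightarrow> near (L j (\<lambda>z. cnj (f z))) (\<lambda>z. cnj (Lb j f z))"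
  and Lb_cnj_near: "smooth_near p f \<Longrightarrow> near (Lb j (\<lambda>z. cnj (f z))) (\<lambda>z. cnj (L j f z))"
  unfolding near_def
  using eventually_mono[OF smooth_near_eventually, of p f "\<lambda>z. L j (\<lambda>z. cnj (f z)) z = cnj (Lb j f z)"]
    eventually_mono[OF smooth_near_eventually, of p f "\<lambda>z. Lb j (\<lambda>z. cnj (f z)) z = cnj (L j f z)"]
  by (simp_all add: L_cnj Lb_cnj smooth_near_differentiable)

end

section \<open>Modules of jets and the effect of the vector fields on the order\<close>

locale CR_family = hypersurface_germ M \<rho> p N
  for M :: "(complex ^ 'n) set" and \<rho> and p and N :: 'n +
  fixes h :: "'n \<Rightarrow> complex ^ 'n \<Rightarrow> complex"
  assumes hol_h: "hol (h i)"
begin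

text \<open>The orders are bounded strictly, so that \<open>JL 0\<close> is empty.\<close>

definition JL :: "nat \<Rightarrow> (complex ^ 'n \<Rightarrow> complex) set" where
  "JL n = {foldr dz w (h i) | w i. length w < n}"

definition JbL :: "nat \<Rightarrow> (complex ^ 'n \<Rightarrow> complex) set" where
  "JbL n = (\<lambda>g z. cnj (g z)) ` JL n"

lemma finite_JL: "finite (JL n)"
proof -
  have "JL n = (\<lambda>(w, i). foldr dz w (h i)) ` ({w. set w \<subseteq> UNIV \<and> length w < n} \<times> UNIV)"
    by (auto simp: JL_def)
  moreover have "finite {w :: 'n list. set w \<subseteq> UNIV \<and> length w < n}"
    by (rule finite_subset[OF _ finite_lists_length_le[of UNIV n]]) auto
  ultimately show ?thesis by simp
qed

lemma JL_mono: "n \<le> m \<Longrightarrow> JL n \<subseteq> JL m" unfolding JL_def by fastforce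
lemma JbL_mono: "n \<le> m \<Longrightarrow> JbL n \<subseteq> JbL m" unfolding JbL_def using JL_mono by blast

lemma JL_hol: "g \<in> JL n \<Longrightarrow> hol g" unfolding JL_def using hol_foldr_dz hol_h by blast
lemma JL_smooth: "g \<in> JL n \<Longrightarrow> smooth_near p g" using JL_hol hol_smooth by blast
lemma JbL_smooth: "g \<in> JbL n \<Longrightarrow> smooth_near p g" unfolding JbL_def using JL_smooth smooth_near_cnj by blast
lemma JL_dz: "g \<in> JL n \<Longrightarrow> dz j g \<in> JL (Suc n)"
  unfolding JL_def by (clarsimp, rename_tac w i, rule_tac x = "j # w" in exI) auto
lemma JbL_dz: "g \<in> JL n \<Longrightarrow> (\<lambda>z. cnj (dz j g z)) \<in> JbL (Suc n)"
  unfolding JbL_def using JL_dz by blast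

lemma mspan_JL_smooth: "mspan (JL n) f \<Longrightarrow> smooth_near p f" using mspan_smooth JL_smooth by blast
lemma mspan_JbL_smooth: "mspan (JbL n) f \<Longrightarrow> smooth_near p f" using mspan_smooth JbL_smooth by blast

text \<open>The module only sees values on \<open>M\<close>, where \<open>dz j\<close> is not well
  defined; \<open>X j\<close> is its tangential substitute and agrees with it on the
  generators.\<close>

lemma mspan_JL_X: assumes "mspan (JL n) f" shows "mspan (JL (Suc n)) (X j f)"
proof (rule mspan_derivation[OF assms tangential_X])
  fix g assume g: "g \<in> JL n"
  show "mspan (JL (Suc n)) (X j g)"
    by (rule mspan.eq[OF mspan.gen[OF JL_dz[OF g]] tangential_smooth[OF tangential_X JL_smooth[OF g]] eqM_sym[OF hol_X[OF JL_hol[OF g]]]])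
qed (use JL_smooth JL_mono[of n "Suc n"] in \<open>auto intro: mspan.gen\<close>)

text \<open>The field kills the generators and differentiates only coefficients, so the order does
  not grow.\<close>

lemma mspan_JL_annihilated:
  assumes "mspan (JL n) f" "tangential Y" "\<And>g. hol g \<Longrightarrow> eqM (Y g) (\<lambda>z. 0)" shows "mspan (JL n) (Y f)"
proof (rule mspan_derivation[OF assms(1,2)])
  fix g assume g: "g \<in> JL n"
  show "mspan (JL n) (Y g)"
    by (rule mspan.eq[OF mspan.zero tangential_smooth[OF assms(2) JL_smooth[OF g]] eqM_sym[OF assms(3)[OF JL_hol[OF g]]]])
qed (use JL_smooth in \<open>auto intro: mspan.gen\<close>)

lemmas mspan_JL_K = mspan_JL_annihilated[OF _ tangential_K hol_K]

lemma L_JL: assumes g: "g \<in> JL n" shows "mspan (JL (Suc n)) (L j g)"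
  unfolding L_def[abs_def]
  by (rule mspan.add[OF mspan.gen[OF JL_dz[OF g]] mspan.scale[OF smooth_phi mspan.gen[OF JL_dz[OF g]]]])

lemma mspan_JL_L: assumes "mspan (JL n) f" shows "mspan (JL (Suc n)) (L j f)"
  by (rule mspan_derivation[OF assms tangential_L])
     (use JL_smooth JL_mono[of n "Suc n"] L_JL in \<open>auto intro: mspan.gen\<close>)

lemma JL_cnj: "JL n = (\<lambda>g z. cnj (g z)) ` JbL n"
  by (simp add: JbL_def image_image)

text \<open>\<open>L j\<close> annihilates conjugates of \<open>hol\<close> germs along
  \<open>M\<close>, so the order is kept; thus arbitrarily long words in the \<open>(1,0)\<close>
  fields stay in one finitely generated module.\<close>

lemma mspan_JbL_L: assumes "mspan (JbL n) f" shows "mspan (JbL n) (L j f)"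
proof (rule mspan_derivation[OF assms tangential_L])
  fix g assume g: "g \<in> JbL n"
  then obtain g' where g': "g' \<in> JL n" "g = (\<lambda>z. cnj (g' z))" by (auto simp: JbL_def)
  have "eqM (L j g) (\<lambda>z. 0)"
    using eqM_trans[OF near_eqM[OF L_cnj_near[OF JL_smooth[OF g'(1)]]] eqM_cnj[OF hol_Lb[OF JL_hol[OF g'(1)]]]] g'(2)
    by simp
  then show "mspan (JbL n) (L j g)"
    by (rule mspan.eq[OF mspan.zero tangential_smooth[OF tangential_L JbL_smooth[OF g]] eqM_sym])
qed (use JbL_smooth in \<open>auto intro: mspan.gen\<close>)

text \<open>On a conjugate, \<open>Lb j\<close> is the conjugate of \<open>L j\<close>, which costs
  one derivative.\<close>

lemma mspan_JbL_Lb: assumes "mspan (JbL n) f" shows "mspan (JbL (Suc n)) (Lb j f)"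
proof (rule mspan_derivation[OF assms tangential_Lb])
  fix g assume g: "g \<in> JbL n"
  then obtain g' where g': "g' \<in> JL n" "g = (\<lambda>z. cnj (g' z))" by (auto simp: JbL_def)
  have "mspan (JbL (Suc n)) (\<lambda>z. cnj (L j g' z))"
    unfolding JbL_def by (rule mspan_cnj[OF L_JL[OF g'(1)]])
  then show "mspan (JbL (Suc n)) (Lb j g)"
    using mspan.eq[OF _ tangential_smooth[OF tangential_Lb JbL_smooth[OF g]] eqM_sym[OF near_eqM[OF Lb_cnj_near[OF JL_smooth[OF g'(1)]], folded g'(2)]]]
    by blast
qed (use JbL_smooth JbL_mono[of n "Suc n"] in \<open>auto intro: mspan.gen\<close>)

text \<open>On a conjugate the \<open>dz j\<close> part of \<open>X j\<close> vanishes along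
  \<open>M\<close>, and the \<open>dzbar N\<close> part produces the conjugate of one more
  \<open>dz N\<close> derivative.\<close>

lemma mspan_JbL_X: assumes "mspan (JbL n) f" shows "mspan (JbL (Suc n)) (X j f)"
proof (rule mspan_derivation[OF assms tangential_X])
  fix g assume g: "g \<in> JbL n"
  then obtain g' where g': "g' \<in> JL n" "g = (\<lambda>z. cnj (g' z))" by (auto simp: JbL_def)
  have c: "smooth_near p (\<lambda>z. - (dz j R z / dzbar N R z))"
    by (intro smooth_near_minus smooth_near_divide smooth_near_dz smooth_near_dzbar smooth_R dzbar_N)
  have "near (X j g) (\<lambda>z. cnj (dzbar j g' z) + - (dz j R z / dzbar N R z) * cnj (dz N g' z))"
    unfolding near_def g'(2) using smooth_near_eventually[OF JL_smooth[OF g'(1)]]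
    by eventually_elim (simp add: X_def dz_cnj dzbar_cnj smooth_near_differentiable)
  then have "eqM (X j g) (\<lambda>z. cnj (dzbar j g' z) + - (dz j R z / dzbar N R z) * cnj (dz N g' z))"
    by (rule near_eqM)
  also have "eqM \<dots> (\<lambda>z. cnj 0 + - (dz j R z / dzbar N R z) * cnj (dz N g' z))"
    by (rule eqM_add[OF eqM_cnj[OF hol_dzbar[OF JL_hol[OF g'(1)]]] eqM_refl])
  finally have eq: "eqM (X j g) (\<lambda>z. - (dz j R z / dzbar N R z) * cnj (dz N g' z))" by simp
  show "mspan (JbL (Suc n)) (X j g)"
    by (rule mspan.eq[OF mspan.scale[OF c mspan.gen[OF JbL_dz[OF g'(1)]]] tangential_smooth[OF tangential_X JbL_smooth[OF g]] eqM_sym[OF eq]])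
qed (use JbL_smooth JbL_mono[of n "Suc n"] in \<open>auto intro: mspan.gen\<close>)

lemma h_JL: "h i \<in> JL (Suc n)"
  unfolding JL_def by (intro CollectI exI[of _ "[]"] exI[of _ i]) simp

end

text \<open>
  \<open>h\<close> is the difference of the two maps, and the identity \<open>PQ\<close> is the difference of the two
  equations that place their values in the target hypersurface.
\<close>

locale CR_system = CR_family M \<rho> p N h
  for M :: "(complex ^ 'n) set" and \<rho> and p and N :: 'n and h +
  fixes k :: nat and P Q :: "'n \<Rightarrow> complex ^ 'n \<Rightarrow> complex"
  assumes smooth_P: "smooth_near p (P i)" and smooth_Q: "smooth_near p (Q i)"
    and PQ: "eqM (\<lambda>z. (\<Sum>i\<in>UNIV. P i z * h i z) + (\<Sum>i\<in>UNIV. Q i z * cnj (h i z))) (\<lambda>z. 0)"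
    and nondegenerate:
      "(\<And>w. length w \<le> k \<Longrightarrow> (\<Sum>i\<in>UNIV. \<mu> i * foldr Lb w (P i) p) = 0) \<Longrightarrow> \<mu> i = 0"
begin

text \<open>\<open>Lb\<close> kills \<open>h\<close>, so in the first sum every letter falls on
  \<open>P\<close>; in the conjugate part each letter raises the order by at most one.\<close>

lemma Lb_word_identity:
  "\<exists>B. mspan (JbL (Suc (length w))) B \<and> eqM (\<lambda>z. (\<Sum>i\<in>UNIV. foldr Lb w (P i) z * h i z) + B z) (\<lambda>z. 0)"
proof (induction w)
  case Nil
  have "(\<lambda>z. cnj (h i z)) \<in> JbL (Suc 0)" for i using h_JL by (auto simp: JbL_def)
  then have "mspan (JbL (Suc 0)) (\<lambda>z. \<Sum>i\<in>UNIV. Q i z * cnj (h i z))"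
    by (intro mspan_sum mspan.scale smooth_Q mspan.gen)
  with PQ show ?case by auto
next
  case (Cons j w)
  then obtain B where B: "mspan (JbL (Suc (length w))) B"
    "eqM (\<lambda>z. (\<Sum>i\<in>UNIV. foldr Lb w (P i) z * h i z) + B z) (\<lambda>z. 0)" by blast
  have sP: "smooth_near p (foldr Lb w (P i))" for i
    by (rule tangential_foldr_smooth[OF tangential_Lb smooth_P])
  note sh = hol_smooth[OF hol_h]
  note s1 = smooth_near_mult[OF sP sh]
  have s2: "smooth_near p (\<lambda>z. \<Sum>i\<in>UNIV. foldr Lb w (P i) z * h i z)"
    by (rule smooth_near_sum) (rule s1)
  have "eqM (\<lambda>z. (\<Sum>i\<in>UNIV. Lb j (foldr Lb w (P i)) z * h i z) + Lb j B z)
     (\<lambda>z. (\<Sum>i\<in>UNIV. Lb j (foldr Lb w (P i)) z * h i z + foldr Lb w (P i) z * 0) + Lb j B z)" by simp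
  also have "eqM \<dots> (\<lambda>z. (\<Sum>i\<in>UNIV. Lb j (foldr Lb w (P i)) z * h i z + foldr Lb w (P i) z * Lb j (h i) z) + Lb j B z)"
    by (rule eqM_add[OF eqM_sum[OF eqM_add[OF eqM_refl eqM_mult[OF eqM_refl eqM_sym[OF hol_Lb[OF hol_h]]]]] eqM_refl])
  also have "eqM \<dots> (\<lambda>z. (\<Sum>i\<in>UNIV. Lb j (\<lambda>z. foldr Lb w (P i) z * h i z) z) + Lb j B z)"
    by (rule eqM_add[OF eqM_sum[OF eqM_sym[OF tangential_mult[OF tangential_Lb sP sh]]] eqM_refl])
  also have "eqM \<dots> (\<lambda>z. Lb j (\<lambda>z. \<Sum>i\<in>UNIV. foldr Lb w (P i) z * h i z) z + Lb j B z)"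
    by (rule eqM_add[OF eqM_sym[OF tangential_sum[OF tangential_Lb s1]] eqM_refl])
  also have "eqM \<dots> (Lb j (\<lambda>z. (\<Sum>i\<in>UNIV. foldr Lb w (P i) z * h i z) + B z))"
    by (rule eqM_sym[OF tangential_add[OF tangential_Lb s2 mspan_JbL_smooth[OF B(1)]]])
  also have "eqM \<dots> (Lb j (\<lambda>z. 0))"
    by (rule tangential_eqM[OF tangential_Lb smooth_near_add[OF s2 mspan_JbL_smooth[OF B(1)]] smooth_near_const B(2)])
  finally have "eqM (\<lambda>z. (\<Sum>i\<in>UNIV. foldr Lb (j # w) (P i) z * h i z) + Lb j B z) (\<lambda>z. 0)"
    using tangential_const[OF tangential_Lb, of j 0] by simp
  then show ?case using mspan_JbL_Lb[OF B(1)] by auto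
qed

text \<open>By nondegeneracy, the \<open>Lb\<close>-derivatives of \<open>P\<close> at
  \<open>p\<close> along words of length at most \<open>k\<close> span, so the corresponding
  identities can be solved for \<open>h\<close>; such words bring in conjugates of derivatives of
  order at most \<open>k\<close>.\<close>

lemma h_reflection: "mspan (JbL (Suc k)) (h i)"
proof -
  \<comment> \<open>Values at \<open>p\<close> of the coefficient vectors whose combination of the
    \<open>h i\<close> lies in the module. Once this is everything, rows with unit vectors as values
    form a system that is the identity at \<open>p\<close>.\<close>
  define S where "S = {v :: complex ^ 'n. \<exists>c. (\<forall>i. smooth_near p (c i)) \<and> (\<forall>i. c i p = v $ i) \<and>
     mspan (JbL (Suc k)) (\<lambda>z. \<Sum>i\<in>UNIV. c i z * h i z)}"
  have word: "(\<chi> i. foldr Lb w (P i) p) \<in> S" if "length w \<le> k" for w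
  proof -
    obtain B where B: "mspan (JbL (Suc (length w))) B"
      "eqM (\<lambda>z. (\<Sum>i\<in>UNIV. foldr Lb w (P i) z * h i z) + B z) (\<lambda>z. 0)" using Lb_word_identity by blast
    have sP: "smooth_near p (foldr Lb w (P i))" for i
      by (rule tangential_foldr_smooth[OF tangential_Lb smooth_P])
    have m: "mspan (JbL (Suc k)) (\<lambda>z. (-1) * B z)"
      by (rule mspan_cmult[OF mspan_mono[OF B(1) JbL_mono]]) (use that in simp)
    have e: "eqM (\<lambda>z. (-1) * B z) (\<lambda>z. \<Sum>i\<in>UNIV. foldr Lb w (P i) z * h i z)"
      using B(2) unfolding eqM_def by eventually_elim (auto simp: add_eq_0_iff2)
    have "mspan (JbL (Suc k)) (\<lambda>z. \<Sum>i\<in>UNIV. foldr Lb w (P i) z * h i z)"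
      by (rule mspan.eq[OF m _ e]) (rule smooth_near_sum, rule smooth_near_mult[OF sP hol_smooth[OF hol_h]])
    with sP show ?thesis unfolding S_def
      by (intro CollectI exI[of _ "\<lambda>i. foldr Lb w (P i)"]) auto
  qed
  have "S = UNIV"
  proof (rule complex_subspace_eq_UNIV)
    show "0 \<in> S" unfolding S_def by (intro CollectI exI[of _ "\<lambda>i z. 0"]) (auto intro: mspan.zero)
    show "u + v \<in> S" if u: "u \<in> S" and v: "v \<in> S" for u v
    proof -
      obtain c where c: "\<forall>i. smooth_near p (c i)" "\<forall>i. c i p = u $ i" "mspan (JbL (Suc k)) (\<lambda>z. \<Sum>i\<in>UNIV. c i z * h i z)"
        using u by (auto simp: S_def)
      obtain d where d: "\<forall>i. smooth_near p (d i)" "\<forall>i. d i p = v $ i" "mspan (JbL (Suc k)) (\<lambda>z. \<Sum>i\<in>UNIV. d i z * h i z)"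
        using v by (auto simp: S_def)
      show ?thesis unfolding S_def using c d mspan.add[OF c(3) d(3)]
        by (intro CollectI exI[of _ "\<lambda>i z. c i z + d i z"]) (auto intro: smooth_near_add simp: algebra_simps sum.distrib)
    qed
    show "a *s v \<in> S" if v: "v \<in> S" for a v
    proof -
      obtain d where d: "\<forall>i. smooth_near p (d i)" "\<forall>i. d i p = v $ i" "mspan (JbL (Suc k)) (\<lambda>z. \<Sum>i\<in>UNIV. d i z * h i z)"
        using v by (auto simp: S_def)
      show ?thesis unfolding S_def using d mspan_cmult[OF d(3), of a]
        by (intro CollectI exI[of _ "\<lambda>i z. a * d i z"]) (auto intro: smooth_near_mult simp: algebra_simps sum_distrib_left)
    qed
    show "\<mu> = 0" if "\<And>v. v \<in> S \<Longrightarrow> (\<Sum>i\<in>UNIV. \<mu> $ i * v $ i) = 0" for \<mu>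
    proof -
      have "\<mu> $ i = 0" for i
        by (rule nondegenerate) (use that[OF word] in simp)
      then show ?thesis by (simp add: vec_eq_iff)
    qed
  qed
  then have "axis i 1 \<in> S" for i by simp
  then have "\<forall>i. \<exists>c. (\<forall>j. smooth_near p (c j)) \<and> (\<forall>j. c j p = (axis i 1 :: complex ^ 'n) $ j) \<and>
     mspan (JbL (Suc k)) (\<lambda>z. \<Sum>j\<in>UNIV. c j z * h j z)" unfolding S_def by blast
  from choice[OF this] obtain c where c: "\<And>i j. smooth_near p (c i j)" "\<And>i j. c i j p = (axis i 1 :: complex ^ 'n) $ j"
     "\<And>i. mspan (JbL (Suc k)) (\<lambda>z. \<Sum>j\<in>UNIV. c i j z * h j z)" by blast
  show ?thesis
    by (rule mspan_eliminate[of UNIV h c])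
       (use c hol_smooth[OF hol_h] in \<open>auto simp: axis_def\<close>)
qed

text \<open>Each \<open>dz j\<close> is realised by \<open>X j\<close> applied to the reflection
  identity, at the price of one order of conjugates.\<close>

lemma JL_reflection: "mspan (JbL (Suc k + length w)) (foldr dz w (h i))"
proof (induction w)
  case Nil
  then show ?case using h_reflection by simp
next
  case (Cons j w)
  have "eqM (X j (foldr dz w (h i))) (dz j (foldr dz w (h i)))"
    by (rule hol_X[OF hol_foldr_dz[OF hol_h]])
  from mspan.eq[OF mspan_JbL_X[OF Cons] smooth_near_dz[OF foldr_dz_smooth[OF hol_smooth[OF hol_h]]] this]
  show ?case by simp
qed

text \<open>Origin of \<open>2 * k\<close>: the conjugate of a derivative of order at most
  \<open>k\<close> is reflected a second time, which leads to derivatives of order at most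
  \<open>k + k\<close>.\<close>

lemma JbL_JL: assumes "mspan (JbL (Suc k)) f" shows "mspan (JL (Suc (2 * k))) f"
proof (rule mspan_trans[OF assms])
  fix g assume "g \<in> JbL (Suc k)"
  then obtain w i where g: "g = (\<lambda>z. cnj (foldr dz w (h i) z))" "length w < Suc k" by (auto simp: JbL_def JL_def)
  have "mspan (JbL (Suc (2 * k))) (foldr dz w (h i))"
    by (rule mspan_mono[OF JL_reflection JbL_mono]) (use g in simp)
  from mspan_cnj[OF this] show "mspan (JL (Suc (2 * k))) g"
    unfolding g(1) JL_cnj by simp
qed

end

section \<open>Prolongation in the transversal direction\<close>

context hypersurface_germ begin

text \<open>Membership in \<open>mspan H + \<mm> G\<close>, where \<open>\<mm>\<close> is the maximal ideal of germs vanishing at \<open>p\<close>.\<close>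

inductive mod_max :: "(complex ^ 'n \<Rightarrow> complex) set \<Rightarrow> (complex ^ 'n \<Rightarrow> complex) set \<Rightarrow> (complex ^ 'n \<Rightarrow> complex) \<Rightarrow> bool"
  for H G where
  base: "mspan H f \<Longrightarrow> mod_max H G f"
| small: "smooth_near p a \<Longrightarrow> a p = 0 \<Longrightarrow> g \<in> G \<Longrightarrow> mod_max H G (\<lambda>z. a z * g z)"
| add: "mod_max H G f \<Longrightarrow> mod_max H G g \<Longrightarrow> mod_max H G (\<lambda>z. f z + g z)"
| eq: "mod_max H G f \<Longrightarrow> smooth_near p g \<Longrightarrow> eqM f g \<Longrightarrow> mod_max H G g"

lemma mod_max_scale:
  assumes "smooth_near p a" "mod_max H G f" "\<And>g. g \<in> G \<union> H \<Longrightarrow> smooth_near p g"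
  shows "mod_max H G (\<lambda>z. a z * f z)"
  using assms(2)
proof induction
  case (base f)
  then show ?case by (intro mod_max.base mspan.scale assms)
next
  case (small b g)
  have "mod_max H G (\<lambda>z. (a z * b z) * g z)"
    by (rule mod_max.small[OF smooth_near_mult[OF assms(1) small(1)] _ small(3)]) (simp add: small(2))
  then show ?case by (simp add: mult.assoc)
next
  case (add f g)
  from mod_max.add[OF add.IH] show ?case by (simp add: distrib_left)
next
  case (eq f g)
  show ?case
    by (rule mod_max.eq[OF eq.IH smooth_near_mult[OF assms(1) eq(2)] eqM_mult[OF eqM_refl eq(3)]])
qed

lemma mod_max_cmult:
  "mod_max H G f \<Longrightarrow> (\<And>g. g \<in> G \<union> H \<Longrightarrow> smooth_near p g) \<Longrightarrow> mod_max H G (\<lambda>z. a * f z)"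
  by (rule mod_max_scale) auto

lemma mod_max_sum:
  "(\<And>i. i \<in> I \<Longrightarrow> mod_max H G (f i)) \<Longrightarrow> mod_max H G (\<lambda>z. \<Sum>i\<in>I. f i z)"
  by (induction I rule: infinite_finite_induct) (auto intro: mod_max.add mod_max.base mspan.zero)

lemma mod_max_small_mspan:
  assumes a: "smooth_near p a" "a p = 0" and "mspan G f" and G: "\<And>g. g \<in> G \<union> H \<Longrightarrow> smooth_near p g"
  shows "mod_max H G (\<lambda>z. a z * f z)"
  using assms(3)
proof induction
  case zero
  then show ?case by (simp add: mod_max.base mspan.zero)
next
  case (gen g)
  then show ?case by (rule mod_max.small[OF a])
next
  case (add f g)
  from mod_max.add[OF add.IH] show ?case by (simp add: distrib_left)
next
  case (scale b f)
  from mod_max_scale[OF scale(1) scale.IH G] show ?case by (simp add: mult.left_commute)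
next
  case (eq f g)
  show ?case
    by (rule mod_max.eq[OF eq.IH smooth_near_mult[OF a(1) eq(2)] eqM_mult[OF eqM_refl eq(3)]])
qed

text \<open>Elimination works with matrices, so membership is unfolded into a row of smooth
  coefficients vanishing at \<open>p\<close>.\<close>

lemma mod_max_representation:
  assumes fin: "finite G" and G: "\<And>g. g \<in> G \<Longrightarrow> smooth_near p g" and "mod_max H G f"
  shows "\<exists>a. (\<forall>g\<in>G. smooth_near p (a g) \<and> a g p = 0) \<and> mspan H (\<lambda>z. f z - (\<Sum>g\<in>G. a g z * g z))"
  using assms(3)
proof induction
  case (base f)
  then show ?case by (intro exI[of _ "\<lambda>g z. 0"]) auto
next
  case (small b g)
  have "(\<lambda>z. b z * g z - (\<Sum>g'\<in>G. (if g' = g then b z else 0) * g' z)) = (\<lambda>z. 0)"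
    using fin small(3) by (simp add: if_distrib[of "\<lambda>x. x * _"] cong: if_cong)
  then show ?case using small mspan.zero
    by (intro exI[of _ "\<lambda>g' z. if g' = g then b z else 0"]) (auto simp del: mult_cancel_right1)
next
  case (add f f')
  then obtain a b where a: "\<forall>g\<in>G. smooth_near p (a g) \<and> a g p = 0" "mspan H (\<lambda>z. f z - (\<Sum>g\<in>G. a g z * g z))"
    and b: "\<forall>g\<in>G. smooth_near p (b g) \<and> b g p = 0" "mspan H (\<lambda>z. f' z - (\<Sum>g\<in>G. b g z * g z))" by blast
  show ?case
    by (rule exI[of _ "\<lambda>g z. a g z + b g z"])
       (use a b mspan.add[OF a(2) b(2)] in \<open>auto intro: smooth_near_add simp: algebra_simps sum.distrib\<close>)
next
  case (eq f f')
  then obtain a where a: "\<forall>g\<in>G. smooth_near p (a g) \<and> a g p = 0" "mspan H (\<lambda>z. f z - (\<Sum>g\<in>G. a g z * g z))" by blast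
  have "smooth_near p (\<lambda>z. f' z - (\<Sum>g\<in>G. a g z * g z))"
    using a(1) G by (intro smooth_near_diff eq smooth_near_sum smooth_near_mult) auto
  from mspan.eq[OF a(2) this eqM_diff[OF eq(3) eqM_refl]] a(1) show ?case by blast
qed

text \<open>Moving the coefficients in the maximal ideal to the other side leaves a matrix that is
  the identity at \<open>p\<close>, to which elimination applies.\<close>

lemma Nakayama:
  assumes fin: "finite G" and G: "\<And>g. g \<in> G \<Longrightarrow> smooth_near p g" and mm: "\<And>g. g \<in> G \<Longrightarrow> mod_max H G g"
    and g: "g \<in> G"
  shows "mspan H g"
proof -
  have "\<forall>g\<in>G. \<exists>a. (\<forall>g'\<in>G. smooth_near p (a g') \<and> a g' p = 0) \<and> mspan H (\<lambda>z. g z - (\<Sum>g'\<in>G. a g' z * g' z))"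
    using mod_max_representation[OF fin G mm] by blast
  from bchoice[OF this] obtain a where a:
    "\<And>g g'. g \<in> G \<Longrightarrow> g' \<in> G \<Longrightarrow> smooth_near p (a g g') \<and> a g g' p = 0"
    "\<And>g. g \<in> G \<Longrightarrow> mspan H (\<lambda>z. g z - (\<Sum>g'\<in>G. a g g' z * g' z))" by blast
  show ?thesis
  proof (rule mspan_eliminate[of G "\<lambda>g. g" "\<lambda>g g' z. (if g = g' then 1 else 0) - a g g' z", OF fin G])
    fix g assume g: "g \<in> G"
    have "(\<lambda>z. \<Sum>g'\<in>G. ((if g = g' then 1 else 0) - a g g' z) * g' z) = (\<lambda>z. g z - (\<Sum>g'\<in>G. a g g' z * g' z))"
      using fin g by (simp add: algebra_simps sum_subtractf if_distrib[of "\<lambda>x. _ * x"] cong: if_cong)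
    then show "mspan H (\<lambda>z. \<Sum>g'\<in>G. ((if g = g' then 1 else 0) - a g g' z) * g' z)" using a(2)[OF g] by simp
  qed (use a g in \<open>auto intro!: smooth_near_diff smooth_near_minus\<close>)
qed

lemma K_funpow_sum:
  assumes "\<And>k. k \<in> I \<Longrightarrow> smooth_near p (f k)"
  shows "eqM ((K c ^^ n) (\<lambda>z. \<Sum>k\<in>I. \<mu> k * f k z)) (\<lambda>z. \<Sum>k\<in>I. \<mu> k * (K c ^^ n) (f k) z)"
  \<comment> \<open>A power of \<open>K c\<close> is a word over a one-letter alphabet.\<close>
  using tangential_foldr_sum[of "\<lambda>_::unit. K c" I f "replicate n ()" \<mu>, OF tangential_K assms]
  by (simp add: foldr_replicate)

lemma K_funpow_eq_0:
  assumes "smooth_near p f" "\<And>w. length w = n \<Longrightarrow> foldr Lb w f p = 0"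
  shows "(K c ^^ n) f p = 0"
  using assms
proof (induction n arbitrary: f)
  case 0
  from "0.prems"(2)[of "[]"] show ?case by simp
next
  case (Suc n)
  have s: "smooth_near p (Lb j f)" for j by (rule tangential_smooth[OF tangential_Lb Suc.prems(1)])
  have z: "(K c ^^ n) (Lb j f) p = 0" for j
    by (rule Suc.IH[OF s]) (use Suc.prems(2)[of "_ @ [j]"] in simp)
  have e: "eqM ((K c ^^ n) (K c f)) (\<lambda>z. \<Sum>j\<in>UNIV. c j * (K c ^^ n) (Lb j f) z)"
    unfolding K_def[of c f, abs_def] by (rule K_funpow_sum[OF s])
  show ?case using eqM_at[OF e] z by (simp add: funpow_swap1)
qed

text \<open>\<open>s\<close> is the least length of a nonempty word that is nonzero at
  \<open>p\<close> on some \<open>\<phi> j\<close>. Polarisation finds the direction, minimality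
  handles all \<open>\<phi> j\<close> at once. The power \<open>b = 0\<close> is left out because
  \<open>\<phi> j p\<close> itself may be nonzero.\<close>

lemma exists_finite_order_direction:
  assumes "w \<noteq> []" "foldr Lb w (\<phi> j) p \<noteq> 0"
  obtains c s j where "s > 0" "\<And>j b. 0 < b \<Longrightarrow> b < s \<Longrightarrow> (K c ^^ b) (\<phi> j) p = 0" "(K c ^^ s) (\<phi> j) p \<noteq> 0"
proof -
  let ?P = "\<lambda>n. n > 0 \<and> (\<exists>j w. length w = n \<and> foldr Lb w (\<phi> j) p \<noteq> 0)"
  define s where "s = (LEAST n. ?P n)"
  have "?P (length w)" using assms by auto
  then have s: "?P s" unfolding s_def by (rule LeastI)
  then obtain j w where jw: "length w = s" "foldr Lb w (\<phi> j) p \<noteq> 0" by blast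
  obtain c where c: "(K c ^^ s) (\<phi> j) p \<noteq> 0"
    using K_funpow_polarisation[OF smooth_phi _ jw(1)] jw(2) by blast
  have "(K c ^^ b) (\<phi> j) p = 0" if "0 < b" "b < s" for j b
    by (rule K_funpow_eq_0[OF smooth_phi]) (use not_less_Least[of b ?P] that s_def in auto)
  with s c show ?thesis using that by blast
qed

section \<open>Derivatives in constant complex directions and their tangential counterparts\<close>

lemma dz_sum:
  assumes "finite I" "\<And>i. i \<in> I \<Longrightarrow> f i differentiable (at z)"
  shows "dz j (\<lambda>z. \<Sum>i\<in>I. a i * f i z) z = (\<Sum>i\<in>I. a i * dz j (f i) z)"
  using assms
proof (induction I)
  case (insert i I)
  have "dz j (\<lambda>z. a i * f i z + (\<Sum>i\<in>I. a i * f i z)) z = dz j (\<lambda>z. a i * f i z) z + dz j (\<lambda>z. \<Sum>i\<in>I. a i * f i z) z"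
    using insert by (intro dz_add differentiable_sum differentiable_mult) auto
  also have "dz j (\<lambda>z. a i * f i z) z = a i * dz j (f i) z"
    using dz_mult[OF differentiable_const, of "f i" z j "a i"] insert by simp
  finally show ?case using insert by simp
qed simp

text \<open>General directions instead of coordinates, because the extraction of transversal
  derivatives needs vectors adapted to the tangent space at \<open>p\<close> and to the leading
  coefficients of the \<open>\<phi> j\<close>.\<close>

definition DD :: "complex ^ 'n \<Rightarrow> (complex ^ 'n \<Rightarrow> complex) \<Rightarrow> complex ^ 'n \<Rightarrow> complex" where
  "DD v f z = (\<Sum>j\<in>UNIV. v $ j * dz j f z)"

definition \<phi>v :: "complex ^ 'n \<Rightarrow> complex ^ 'n \<Rightarrow> complex" where
  "\<phi>v v z = (\<Sum>j\<in>UNIV. v $ j * \<phi> j z)"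

definition \<Lambda> :: "complex ^ 'n \<Rightarrow> (complex ^ 'n \<Rightarrow> complex) \<Rightarrow> complex ^ 'n \<Rightarrow> complex" where
  "\<Lambda> v f z = (\<Sum>j\<in>UNIV. v $ j * L j f z)"

lemma \<Lambda>_eq: "\<Lambda> v f z = DD v f z + \<phi>v v z * dz N f z"
  by (simp add: \<Lambda>_def DD_def \<phi>v_def L_def distrib_left sum.distrib sum_distrib_right mult.assoc)

lemma tangential_\<Lambda>: "tangential (\<Lambda> v)"
  unfolding \<Lambda>_def[abs_def] by (rule tangential_lincomb[OF tangential_L])

lemma smooth_\<phi>v: "smooth_near p (\<phi>v v)"
  unfolding \<phi>v_def[abs_def] by (rule smooth_near_sum[OF smooth_near_mult[OF smooth_near_const smooth_phi]])

lemma DD_smooth: "smooth_near p f \<Longrightarrow> smooth_near p (DD v f)"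
  unfolding DD_def[abs_def] by (rule smooth_near_sum[OF smooth_near_mult[OF smooth_near_const smooth_near_dz]])

lemma DD_hol: "hol f \<Longrightarrow> hol (DD v f)"
  unfolding DD_def[abs_def] by (rule hol_sum[OF hol_cmult[OF hol_dz]])

lemma near_sum: "(\<And>i. i \<in> I \<Longrightarrow> near (f i) (g i)) \<Longrightarrow> near (\<lambda>z. \<Sum>i\<in>I. f i z) (\<lambda>z. \<Sum>i\<in>I. g i z)"
  by (induction I rule: infinite_finite_induct) (auto intro: near_add)

lemma near_DD: "near f g \<Longrightarrow> near (DD v f) (DD v g)"
  unfolding DD_def[abs_def] by (rule near_sum[OF near_cmult[OF near_dz(1)]])

lemma DD_axis: "DD (axis j 1) f = dz j f"
  by (simp add: fun_eq_iff DD_def axis_def if_distrib[of "\<lambda>x. x * _"] cong: if_cong)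

lemma DD_commute:
  assumes "smooth_near p f" shows "near (DD u (DD v f)) (DD v (DD u f))"
  unfolding near_def using smooth_near_eventually[OF assms]
proof eventually_elim
  case (elim z)
  have exp: "DD u (DD v f) z = (\<Sum>i\<in>UNIV. \<Sum>j\<in>UNIV. u $ i * (v $ j * dz i (dz j f) z))" for u v
    unfolding DD_def[of v, abs_def] unfolding DD_def
    by (subst dz_sum) (auto intro: smooth_near_differentiable smooth_near_dz elim simp: sum_distrib_left)
  show ?case
    unfolding exp
    by (subst sum.swap) (simp add: dz_dz_commute(1)[OF elim] mult.left_commute)
qed

lemma DD_add_left: "DD (u + a *s v) f z = DD u f z + a * DD v f z"
  by (simp add: DD_def algebra_simps sum.distrib sum_distrib_left)

lemma near_DD_add:
  assumes "smooth_near p f" "smooth_near p g"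
  shows "near (DD v (\<lambda>z. f z + a * g z)) (\<lambda>z. DD v f z + a * DD v g z)"
proof -
  have sg: "smooth_near p (\<lambda>z. a * g z)" by (rule smooth_near_mult[OF smooth_near_const assms(2)])
  have "near (dz j (\<lambda>z. f z + a * g z)) (\<lambda>z. dz j f z + a * dz j g z)" for j
    by (rule near_trans[OF near_dz_add(1)[OF assms(1) sg] near_add[OF near_refl near_dz_cmult(1)[OF assms(2)]]])
  then have "near (\<lambda>z. \<Sum>j\<in>UNIV. v $ j * dz j (\<lambda>z. f z + a * g z) z) (\<lambda>z. \<Sum>j\<in>UNIV. v $ j * (dz j f z + a * dz j g z))"
    by (rule near_sum[OF near_cmult])
  then show ?thesis by (simp add: DD_def[abs_def] algebra_simps sum.distrib sum_distrib_left)
qed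

lemma foldr_DD_smooth: "smooth_near p f \<Longrightarrow> smooth_near p (foldr DD vs f)"
  by (induction vs) (auto intro: DD_smooth)

lemma foldr_DD_near: "near f g \<Longrightarrow> near (foldr DD vs f) (foldr DD vs g)"
  by (induction vs) (auto intro: near_DD)

lemma foldr_DD_add:
  assumes "smooth_near p f" "smooth_near p g"
  shows "near (foldr DD vs (\<lambda>z. f z + a * g z)) (\<lambda>z. foldr DD vs f z + a * foldr DD vs g z)"
proof (induction vs)
  case (Cons v vs)
  from near_trans[OF near_DD[OF this] near_DD_add[OF foldr_DD_smooth[OF assms(1)] foldr_DD_smooth[OF assms(2)]]]
  show ?case by simp
qed simp

lemma foldr_DD_move:
  assumes "smooth_near p f" shows "near (foldr DD us (DD v f)) (DD v (foldr DD us f))"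
proof (induction us)
  case (Cons u us)
  from near_trans[OF near_DD[OF this] DD_commute[OF foldr_DD_smooth[OF assms]]]
  show ?case by simp
qed simp

end

text \<open>Along \<open>K c\<close> every \<open>\<phi> j\<close> deviates from its value at
  \<open>p\<close> to order at least \<open>s\<close>, and \<open>\<phi> j\<^sub>0\<close> to order
  exactly \<open>s\<close>.\<close>

locale CR_direction = CR_system M \<rho> p N h k P Q
  for M :: "(complex ^ 'n) set" and \<rho> and p and N :: 'n and h and k and P and Q +
  fixes c :: "'n \<Rightarrow> complex" and s :: nat and j\<^sub>0 :: 'n
  assumes s_pos: "s > 0" and ord_phi: "\<And>j b. 0 < b \<Longrightarrow> b < s \<Longrightarrow> (K c ^^ b) (\<phi> j) p = 0"
    and tau_nonzero: "(K c ^^ s) (\<phi> j\<^sub>0) p \<noteq> 0"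
begin

text \<open>As \<open>\<phi> j\<close> is minus the quotient of \<open>dz j R\<close> by
  \<open>dz N R\<close>, this is the holomorphic tangent space of \<open>M\<close> at
  \<open>p\<close>, a hyperplane complementary to \<open>axis N 1\<close>.\<close>

definition T :: "(complex ^ 'n) set" where "T = {v. \<phi>v v p = 0}"

text \<open>Leading coefficient of \<open>\<phi>v v\<close> along \<open>K c\<close>; linear in
  \<open>v\<close>, so \<open>T\<close> is its kernel in \<open>T\<close> plus one line.\<close>

definition \<tau> :: "complex ^ 'n \<Rightarrow> complex" where "\<tau> v = (K c ^^ s) (\<phi>v v) p"

text \<open>A derivative of order \<open>length vs + d\<close>, where \<open>d\<close> counts the
  transversal direction \<open>N\<close>.\<close>

definition mon :: "(complex ^ 'n) list \<Rightarrow> nat \<Rightarrow> 'n \<Rightarrow> complex ^ 'n \<Rightarrow> complex" where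
  "mon vs d i = foldr DD vs ((dz N ^^ d) (h i))"

abbreviation S :: "(complex ^ 'n \<Rightarrow> complex) set" where "S \<equiv> JL (Suc (2 * k))"

lemma K_funpow_phiv: "(K c ^^ b) (\<phi>v v) p = (\<Sum>j\<in>UNIV. v $ j * (K c ^^ b) (\<phi> j) p)"
proof -
  have "eqM ((K c ^^ b) (\<lambda>z. \<Sum>j\<in>UNIV. v $ j * \<phi> j z)) (\<lambda>z. \<Sum>j\<in>UNIV. v $ j * (K c ^^ b) (\<phi> j) z)"
    by (rule K_funpow_sum[OF smooth_phi])
  from eqM_at[OF this] show ?thesis by (simp add: \<phi>v_def[abs_def])
qed

lemma ord_phiv: assumes "v \<in> T" shows "ord_ge c s (\<phi>v v)"
  unfolding ord_ge_def
proof (intro conjI allI impI smooth_\<phi>v)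
  fix b assume "b < s"
  then show "(K c ^^ b) (\<phi>v v) p = 0"
    using assms ord_phi by (cases "b = 0") (auto simp: K_funpow_phiv T_def)
qed

lemma ord_phiv_Suc: assumes "v \<in> T" "\<tau> v = 0" shows "ord_ge c (Suc s) (\<phi>v v)"
  using ord_phiv[OF assms(1)] assms(2) by (auto simp: ord_ge_def \<tau>_def less_Suc_eq)

lemma hol_dz_funpow: "hol f \<Longrightarrow> hol ((dz j ^^ d) f)"
  by (induction d) (auto intro: hol_dz)

lemma hol_mon: "hol (mon vs d i)"
  unfolding mon_def by (induction vs) (auto intro: DD_hol hol_dz_funpow hol_h)

lemma mspan_DD:
  assumes "mspan (JL n) f" "hol f" shows "mspan (JL (Suc n)) (DD v f)"
proof -
  have m: "mspan (JL (Suc n)) (\<lambda>z. \<Sum>j\<in>UNIV. v $ j * X j f z)"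
    by (rule mspan_sum[OF mspan_cmult[OF mspan_JL_X[OF assms(1)]]])
  have "eqM (\<lambda>z. \<Sum>j\<in>UNIV. v $ j * X j f z) (\<lambda>z. \<Sum>j\<in>UNIV. v $ j * dz j f z)"
    by (rule eqM_sum[OF eqM_mult[OF eqM_refl hol_X[OF assms(2)]]])
  then have "eqM (\<lambda>z. \<Sum>j\<in>UNIV. v $ j * X j f z) (DD v f)" by (simp add: DD_def[abs_def])
  from mspan.eq[OF m DD_smooth[OF hol_smooth[OF assms(2)]] this] show ?thesis .
qed

lemma mspan_mon: "mspan (JL (Suc (length vs + d))) (mon vs d i)"
proof (induction vs)
  case Nil
  have "mon [] d i = foldr dz (replicate d N) (h i)" by (simp add: mon_def foldr_replicate)
  then show ?case unfolding JL_def
    by (intro mspan.gen CollectI exI[of _ "replicate d N"] exI[of _ i]) simp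
next
  case (Cons v vs)
  from mspan_DD[OF this hol_mon, of v] show ?case by (simp add: mon_def)
qed

lemma dz_N_mon: "near (dz N (mon vs d i)) (mon vs (Suc d) i)"
  using near_sym[OF foldr_DD_move[OF hol_smooth[OF hol_dz_funpow[OF hol_h]], of vs "axis N 1"]]
  by (simp add: mon_def DD_axis)

lemma \<Lambda>_mon: "eqM (\<Lambda> v (mon vs d i)) (\<lambda>z. mon (v # vs) d i z + \<phi>v v z * mon vs (Suc d) i z)"
  using eqM_add[OF eqM_refl eqM_mult[OF eqM_refl near_eqM[OF dz_N_mon]], of "mon (v # vs) d i" "\<phi>v v" vs d i]
  by (simp add: \<Lambda>_eq[abs_def] mon_def)

lemma \<Lambda>_mult_mon:
  assumes "smooth_near p a"
  shows "eqM (\<Lambda> v (\<lambda>z. a z * mon vs d i z))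
    (\<lambda>z. \<Lambda> v a z * mon vs d i z + (a z * mon (v # vs) d i z + (a z * \<phi>v v z) * mon vs (Suc d) i z))"
proof -
  have "eqM (\<Lambda> v (\<lambda>z. a z * mon vs d i z)) (\<lambda>z. \<Lambda> v a z * mon vs d i z + a z * \<Lambda> v (mon vs d i) z)"
    by (rule tangential_mult[OF tangential_\<Lambda> assms hol_smooth[OF hol_mon]])
  also have "eqM \<dots> (\<lambda>z. \<Lambda> v a z * mon vs d i z + a z * (mon (v # vs) d i z + \<phi>v v z * mon vs (Suc d) i z))"
    by (rule eqM_add[OF eqM_refl eqM_mult[OF eqM_refl \<Lambda>_mon]])
  finally show ?thesis by (simp add: algebra_simps)
qed

text \<open>
  A term \<open>a \<cdot> mon vs d\<close> has weight (order of \<open>a\<close> along \<open>K c\<close>) \<open>- s d\<close>; the operators \<open>\<Lambda> v\<close>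
  with \<open>v \<in> T\<close> preserve the weight, and terms of weight at least \<open>\<sigma>\<close> cannot contribute to
  transversal degree \<open>d\<close> after applying \<open>K c\<close> fewer than \<open>\<sigma> + s d\<close> times.
\<close>

inductive wt :: "nat \<Rightarrow> nat \<Rightarrow> 'n \<Rightarrow> (complex ^ 'n \<Rightarrow> complex) \<Rightarrow> bool" for n \<sigma> i where
  base: "length vs + d = n \<Longrightarrow> set vs \<subseteq> T \<Longrightarrow> ord_ge c (\<sigma> + s * d) a \<Longrightarrow> wt n \<sigma> i (\<lambda>z. a z * mon vs d i z)"
| low: "mspan (JL n) f \<Longrightarrow> wt n \<sigma> i f"
| add: "wt n \<sigma> i f \<Longrightarrow> wt n \<sigma> i g \<Longrightarrow> wt n \<sigma> i (\<lambda>z. f z + g z)"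
| eq: "wt n \<sigma> i f \<Longrightarrow> smooth_near p g \<Longrightarrow> eqM f g \<Longrightarrow> wt n \<sigma> i g"

lemma wt_smooth: "wt n \<sigma> i f \<Longrightarrow> smooth_near p f"
proof (induction rule: wt.induct)
  case (base vs d a)
  then show ?case by (intro smooth_near_mult ord_ge_smooth hol_smooth[OF hol_mon])
qed (auto intro: smooth_near_add mspan_JL_smooth)

lemma wt_sum: "(\<And>q. q \<in> I \<Longrightarrow> wt n \<sigma> i (f q)) \<Longrightarrow> wt n \<sigma> i (\<lambda>z. \<Sum>q\<in>I. f q z)"
  by (induction I rule: infinite_finite_induct) (auto intro: wt.add wt.low mspan.zero)

lemma ord_ge_cmult: "ord_ge c t a \<Longrightarrow> ord_ge c t (\<lambda>z. b * a z)"
  using ord_ge_mult(1)[of c 0 "\<lambda>z. b" t a] by (simp add: ord_ge_def)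

lemma mspan_JL_\<Lambda>: assumes "mspan (JL n) f" shows "mspan (JL (Suc n)) (\<Lambda> v f)"
  unfolding \<Lambda>_def[abs_def] by (rule mspan_sum[OF mspan_cmult[OF mspan_JL_L[OF assms]]])

lemma mspan_JbL_\<Lambda>: assumes "mspan (JbL n) f" shows "mspan (JbL n) (\<Lambda> v f)"
  unfolding \<Lambda>_def[abs_def] by (rule mspan_sum[OF mspan_cmult[OF mspan_JbL_L[OF assms]]])

text \<open>Of the three Leibniz terms, the differentiated coefficient leaves the order of the
  monomial unchanged and is \<open>low\<close>; \<open>DD v\<close> adds a tangential letter;
  \<open>\<phi>v v * dz N\<close> raises the degree \<open>d\<close> by one and the order of the
  coefficient by \<open>s\<close>.\<close>

lemma wt_\<Lambda>:
  assumes "wt n \<sigma> i f" "v \<in> T" shows "wt (Suc n) \<sigma> i (\<Lambda> v f)"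
  using assms(1)
proof induction
  case (base vs d a)
  note sa = ord_ge_smooth[OF base(3)]
  have "wt (Suc n) \<sigma> i (\<lambda>z. \<Lambda> v a z * mon vs d i z)"
    using mspan.scale[OF tangential_smooth[OF tangential_\<Lambda> sa] mspan_mon[of vs d i]] base(1)
    by (intro wt.low) simp
  moreover have "wt (Suc n) \<sigma> i (\<lambda>z. a z * mon (v # vs) d i z)"
    by (rule wt.base) (use base assms(2) in auto)
  moreover have "ord_ge c (\<sigma> + s * Suc d) (\<lambda>z. a z * \<phi>v v z)"
    using ord_ge_mult(1)[OF base(3) ord_phiv[OF assms(2)]] by (simp add: algebra_simps)
  then have "wt (Suc n) \<sigma> i (\<lambda>z. (a z * \<phi>v v z) * mon vs (Suc d) i z)"
    by (intro wt.base) (use base in auto)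
  ultimately have "wt (Suc n) \<sigma> i (\<lambda>z. \<Lambda> v a z * mon vs d i z + (a z * mon (v # vs) d i z + (a z * \<phi>v v z) * mon vs (Suc d) i z))"
    by (intro wt.add)
  then show ?case
    by (rule wt.eq[OF _ tangential_smooth[OF tangential_\<Lambda> smooth_near_mult[OF sa hol_smooth[OF hol_mon]]] eqM_sym[OF \<Lambda>_mult_mon[OF sa]]])
next
  case (low f)
  then show ?case by (intro wt.low mspan_JL_\<Lambda>)
next
  case (add f g)
  note sf = wt_smooth[OF add(1)] wt_smooth[OF add(2)]
  show ?case
    by (rule wt.eq[OF wt.add[OF add.IH] tangential_smooth[OF tangential_\<Lambda> smooth_near_add[OF sf]] eqM_sym[OF tangential_add[OF tangential_\<Lambda> sf]]])
next
  case (eq f g)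
  show ?case
    by (rule wt.eq[OF eq.IH tangential_smooth[OF tangential_\<Lambda> eq(2)] tangential_eqM[OF tangential_\<Lambda> wt_smooth[OF eq(1)] eq(2,3)]])
qed

text \<open>Leading part of the word \<open>ws\<close> of \<open>\<Lambda>\<close> applied to
  \<open>\<Lambda> v ^^ m\<close>: \<open>q\<close> of the \<open>m\<close> letters \<open>v\<close>
  are traded for transversal derivatives, each with a factor \<open>\<phi>v v\<close>, and
  \<open>e q\<close> counts the ways to do so.\<close>

definition lead :: "(nat \<Rightarrow> nat) \<Rightarrow> (complex ^ 'n) list \<Rightarrow> complex ^ 'n \<Rightarrow> nat \<Rightarrow> 'n \<Rightarrow> complex ^ 'n \<Rightarrow> complex" where
  "lead e ws v m i z = (\<Sum>q\<le>m. of_nat (e q) * \<phi>v v z ^ q * mon (ws @ replicate (m - q) v) q i z)"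

lemma smooth_coeff: "smooth_near p (\<lambda>z. of_nat b * \<phi>v v z ^ q)"
  by (rule smooth_near_mult[OF smooth_near_const smooth_near_power[OF smooth_\<phi>v]])

lemma lead_smooth: "smooth_near p (lead e ws v m i)"
  unfolding lead_def[abs_def]
  by (rule smooth_near_sum[OF smooth_near_mult[OF smooth_coeff hol_smooth[OF hol_mon]]])

lemma \<Lambda>_lead:
  "\<exists>r. mspan (JL (Suc (length ws + m))) r \<and> eqM (\<Lambda> u (lead e ws v m i))
    (\<lambda>z. (\<Sum>q\<le>m. of_nat (e q) * \<phi>v v z ^ q * mon (u # ws @ replicate (m - q) v) q i z)
       + (\<Sum>q\<le>m. of_nat (e q) * \<phi>v v z ^ q * \<phi>v u z * mon (ws @ replicate (m - q) v) (Suc q) i z) + r z)"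
proof -
  let ?r = "\<lambda>z. \<Sum>q\<le>m. \<Lambda> u (\<lambda>z. of_nat (e q) * \<phi>v v z ^ q) z * mon (ws @ replicate (m - q) v) q i z"
  have "mspan (JL (Suc (length ws + m))) ?r"
  proof (rule mspan_sum[OF mspan.scale[OF tangential_smooth[OF tangential_\<Lambda> smooth_coeff]]])
    fix q assume "q \<in> {..m}"
    then show "mspan (JL (Suc (length ws + m))) (mon (ws @ replicate (m - q) v) q i)"
      using mspan_mon[of "ws @ replicate (m - q) v" q i] by simp
  qed
  moreover have "eqM (\<Lambda> u (lead e ws v m i)) (\<lambda>z. \<Sum>q\<le>m. \<Lambda> u (\<lambda>z. of_nat (e q) * \<phi>v v z ^ q * mon (ws @ replicate (m - q) v) q i z) z)"
    unfolding lead_def[abs_def]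
    by (rule tangential_sum[OF tangential_\<Lambda> smooth_near_mult[OF smooth_coeff hol_smooth[OF hol_mon]]])
  then have "eqM (\<Lambda> u (lead e ws v m i)) (\<lambda>z. \<Sum>q\<le>m. \<Lambda> u (\<lambda>z. of_nat (e q) * \<phi>v v z ^ q) z * mon (ws @ replicate (m - q) v) q i z
      + (of_nat (e q) * \<phi>v v z ^ q * mon (u # ws @ replicate (m - q) v) q i z
       + of_nat (e q) * \<phi>v v z ^ q * \<phi>v u z * mon (ws @ replicate (m - q) v) (Suc q) i z))"
    by (rule eqM_trans[OF _ eqM_sum[OF \<Lambda>_mult_mon[OF smooth_coeff]]])
  ultimately show ?thesis
    by (intro exI[of _ ?r]) (simp add: sum.distrib algebra_simps)
qed

text \<open>Each factor \<open>\<Lambda> v\<close> either adds a letter \<open>v\<close> or trades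
  it for \<open>\<phi>v v\<close> times a transversal derivative; derivatives of coefficients
  produce lower order and go into the error.\<close>

lemma funpow_\<Lambda>_expansion:
  assumes v: "v \<in> T"
  shows "\<exists>e. (\<forall>q\<le>m. e q > 0) \<and> wt m 1 i (\<lambda>z. (\<Lambda> v ^^ m) (h i) z - lead e [] v m i z)"
proof (induction m)
  case 0
  show ?case by (rule exI[of _ "\<lambda>q. 1"]) (auto simp: lead_def mon_def intro: wt.low mspan.zero)
next
  case (Suc m)
  then obtain e where e: "\<And>q. q \<le> m \<Longrightarrow> e q > 0" "wt m 1 i (\<lambda>z. (\<Lambda> v ^^ m) (h i) z - lead e [] v m i z)" by blast
  \<comment> \<open>Pascal's rule for the multiplicities, cut off at both ends; only positivity is
    recorded.\<close>
  define e' where "e' q = (if q \<le> m then e q else 0) + (if q > 0 then e (q - 1) else 0)" for q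
  have pos: "e' q > 0" if "q \<le> Suc m" for q using that e(1)[of q] e(1)[of "q - 1"] by (auto simp: e'_def)
  let ?r = "\<lambda>z. (\<Lambda> v ^^ m) (h i) z - lead e [] v m i z"
  obtain r where r: "mspan (JL (Suc m)) r" "eqM (\<Lambda> v (lead e [] v m i))
    (\<lambda>z. (\<Sum>q\<le>m. of_nat (e q) * \<phi>v v z ^ q * mon (v # replicate (m - q) v) q i z)
       + (\<Sum>q\<le>m. of_nat (e q) * \<phi>v v z ^ q * \<phi>v v z * mon (replicate (m - q) v) (Suc q) i z) + r z)"
    using \<Lambda>_lead[of "[]" m v e v i] by auto
  have split: "lead e' [] v (Suc m) i z = (\<Sum>q\<le>m. of_nat (e q) * \<phi>v v z ^ q * mon (v # replicate (m - q) v) q i z)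
       + (\<Sum>q\<le>m. of_nat (e q) * \<phi>v v z ^ q * \<phi>v v z * mon (replicate (m - q) v) (Suc q) i z)" for z
  proof -
    have "lead e' [] v (Suc m) i z = (\<Sum>q\<le>Suc m. of_nat (if q \<le> m then e q else 0) * \<phi>v v z ^ q * mon (replicate (Suc m - q) v) q i z)
       + (\<Sum>q\<le>Suc m. of_nat (if q > 0 then e (q - 1) else 0) * \<phi>v v z ^ q * mon (replicate (Suc m - q) v) q i z)"
      by (simp only: lead_def e'_def of_nat_add distrib_right sum.distrib append_Nil)
    also have "(\<Sum>q\<le>Suc m. of_nat (if q \<le> m then e q else 0) * \<phi>v v z ^ q * mon (replicate (Suc m - q) v) q i z)
       = (\<Sum>q\<le>m. of_nat (e q) * \<phi>v v z ^ q * mon (v # replicate (m - q) v) q i z)"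
      by (simp add: Suc_diff_le)
    also have "(\<Sum>q\<le>Suc m. of_nat (if q > 0 then e (q - 1) else 0) * \<phi>v v z ^ q * mon (replicate (Suc m - q) v) q i z)
       = (\<Sum>q\<le>m. of_nat (e q) * \<phi>v v z ^ q * \<phi>v v z * mon (replicate (m - q) v) (Suc q) i z)"
      by (subst sum.atMost_Suc_shift) (simp add: mult_ac)
    finally show ?thesis .
  qed
  have sr: "smooth_near p ?r" by (rule wt_smooth[OF e(2)])
  have sm: "smooth_near p ((\<Lambda> v ^^ n) (h i))" for n
    by (rule tangential_funpow_smooth[OF tangential_\<Lambda> hol_smooth[OF hol_h]])
  have "eqM (\<Lambda> v (\<lambda>z. lead e [] v m i z + ?r z)) (\<lambda>z. \<Lambda> v (lead e [] v m i) z + \<Lambda> v ?r z)"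
    by (rule tangential_add[OF tangential_\<Lambda> lead_smooth sr])
  also have "eqM \<dots> (\<lambda>z. (lead e' [] v (Suc m) i z + r z) + \<Lambda> v ?r z)"
    unfolding split by (rule eqM_add[OF r(2) eqM_refl])
  finally have "eqM (\<lambda>z. (\<Lambda> v ^^ Suc m) (h i) z) (\<lambda>z. (lead e' [] v (Suc m) i z + r z) + \<Lambda> v ?r z)" by simp
  then have "eqM (\<lambda>z. r z + \<Lambda> v ?r z) (\<lambda>z. (\<Lambda> v ^^ Suc m) (h i) z - lead e' [] v (Suc m) i z)"
    unfolding eqM_def by (auto elim: eventually_mono)
  from wt.eq[OF wt.add[OF wt.low[OF r(1)] wt_\<Lambda>[OF e(2) v]] smooth_near_diff[OF sm lead_smooth] this]
  show ?case using pos by blast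
qed

text \<open>For a letter \<open>w\<close> with \<open>\<tau> w = 0\<close> the coefficient
  \<open>\<phi>v w\<close> has order at least \<open>Suc s\<close>, one more than a transversal
  derivative costs. Its transversal part therefore has weight at least \<open>1\<close> and joins
  the error, so that only letters \<open>v\<close> are traded in the leading part.\<close>

lemma foldr_\<Lambda>_expansion:
  assumes v: "v \<in> T" and ws: "\<And>w. w \<in> set ws \<Longrightarrow> w \<in> T \<and> \<tau> w = 0"
  shows "\<exists>e. (\<forall>q\<le>m. e q > 0) \<and> wt (length ws + m) 1 i (\<lambda>z. foldr \<Lambda> ws ((\<Lambda> v ^^ m) (h i)) z - lead e ws v m i z)"
  using ws
proof (induction ws)
  case Nil
  then show ?case using funpow_\<Lambda>_expansion[OF v] by simp
next
  case (Cons w ws)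
  let ?f = "foldr \<Lambda> ws ((\<Lambda> v ^^ m) (h i))"
  obtain e where e: "\<And>q. q \<le> m \<Longrightarrow> e q > 0" "wt (length ws + m) 1 i (\<lambda>z. ?f z - lead e ws v m i z)" using Cons by auto
  let ?r = "\<lambda>z. ?f z - lead e ws v m i z"
  have w: "w \<in> T" "\<tau> w = 0" using Cons.prems by auto
  let ?t = "\<lambda>z. \<Sum>q\<le>m. of_nat (e q) * \<phi>v v z ^ q * \<phi>v w z * mon (ws @ replicate (m - q) v) (Suc q) i z"
  obtain r where r: "mspan (JL (Suc (length ws + m))) r" "eqM (\<Lambda> w (lead e ws v m i))
    (\<lambda>z. (\<Sum>q\<le>m. of_nat (e q) * \<phi>v v z ^ q * mon (w # ws @ replicate (m - q) v) q i z) + ?t z + r z)"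
    using \<Lambda>_lead[of ws m w e v i] by blast
  have t: "wt (Suc (length ws + m)) 1 i ?t"
  proof (rule wt_sum, rule wt.base)
    fix q assume q: "q \<in> {..m}"
    show "length (ws @ replicate (m - q) v) + Suc q = Suc (length ws + m)" using q by simp
    show "set (ws @ replicate (m - q) v) \<subseteq> T" using Cons.prems v by auto
    have "ord_ge c (s * q) (\<lambda>z. of_nat (e q) * \<phi>v v z ^ q)"
      using ord_ge_power[OF ord_phiv[OF v]] ord_ge_cmult by blast
    from ord_ge_mult(1)[OF this ord_phiv_Suc[OF w]]
    show "ord_ge c (1 + s * Suc q) (\<lambda>z. of_nat (e q) * \<phi>v v z ^ q * \<phi>v w z)" by (simp add: algebra_simps)
  qed
  have sr: "smooth_near p ?r" by (rule wt_smooth[OF e(2)])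
  have sm: "smooth_near p (foldr \<Lambda> us ((\<Lambda> v ^^ n) (h i)))" for us n
    by (rule tangential_foldr_smooth[OF tangential_\<Lambda> tangential_funpow_smooth[OF tangential_\<Lambda> hol_smooth[OF hol_h]]])
  have "eqM (\<Lambda> w (\<lambda>z. lead e ws v m i z + ?r z)) (\<lambda>z. \<Lambda> w (lead e ws v m i) z + \<Lambda> w ?r z)"
    by (rule tangential_add[OF tangential_\<Lambda> lead_smooth sr])
  also have "eqM \<dots> (\<lambda>z. (lead e (w # ws) v m i z + ?t z + r z) + \<Lambda> w ?r z)"
    unfolding lead_def[of e "w # ws"] using eqM_add[OF r(2) eqM_refl[of "\<Lambda> w ?r"]] by simp
  finally have "eqM (\<Lambda> w ?f) (\<lambda>z. (lead e (w # ws) v m i z + ?t z + r z) + \<Lambda> w ?r z)" by simp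
  then have "eqM (\<lambda>z. ?t z + (r z + \<Lambda> w ?r z)) (\<lambda>z. foldr \<Lambda> (w # ws) ((\<Lambda> v ^^ m) (h i)) z - lead e (w # ws) v m i z)"
    unfolding eqM_def by (auto elim: eventually_mono)
  from wt.eq[OF wt.add[OF t wt.add[OF wt.low[OF r(1)] wt_\<Lambda>[OF e(2) w(1)]]] smooth_near_diff[OF sm lead_smooth] this]
  show ?case using e(1) by auto
qed

text \<open>\<open>K c\<close> annihilates \<open>y\<close> along \<open>M\<close>: derivatives of
  \<open>h\<close> behave as constants, and only coefficients are differentiated.\<close>

lemma K_funpow_mult_hol:
  assumes a: "smooth_near p a" and y: "hol y"
  shows "eqM ((K c ^^ b) (\<lambda>z. a z * y z)) (\<lambda>z. (K c ^^ b) a z * y z)"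
proof (induction b)
  case (Suc b)
  note sa = tangential_funpow_smooth[OF tangential_K a]
  have "eqM (K c ((K c ^^ b) (\<lambda>z. a z * y z))) (K c (\<lambda>z. (K c ^^ b) a z * y z))"
    by (rule tangential_eqM[OF tangential_K tangential_funpow_smooth[OF tangential_K smooth_near_mult[OF a hol_smooth[OF y]]]
          smooth_near_mult[OF sa hol_smooth[OF y]] Suc])
  also have "eqM \<dots> (\<lambda>z. K c ((K c ^^ b) a) z * y z + (K c ^^ b) a z * K c y z)"
    by (rule tangential_mult[OF tangential_K sa hol_smooth[OF y]])
  also have "eqM \<dots> (\<lambda>z. K c ((K c ^^ b) a) z * y z + (K c ^^ b) a z * 0)"
    by (rule eqM_add[OF eqM_refl eqM_mult[OF eqM_refl hol_K[OF y]]])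
  finally show ?case by simp
qed simp

lemma JL_S_smooth: "g \<in> JL n \<union> S \<Longrightarrow> smooth_near p g"
  using JL_smooth by blast

lemma mspan_JL_K_funpow: "mspan (JL n) f \<Longrightarrow> mspan (JL n) ((K c ^^ b) f)"
  by (induction b) (auto intro: mspan_JL_K)

text \<open>Terms of transversal degree below \<open>d\<close> are covered by \<open>IH\<close>.
  From degree \<open>d\<close> on the coefficient has order above \<open>s * d\<close>, so it still
  vanishes at \<open>p\<close> after \<open>s * d\<close> applications of
  \<open>K c\<close>.\<close>

lemma K_funpow_wt:
  assumes "wt n 1 i f" and low: "\<And>g. g \<in> JL n \<Longrightarrow> mspan S g"
    and IH: "\<And>d' vs. d' < d \<Longrightarrow> set vs \<subseteq> T \<Longrightarrow> length vs + d' = n \<Longrightarrow> mod_max S (JL (Suc n)) (mon vs d' i)"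
  shows "mod_max S (JL (Suc n)) ((K c ^^ (s * d)) f)"
  using assms(1)
proof induction
  case (base vs d' a)
  note sa = ord_ge_smooth[OF base(3)]
  note sK = tangential_funpow_smooth[OF tangential_K sa]
  have "mod_max S (JL (Suc n)) (\<lambda>z. (K c ^^ (s * d)) a z * mon vs d' i z)"
  proof (cases "d' < d")
    case True
    show ?thesis by (rule mod_max_scale[OF sK IH[OF True base(2,1)] JL_S_smooth])
  next
    case False
    then have "s * d < 1 + s * d'" by (simp add: less_Suc_eq_le)
    then have "(K c ^^ (s * d)) a p = 0" using base(3) by (auto simp: ord_ge_def)
    then show ?thesis
      using mod_max_small_mspan[OF sK _ _ JL_S_smooth] mspan_mon[of vs d' i] base(1) by simp
  qed
  then show ?case
    by (rule mod_max.eq[OF _ tangential_funpow_smooth[OF tangential_K smooth_near_mult[OF sa hol_smooth[OF hol_mon]]]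
          eqM_sym[OF K_funpow_mult_hol[OF sa hol_mon]]])
next
  case (low f)
  then have "mspan S f" using assms(2) mspan_trans by blast
  then show ?case by (rule mod_max.base[OF mspan_JL_K_funpow])
next
  case (add f g)
  note sf = wt_smooth[OF add(1)] wt_smooth[OF add(2)]
  show ?case
    by (rule mod_max.eq[OF mod_max.add[OF add.IH] tangential_funpow_smooth[OF tangential_K smooth_near_add[OF sf]]
          eqM_sym[OF K_funpow_add[OF sf]]])
next
  case (eq f g)
  show ?case
    by (rule mod_max.eq[OF eq.IH tangential_funpow_smooth[OF tangential_K eq(2)]
          tangential_funpow_eqM[OF tangential_K wt_smooth[OF eq(1)] eq(2,3)]])
qed

text \<open>The power \<open>s * d\<close> of \<open>K c\<close> isolates transversal degree
  \<open>d\<close>: coefficients of higher degree still vanish at \<open>p\<close>, lower degrees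
  are known by \<open>IH\<close>, and the coefficient of degree \<open>d\<close> becomes nonzero at
  \<open>p\<close>, hence invertible.\<close>

lemma mod_max_mon_special:
  assumes low: "\<And>g. g \<in> JL n \<Longrightarrow> mspan S g"
    and IH: "\<And>d' vs. d' < d \<Longrightarrow> set vs \<subseteq> T \<Longrightarrow> length vs + d' = n \<Longrightarrow> mod_max S (JL (Suc n)) (mon vs d' i)"
    and v: "v \<in> T" "\<tau> v \<noteq> 0" and ws: "\<And>w. w \<in> set ws \<Longrightarrow> w \<in> T \<and> \<tau> w = 0"
    and n: "length ws + l + d = n"
  shows "mod_max S (JL (Suc n)) (mon (ws @ replicate l v) d i)"
proof -
  let ?PP = "mod_max S (JL (Suc n))"
  \<comment> \<open>Of the \<open>m\<close> letters \<open>v\<close>, \<open>d\<close> are to be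
    traded for transversal derivatives, which leaves the \<open>l\<close> letters wanted.\<close>
  define m where "m = l + d"
  let ?f = "foldr \<Lambda> ws ((\<Lambda> v ^^ m) (h i))"
  let ?K = "K c ^^ (s * d)"
  obtain e where e: "\<And>q. q \<le> m \<Longrightarrow> e q > 0" "wt (length ws + m) 1 i (\<lambda>z. ?f z - lead e ws v m i z)"
    using foldr_\<Lambda>_expansion[OF v(1) ws, of ws m i] by blast
  have wt: "wt n 1 i (\<lambda>z. ?f z - lead e ws v m i z)" using e(2) n by (simp add: m_def add.assoc)
  \<comment> \<open>Words in \<open>\<Lambda>\<close> never leave the module of conjugates that
    contains \<open>h\<close>, however long they are; reflection then puts them into
    \<open>mspan S\<close>.\<close>
  have "mspan (JbL (Suc k)) ((\<Lambda> v ^^ m) (h i))"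
    by (induction m) (auto intro: h_reflection mspan_JbL_\<Lambda>)
  then have "mspan (JbL (Suc k)) ?f" by (induction ws) (auto intro: mspan_JbL_\<Lambda>)
  then have Sf: "mspan S ?f" by (rule JbL_JL)
  have sf: "smooth_near p ?f" by (rule mspan_JL_smooth[OF Sf])
  define a where "a q z = of_nat (e q) * \<phi>v v z ^ q" for q z
  have sa: "smooth_near p (a q)" for q unfolding a_def[abs_def] by (rule smooth_coeff)
  have sKa: "smooth_near p (?K (a q))" for q by (rule tangential_funpow_smooth[OF tangential_K sa])
  define y where "y q = mon (ws @ replicate (m - q) v) q i" for q
  have hy: "hol (y q)" for q unfolding y_def by (rule hol_mon)
  have lead: "lead e ws v m i = (\<lambda>z. \<Sum>q\<le>m. a q z * y q z)" by (simp add: lead_def[abs_def] a_def y_def)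
  have "?PP (\<lambda>z. ?K ?f z + (-1) * ?K (\<lambda>z. ?f z - lead e ws v m i z) z)"
    by (rule mod_max.add[OF mod_max.base[OF mspan_JL_K_funpow[OF Sf]] mod_max_cmult[OF K_funpow_wt[OF wt low IH] JL_S_smooth]])
  moreover have "eqM (\<lambda>z. ?K ?f z + (-1) * ?K (\<lambda>z. ?f z - lead e ws v m i z) z) (\<lambda>z. \<Sum>q\<le>m. ?K (a q) z * y q z)"
  proof -
    have "eqM (?K (\<lambda>z. lead e ws v m i z + (?f z - lead e ws v m i z)))
        (\<lambda>z. ?K (lead e ws v m i) z + ?K (\<lambda>z. ?f z - lead e ws v m i z) z)"
      by (rule K_funpow_add[OF lead_smooth smooth_near_diff[OF sf lead_smooth]])
    then have 1: "eqM (\<lambda>z. ?K ?f z + (-1) * ?K (\<lambda>z. ?f z - lead e ws v m i z) z) (?K (lead e ws v m i))"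
      unfolding eqM_def by (auto elim: eventually_mono)
    have "eqM (?K (\<lambda>z. \<Sum>q\<le>m. 1 * (a q z * y q z))) (\<lambda>z. \<Sum>q\<le>m. 1 * ?K (\<lambda>z. a q z * y q z) z)"
      by (rule K_funpow_sum[OF smooth_near_mult[OF sa hol_smooth[OF hy]]])
    then have 2: "eqM (?K (lead e ws v m i)) (\<lambda>z. \<Sum>q\<le>m. ?K (\<lambda>z. a q z * y q z) z)"
      unfolding lead by simp
    show ?thesis
      by (rule eqM_trans[OF eqM_trans[OF 1 2] eqM_sum[OF K_funpow_mult_hol[OF sa hy]]])
  qed
  ultimately have sum: "?PP (\<lambda>z. \<Sum>q\<le>m. ?K (a q) z * y q z)"
    by (rule mod_max.eq[OF _ smooth_near_sum[OF smooth_near_mult[OF sKa hol_smooth[OF hy]]]])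
  have other: "?PP (\<lambda>z. ?K (a q) z * y q z)" if q: "q \<le> m" "q \<noteq> d" for q
  proof (cases "q < d")
    case True
    show ?thesis
      unfolding y_def
      by (rule mod_max_scale[OF sKa IH[OF True] JL_S_smooth]) (use ws v n q in \<open>auto simp: m_def\<close>)
  next
    case False
    have "ord_ge c (s * q) (a q)"
      unfolding a_def[abs_def] using ord_ge_power[OF ord_phiv[OF v(1)]] ord_ge_cmult by blast
    moreover have "s * d < s * q" using False q s_pos by simp
    ultimately have z: "?K (a q) p = 0" by (auto simp: ord_ge_def)
    have m: "mspan (JL (Suc n)) (y q)"
    proof -
      have "length (ws @ replicate (m - q) v) + q = n" using q n by (simp add: m_def)
      with mspan_mon[of "ws @ replicate (m - q) v" q i] show ?thesis unfolding y_def by metis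
    qed
    show ?thesis by (rule mod_max_small_mspan[OF sKa z m JL_S_smooth])
  qed
  have "?PP (\<lambda>z. (\<Sum>q\<le>m. ?K (a q) z * y q z) + (-1) * (\<Sum>q\<in>{..m} - {d}. ?K (a q) z * y q z))"
    by (rule mod_max.add[OF sum mod_max_cmult[OF mod_max_sum JL_S_smooth]]) (use other in auto)
  also have "(\<lambda>z. (\<Sum>q\<le>m. ?K (a q) z * y q z) + (-1) * (\<Sum>q\<in>{..m} - {d}. ?K (a q) z * y q z)) = (\<lambda>z. ?K (a d) z * y d z)"
    by (rule ext, subst sum.remove[of "{..m}" d]) (auto simp: m_def)
  finally have d: "?PP (\<lambda>z. ?K (a d) z * y d z)" .
  \<comment> \<open>The leading coefficient of \<open>\<phi>v v ^ d\<close> is a nonzero multiple of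
    \<open>\<tau> v ^ d\<close>, and \<open>e d\<close> is positive.\<close>
  have nz: "?K (a d) p \<noteq> 0"
  proof -
    have sp: "smooth_near p (\<lambda>z. \<phi>v v z ^ d)" by (rule smooth_near_power[OF smooth_\<phi>v])
    have "eqM (?K (\<lambda>z. \<Sum>u\<in>{()}. of_nat (e d) * \<phi>v v z ^ d)) (\<lambda>z. \<Sum>u\<in>{()}. of_nat (e d) * ?K (\<lambda>z. \<phi>v v z ^ d) z)"
      by (rule K_funpow_sum[OF sp])
    from eqM_at[OF this] have "?K (a d) p = of_nat (e d) * ?K (\<lambda>z. \<phi>v v z ^ d) p" by (simp add: a_def[abs_def])
    moreover have "?K (\<lambda>z. \<phi>v v z ^ d) p \<noteq> 0"
      using ord_ge_power[OF ord_phiv[OF v(1)]] v(2) by (simp add: \<tau>_def)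
    ultimately show ?thesis using e(1)[of d] by (simp add: m_def)
  qed
  have "?PP (\<lambda>z. inverse (?K (a d) z) * (?K (a d) z * y d z))"
    by (rule mod_max_scale[OF smooth_near_inverse[OF sKa nz] d JL_S_smooth])
  moreover have "eqM (\<lambda>z. inverse (?K (a d) z) * (?K (a d) z * y d z)) (y d)"
    by (rule eqM_near[OF eventually_mono[OF smooth_near_nonzero[OF sKa nz]]]) simp
  ultimately have "?PP (y d)" by (rule mod_max.eq[OF _ hol_smooth[OF hy]])
  then show ?thesis by (simp add: y_def m_def)
qed

lemma \<phi>v_lin: "\<phi>v (u + a *s v) z = \<phi>v u z + a * \<phi>v v z"
  by (simp add: \<phi>v_def algebra_simps sum.distrib sum_distrib_left)

lemma \<phi>v_axis: "\<phi>v (axis j 1) z = \<phi> j z"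
  by (simp add: \<phi>v_def axis_def if_distrib[of "\<lambda>x. x * _"] cong: if_cong)

lemma \<tau>_lin: "\<tau> (u + a *s v) = \<tau> u + a * \<tau> v"
  by (simp add: \<tau>_def K_funpow_phiv algebra_simps sum.distrib sum_distrib_left)

text \<open>\<open>\<phi> N\<close> is constant near \<open>p\<close>, and \<open>s\<close> is
  positive.\<close>

lemma \<tau>_N: "\<tau> (axis N 1) = 0"
proof -
  have "eqM (\<phi>v (axis N 1)) (\<lambda>z. -1)"
    by (rule eqM_near) (use phi_N in \<open>simp add: \<phi>v_axis\<close>)
  then have "eqM ((K c ^^ s) (\<phi>v (axis N 1))) ((K c ^^ s) (\<lambda>z. -1))"
    by (rule tangential_funpow_eqM[OF tangential_K smooth_\<phi>v smooth_near_const])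
  moreover have "(K c ^^ s) (\<lambda>z. -1) = (\<lambda>z. 0)"
  proof -
    obtain s' where s': "s = Suc s'" using s_pos by (cases s) auto
    have "(K c ^^ s') (\<lambda>z. 0) = (\<lambda>z. 0)" using tangential_const[OF tangential_K, of c 0] by (induction s') auto
    then show ?thesis using tangential_const[OF tangential_K, of c "-1"] by (simp add: s' funpow_swap1)
  qed
  ultimately have "eqM ((K c ^^ s) (\<phi>v (axis N 1))) (\<lambda>z. 0)" by simp
  from eqM_at[OF this] show ?thesis by (simp add: \<tau>_def)
qed

lemma phi_N_at: "\<phi> N p = -1"
  using eventually_nhds_x_imp_x[OF phi_N] .

text \<open>Since \<open>\<phi> N p = -1\<close>, a multiple of \<open>axis N 1\<close> corrects
  \<open>axis j\<^sub>0 1\<close> to a vector of \<open>T\<close>, and it does not affect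
  \<open>\<tau>\<close>.\<close>

lemma exists_transversal: obtains v where "v \<in> T" "\<tau> v \<noteq> 0"
proof
  show "axis j\<^sub>0 1 + \<phi> j\<^sub>0 p *s axis N 1 \<in> T" by (simp add: T_def \<phi>v_lin \<phi>v_axis phi_N_at)
  have "\<phi>v (axis j\<^sub>0 1) = \<phi> j\<^sub>0" by (rule ext) (rule \<phi>v_axis)
  then show "\<tau> (axis j\<^sub>0 1 + \<phi> j\<^sub>0 p *s axis N 1) \<noteq> 0"
    using tau_nonzero by (simp only: \<tau>_lin \<tau>_N) (simp add: \<tau>_def)
qed

lemma foldr_DD_split:
  assumes g: "smooth_near p g"
  shows "near (foldr DD us (DD (u + a *s v) g)) (\<lambda>z. foldr DD us (DD u g) z + a * foldr DD us (DD v g) z)"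
proof -
  have "DD (u + a *s v) g = (\<lambda>z. DD u g z + a * DD v g z)" by (rule ext) (rule DD_add_left)
  then show ?thesis using foldr_DD_add[OF DD_smooth[OF g] DD_smooth[OF g]] by simp
qed

lemma mod_max_DD_split:
  assumes "smooth_near p g" "mod_max S (JL n) (foldr DD us (DD u g))" "mod_max S (JL n) (foldr DD us (DD v g))"
  shows "mod_max S (JL n) (foldr DD us (DD (u + a *s v) g))"
  by (rule mod_max.eq[OF mod_max.add[OF assms(2) mod_max_cmult[OF assms(3) JL_S_smooth]]
        foldr_DD_smooth[OF DD_smooth[OF assms(1)]] eqM_sym[OF near_eqM[OF foldr_DD_split[OF assms(1)]]]])

lemma mod_max_DD_move:
  assumes "smooth_near p g"
  shows "mod_max S (JL n) (foldr DD us (DD u g)) \<longleftrightarrow> mod_max S (JL n) (DD u (foldr DD us g))"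
  using mod_max.eq[OF _ DD_smooth[OF foldr_DD_smooth[OF assms]] near_eqM[OF foldr_DD_move[OF assms]]]
    mod_max.eq[OF _ foldr_DD_smooth[OF DD_smooth[OF assms]] near_eqM[OF near_sym[OF foldr_DD_move[OF assms]]]]
  by blast

text \<open>Each letter splits as \<open>x = w + a *s v\<close> with \<open>\<tau> w = 0\<close>. As
  the \<open>DD\<close> commute, linearity in every letter reduces to kernel letters followed by
  copies of \<open>v\<close>; the induction runs over the letters not yet split.\<close>

lemma mod_max_mon_tangential:
  assumes low: "\<And>g. g \<in> JL n \<Longrightarrow> mspan S g"
    and IH: "\<And>d' vs. d' < d \<Longrightarrow> set vs \<subseteq> T \<Longrightarrow> length vs + d' = n \<Longrightarrow> mod_max S (JL (Suc n)) (mon vs d' i)"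
    and "set vs \<subseteq> T" "length vs + d = n"
  shows "mod_max S (JL (Suc n)) (mon vs d i)"
proof -
  obtain v where v: "v \<in> T" "\<tau> v \<noteq> 0" using exists_transversal .
  have "mod_max S (JL (Suc n)) (mon (ws @ replicate l v @ vs) d i)"
    if "set vs \<subseteq> T" "\<And>w. w \<in> set ws \<Longrightarrow> w \<in> T \<and> \<tau> w = 0" "length ws + l + length vs + d = n" for ws l vs
    using that
  proof (induction vs arbitrary: ws l)
    case Nil
    have l: "length ws + l + d = n" using Nil(3) by simp
    show ?case unfolding append_Nil2 by (rule mod_max_mon_special[OF low IH v Nil(2) l])
  next
    case (Cons x vs)
    define a where "a = \<tau> x / \<tau> v"
    define w where "w = x + (- a) *s v"
    have x: "x = w + a *s v" by (simp add: w_def vec_eq_iff)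
    have "x \<in> T" using Cons.prems by simp
    then have w: "w \<in> T" using v(1) unfolding w_def T_def mem_Collect_eq \<phi>v_lin by simp
    have "\<tau> w = 0" using v(2) unfolding w_def \<tau>_lin a_def by simp
    note w = w this
    have g: "smooth_near p (mon vs d i)" by (rule hol_smooth[OF hol_mon])
    have "mod_max S (JL (Suc n)) (mon ((w # ws) @ replicate l v @ vs) d i)"
      by (rule Cons.IH) (use Cons.prems w in auto)
    then have 1: "mod_max S (JL (Suc n)) (foldr DD (ws @ replicate l v) (DD w (mon vs d i)))"
      by (subst mod_max_DD_move[OF g]) (simp add: mon_def)
    have "mod_max S (JL (Suc n)) (mon (ws @ replicate (Suc l) v @ vs) d i)"
      by (rule Cons.IH) (use Cons.prems in auto)
    moreover have "ws @ replicate (Suc l) v @ vs = (ws @ replicate l v) @ (v # vs)"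
      by (simp add: replicate_app_Cons_same)
    moreover have "mon ((ws @ replicate l v) @ (v # vs)) d i = foldr DD (ws @ replicate l v) (DD v (mon vs d i))"
      unfolding mon_def foldr_append by simp
    ultimately have 2: "mod_max S (JL (Suc n)) (foldr DD (ws @ replicate l v) (DD v (mon vs d i)))"
      by metis
    have "mod_max S (JL (Suc n)) (foldr DD (ws @ replicate l v) (DD x (mon vs d i)))"
      unfolding x by (rule mod_max_DD_split[OF g 1 2])
    moreover have "mon ((ws @ replicate l v) @ (x # vs)) d i = foldr DD (ws @ replicate l v) (DD x (mon vs d i))"
      unfolding mon_def foldr_append by simp
    ultimately show ?case by simp
  qed
  from this[of vs "[]" 0] assms show ?thesis by simp
qed

lemma mod_max_mon:
  assumes low: "\<And>g. g \<in> JL n \<Longrightarrow> mspan S g"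
    and "set vs \<subseteq> T" "length vs + d = n"
  shows "mod_max S (JL (Suc n)) (mon vs d i)"
  using assms(2,3)
proof (induction d arbitrary: vs rule: less_induct)
  case (less d)
  show ?case by (rule mod_max_mon_tangential[OF low less.IH less.prems])
qed

text \<open>A coordinate direction is a vector of \<open>T\<close> plus a multiple of
  \<open>axis N 1\<close>, and transversal letters can be commuted inwards; this leaves monomials
  with letters in \<open>T\<close>. Only order exactly \<open>n\<close> is at stake, lower orders
  being covered by \<open>low\<close>.\<close>

lemma mod_max_derivative:
  assumes low: "\<And>g. g \<in> JL n \<Longrightarrow> mspan S g" and "g \<in> JL (Suc n)"
  shows "mod_max S (JL (Suc n)) g"
proof -
  obtain w i where g: "g = foldr dz w (h i)" "length w < Suc n" using assms(2) by (auto simp: JL_def)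
  show ?thesis
  proof (cases "length w < n")
    case True
    then show ?thesis using low g by (intro mod_max.base low) (auto simp: JL_def)
  next
    case False
    have "mod_max S (JL (Suc n)) (foldr DD us (foldr DD vs ((dz N ^^ d) (h i))))"
      if "set us \<subseteq> T" "length us + length vs + d = n" for us vs d
      using that
    proof (induction vs arbitrary: us d)
      case Nil
      then show ?case using mod_max_mon[OF low, where vs = us and d = d] by (simp add: mon_def)
    next
      case (Cons x vs)
      define u where "u = x + \<phi>v x p *s axis N 1"
      have x: "x = u + (- \<phi>v x p) *s axis N 1" by (simp add: u_def vec_eq_iff)
      have u: "u \<in> T" by (simp add: u_def T_def \<phi>v_lin \<phi>v_axis phi_N_at)
      have sd: "smooth_near p ((dz N ^^ d) (h i))" by (rule hol_smooth[OF hol_dz_funpow[OF hol_h]])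
      have g: "smooth_near p (foldr DD vs ((dz N ^^ d) (h i)))" by (rule foldr_DD_smooth[OF sd])
      have "mod_max S (JL (Suc n)) (foldr DD (u # us) (foldr DD vs ((dz N ^^ d) (h i))))"
        by (rule Cons.IH) (use Cons.prems u in auto)
      then have 1: "mod_max S (JL (Suc n)) (foldr DD us (DD u (foldr DD vs ((dz N ^^ d) (h i)))))"
        by (subst mod_max_DD_move[OF g]) simp
      have "mod_max S (JL (Suc n)) (foldr DD us (foldr DD vs ((dz N ^^ Suc d) (h i))))"
        by (rule Cons.IH) (use Cons.prems in auto)
      then have "mod_max S (JL (Suc n)) (foldr DD us (foldr DD vs (DD (axis N 1) ((dz N ^^ d) (h i)))))"
        by (simp add: DD_axis)
      then have 2: "mod_max S (JL (Suc n)) (foldr DD us (DD (axis N 1) (foldr DD vs ((dz N ^^ d) (h i)))))"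
        by (rule mod_max.eq[OF _ foldr_DD_smooth[OF DD_smooth[OF g]] near_eqM[OF foldr_DD_near[OF foldr_DD_move[OF sd]]]])
      from mod_max_DD_split[OF g 1 2, of "- \<phi>v x p"] have "mod_max S (JL (Suc n)) (foldr DD us (DD x (foldr DD vs ((dz N ^^ d) (h i)))))"
        by (subst x)
      then show ?case by simp
    qed
    from this[of "[]" "map (\<lambda>j. axis j 1) w" 0] False g
    have m: "mod_max S (JL (Suc n)) (foldr (\<lambda>j. DD (axis j 1)) w (h i))"
      by (simp add: foldr_map comp_def)
    have ax: "(\<lambda>j. DD (axis j 1)) = dz" by (intro ext) (simp add: DD_axis)
    show ?thesis using m unfolding ax g(1) .
  qed
qed

text \<open>Every element of \<open>JL (Suc n)\<close> lies in \<open>mspan S\<close> up to the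
  maximal ideal times \<open>JL (Suc n)\<close>, a finite set, so Nakayama's lemma removes the
  remainder.\<close>

theorem prolongation: "g \<in> JL n \<Longrightarrow> mspan S g"
proof (induction n arbitrary: g)
  case 0
  then show ?case by (simp add: JL_def)
next
  case (Suc n)
  show ?case by (rule Nakayama[OF finite_JL JL_smooth mod_max_derivative[OF Suc.IH] Suc.prems])
qed

end

section \<open>Uniqueness along the hypersurface\<close>

text \<open>A chart flattens the hypersurface near \<open>p\<close>, and the curves are preimages of
  straight segments in the tangent space. Bound and neighbourhood do not depend on the end
  point.\<close>

lemma hypersurface_curves:
  fixes \<rho> :: "'a::euclidean_space \<Rightarrow> real"
  assumes s: "smooth_near p \<rho>" and p: "\<rho> p = 0" and n: "frechet_derivative \<rho> (at p) n \<noteq> 0"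
    and W: "open W" "p \<in> W"
  shows "\<exists>B \<Omega>. open \<Omega> \<and> p \<in> \<Omega> \<and> (\<forall>z\<in>\<Omega>. \<rho> z = 0 \<longrightarrow> (\<exists>\<gamma> \<gamma>'. \<gamma> 0 = p \<and> \<gamma> 1 = z \<and>
    (\<forall>t\<in>{0..1}. \<gamma> t \<in> W \<and> \<rho> (\<gamma> t) = 0 \<and> (\<gamma> has_vector_derivative \<gamma>' t) (at t) \<and> norm (\<gamma>' t) \<le> B)))"
proof -
  obtain W0 where W0: "open W0" "p \<in> W0" "smooth_on W0 \<rho>" using s by (auto simp: smooth_near_def)
  define d where "d = frechet_derivative \<rho> (at p)"
  have dr: "(\<rho> has_derivative frechet_derivative \<rho> (at x)) (at x)" if "x \<in> W0" for x
    by (rule smooth_on_has_derivative[OF W0(3) that])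
  have bl: "bounded_linear (frechet_derivative \<rho> (at x))" if "x \<in> W0" for x
    by (rule has_derivative_bounded_linear[OF dr[OF that]])
  have bd: "bounded_linear d" using bl[OF W0(2)] by (simp add: d_def)
  have lind: "linear d" using bd by (rule bounded_linear.linear)
  define m where "m = n /\<^sub>R d n"
  have dm: "d m = 1" using n lind by (simp add: m_def d_def linear_scale)
  \<comment> \<open>Chosen so that \<open>d (\<Psi> y - p) = \<rho> y\<close> and the derivative at
    \<open>p\<close> is the identity; the hypersurface goes to the hyperplane through
    \<open>p\<close> on which \<open>d\<close> is constant.\<close>
  define \<Psi> where "\<Psi> y = y + (\<rho> y - d (y - p)) *\<^sub>R m" for y
  have d\<Psi>: "d (\<Psi> y - p) = \<rho> y" for y
    using lind dm by (simp add: \<Psi>_def linear_add linear_diff linear_scale)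
  have \<Psi>p: "\<Psi> p = p" using p lind by (simp add: \<Psi>_def linear_0)
  define D where "D x v = v + (frechet_derivative \<rho> (at x) v - d v) *\<^sub>R m" for x v
  have blD: "bounded_linear (D x)" if "x \<in> W0" for x
    unfolding D_def[abs_def]
    by (intro bounded_linear_add bounded_linear_ident bounded_linear_scaleR_const bounded_linear_sub bl that bd)
  define f' where "f' x = Blinfun (D x)" for x
  have f': "blinfun_apply (f' x) = D x" if "x \<in> W0" for x
    unfolding f'_def by (rule bounded_linear_Blinfun_apply[OF blD[OF that]])
  have der: "(\<Psi> has_derivative blinfun_apply (f' x)) (at x)" if "x \<in> W0" for x
  proof -
    have "((\<lambda>y. y - p) has_derivative (\<lambda>v. v)) (at x)" by (auto intro!: derivative_eq_intros)
    from bounded_linear.has_derivative[OF bd this]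
    have 1: "((\<lambda>y. d (y - p)) has_derivative d) (at x)" .
    show ?thesis
      unfolding f'[OF that] \<Psi>_def[abs_def] D_def[abs_def]
      by (intro has_derivative_add has_derivative_ident has_derivative_scaleR_left has_derivative_diff dr that 1)
  qed
  have contf: "continuous_on W0 f'"
  proof (rule continuous_on_blinfun_componentwise)
    fix v :: 'a
    have "continuous_on W0 (\<lambda>x. D x v)"
      unfolding D_def
      by (intro continuous_intros smooth_on_continuous[OF smooth_on_frechet[OF W0(3)]])
    then show "continuous_on W0 (\<lambda>x. blinfun_apply (f' x) v)"
      by (rule continuous_on_eq) (simp add: f')
  qed
  have f'p: "f' p = id_blinfun"
    by (rule blinfun_eqI) (simp add: f'[OF W0(2)] D_def d_def)
  have inv: "id_blinfun o\<^sub>L f' p = id_blinfun" by (rule blinfun_eqI) (simp add: f'p)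
  obtain U V g g' where UV: "open U" "U \<subseteq> W0" "p \<in> U" "open V" "\<Psi> p \<in> V" "homeomorphism U V \<Psi> g"
    and g': "\<And>y. y \<in> V \<Longrightarrow> (g has_derivative (g' y)) (at y)"
    "\<And>y. y \<in> V \<Longrightarrow> g' y = inv (blinfun_apply (f' (g y)))"
    "\<And>y. y \<in> V \<Longrightarrow> bij (blinfun_apply (f' (g y)))"
    by (rule inverse_function_theorem[OF W0(1) der contf W0(2) inv]) (assumption, rule that, assumption+)
  have g\<Psi>: "g (\<Psi> x) = x" if "x \<in> U" for x using UV(6) that by (simp add: homeomorphism_def)
  have \<Psi>g: "\<Psi> (g y) = y" "g y \<in> U" if "y \<in> V" for y using UV(6) that by (auto simp: homeomorphism_def)
  \<comment> \<open>Within \<open>1 / 2\<close> of the identity the derivative of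
    \<open>\<Psi>\<close> shrinks no vector by more than a factor \<open>2\<close>, hence the speed
    bound \<open>2 * r\<close>.\<close>
  have "isCont f' p" using contf W0 continuous_on_eq_continuous_at by blast
  then have "\<forall>\<^sub>F x in nhds p. dist (f' x) (f' p) < 1 / 2"
    by (intro tendstoD) (auto simp: isCont_def tendsto_at_iff_tendsto_nhds)
  then obtain W1 where W1: "open W1" "p \<in> W1" "\<And>x. x \<in> W1 \<Longrightarrow> dist (f' x) (f' p) < 1 / 2"
    unfolding eventually_nhds by blast
  have gp: "g p = p" using g\<Psi>[OF UV(3)] \<Psi>p by simp
  have contg: "continuous_on V g" using UV(6) by (simp add: homeomorphism_def)
  have "open (V \<inter> g -` (W \<inter> W1))"
    by (rule continuous_open_preimage[OF contg UV(4)]) (use W W1 in auto)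
  moreover have "p \<in> V \<inter> g -` (W \<inter> W1)" using UV(5) \<Psi>p gp W W1 by auto
  ultimately obtain r where r: "r > 0" "ball p r \<subseteq> V \<inter> g -` (W \<inter> W1)"
    using open_contains_ball by metis
  have cont\<Psi>: "continuous_on U \<Psi>" using UV(6) by (simp add: homeomorphism_def)
  define \<Omega> where "\<Omega> = U \<inter> \<Psi> -` ball p r"
  have \<Omega>: "open \<Omega>" "p \<in> \<Omega>"
    unfolding \<Omega>_def using continuous_open_preimage[OF cont\<Psi> UV(1)] UV(3) \<Psi>p r by auto
  have "\<exists>\<gamma> \<gamma>'. \<gamma> 0 = p \<and> \<gamma> 1 = z \<and>
    (\<forall>t\<in>{0..1}. \<gamma> t \<in> W \<and> \<rho> (\<gamma> t) = 0 \<and> (\<gamma> has_vector_derivative \<gamma>' t) (at t) \<and> norm (\<gamma>' t) \<le> 2 * r)"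
    if z: "z \<in> \<Omega>" "\<rho> z = 0" for z
  proof -
    define w where "w = \<Psi> z - p"
    have w: "norm w < r" using z by (simp add: \<Omega>_def w_def dist_norm norm_minus_commute)
    have dw: "d w = 0" using d\<Psi>[of z] z by (simp add: w_def)
    define \<gamma> where "\<gamma> t = g (p + t *\<^sub>R w)" for t :: real
    define \<gamma>' where "\<gamma>' t = g' (p + t *\<^sub>R w) w" for t :: real
    have inb: "p + t *\<^sub>R w \<in> ball p r" if "t \<in> {0..1}" for t
    proof -
      have "\<bar>t\<bar> * norm w \<le> 1 * norm w" using that by (intro mult_right_mono) auto
      then show ?thesis using w by (simp add: dist_norm)
    qed
    have "\<gamma> t \<in> W \<and> \<rho> (\<gamma> t) = 0 \<and> (\<gamma> has_vector_derivative \<gamma>' t) (at t) \<and> norm (\<gamma>' t) \<le> 2 * r"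
      if t: "t \<in> {0..1}" for t
    proof -
      let ?y = "p + t *\<^sub>R w"
      have y: "?y \<in> V" "g ?y \<in> W" "g ?y \<in> W1" using r(2) inb[OF t] by auto
      have "\<rho> (\<gamma> t) = d (\<Psi> (g ?y) - p)" by (simp add: d\<Psi> \<gamma>_def)
      also have "\<dots> = 0" using \<Psi>g(1)[OF y(1)] dw lind by (simp add: linear_scale)
      finally have rho: "\<rho> (\<gamma> t) = 0" .
      have vd: "(\<gamma> has_vector_derivative \<gamma>' t) (at t)"
        unfolding \<gamma>_def[abs_def] \<gamma>'_def by (rule line_has_vector_derivative[OF g'(1)[OF y(1)]])
      have "blinfun_apply (f' (g ?y)) (\<gamma>' t) = w"
        unfolding \<gamma>'_def g'(2)[OF y(1)] using g'(3)[OF y(1)] by (simp add: bij_is_surj surj_f_inv_f)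
      then have "w = \<gamma>' t + blinfun_apply (f' (g ?y) - f' p) (\<gamma>' t)"
        by (simp add: f'p blinfun.diff_left)
      then have "norm (\<gamma>' t) \<le> norm w + norm (blinfun_apply (f' (g ?y) - f' p) (\<gamma>' t))"
        by (metis add_diff_cancel_right' norm_triangle_ineq4)
      also have "norm (blinfun_apply (f' (g ?y) - f' p) (\<gamma>' t)) \<le> norm (f' (g ?y) - f' p) * norm (\<gamma>' t)"
        by (rule norm_blinfun)
      also have "\<dots> \<le> 1 / 2 * norm (\<gamma>' t)"
        using W1(3)[OF y(3)] by (intro mult_right_mono) (auto simp: dist_norm)
      finally have "norm (\<gamma>' t) \<le> 2 * norm w" by simp
      then show ?thesis using rho vd y(2) w by (auto simp: \<gamma>_def)
    qed
    moreover have "\<gamma> 0 = p" by (simp add: \<gamma>_def gp)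
    moreover have "\<gamma> 1 = z" using g\<Psi>[of z] z by (simp add: \<gamma>_def w_def \<Omega>_def)
    ultimately show ?thesis by blast
  qed
  with \<Omega> show ?thesis by blast
qed

text \<open>The energy, the sum of the squared norms, starts at \<open>0\<close>, and its product
  with \<open>exp (- k * t)\<close> does not increase.\<close>

lemma Gronwall_zero:
  fixes u u' :: "'i \<Rightarrow> real \<Rightarrow> complex"
  assumes fin: "finite G" and der: "\<And>g t. g \<in> G \<Longrightarrow> t \<in> {0..1} \<Longrightarrow> (u g has_vector_derivative u' g t) (at t)"
    and bound: "\<And>g t. g \<in> G \<Longrightarrow> t \<in> {0..1} \<Longrightarrow> norm (u' g t) \<le> C * (\<Sum>g\<in>G. norm (u g t))"
    and init: "\<And>g. g \<in> G \<Longrightarrow> u g 0 = 0" and C: "C \<ge> 0" and g: "g \<in> G"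
  shows "u g 1 = 0"
proof -
  define \<phi> where "\<phi> t = (\<Sum>g\<in>G. u g t \<bullet> u g t)" for t
  \<comment> \<open>\<open>2\<close> from differentiating a square, \<open>C\<close> from the bound,
    \<open>card G\<close> from comparing the square of a sum with the sum of squares.\<close>
  define k where "k = 2 * C * real (card G)"
  define \<phi>' where "\<phi>' t = (\<Sum>g\<in>G. u g t \<bullet> u' g t + u' g t \<bullet> u g t)" for t
  have d: "(\<phi> has_real_derivative \<phi>' t) (at t)" if "t \<in> {0..1}" for t
    unfolding \<phi>_def[abs_def] \<phi>'_def has_real_derivative_iff_has_vector_derivative
    by (intro has_vector_derivative_sum bounded_bilinear.has_vector_derivative[OF bounded_bilinear_inner] der that)
  have b: "\<phi>' t \<le> k * \<phi> t" if t: "t \<in> {0..1}" for t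
  proof -
    have "\<phi>' t \<le> (\<Sum>g\<in>G. 2 * (norm (u g t) * (C * (\<Sum>g\<in>G. norm (u g t)))))"
      unfolding \<phi>'_def
    proof (rule sum_mono)
      fix g assume g: "g \<in> G"
      have "u g t \<bullet> u' g t \<le> norm (u g t) * norm (u' g t)" by (rule norm_cauchy_schwarz)
      also have "\<dots> \<le> norm (u g t) * (C * (\<Sum>g\<in>G. norm (u g t)))"
        by (intro mult_left_mono bound g t) auto
      finally show "u g t \<bullet> u' g t + u' g t \<bullet> u g t \<le> 2 * (norm (u g t) * (C * (\<Sum>g\<in>G. norm (u g t))))"
        by (simp add: inner_commute)
    qed
    also have "\<dots> = 2 * C * (\<Sum>g\<in>G. norm (u g t))\<^sup>2"
      by (simp add: power2_eq_square sum_distrib_left sum_distrib_right mult_ac)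
    also have "\<dots> \<le> 2 * C * (real (card G) * (\<Sum>g\<in>G. (norm (u g t))\<^sup>2))"
      using C sum_squared_le_sum_of_squares[of "\<lambda>g. norm (u g t)" G] by (intro mult_left_mono) (auto simp: mult.commute)
    also have "\<dots> = k * \<phi> t" by (simp add: k_def \<phi>_def power2_norm_eq_inner mult.assoc)
    finally show ?thesis .
  qed
  have "(\<lambda>t. exp (- k * t) * \<phi> t) 1 \<le> (\<lambda>t. exp (- k * t) * \<phi> t) 0"
  proof (rule DERIV_nonpos_imp_nonincreasing[of 0 1])
    fix t :: real assume "0 \<le> t" "t \<le> 1"
    then have t: "t \<in> {0..1}" by simp
    have "((\<lambda>t. exp (- k * t) * \<phi> t) has_real_derivative (exp (- k * t) * (- k)) * \<phi> t + \<phi>' t * exp (- k * t)) (at t)"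
      by (rule DERIV_mult[OF _ d[OF t]]) (auto intro!: derivative_eq_intros)
    moreover have "exp (- k * t) * (- k) * \<phi> t + \<phi>' t * exp (- k * t) = exp (- k * t) * (\<phi>' t - k * \<phi> t)"
      by (simp add: algebra_simps)
    moreover have "\<dots> \<le> 0" using b[OF t] by (simp add: mult_nonneg_nonpos)
    ultimately show "\<exists>y. ((\<lambda>t. exp (- k * t) * \<phi> t) has_real_derivative y) (at t) \<and> y \<le> 0" by metis
  qed simp
  moreover have "\<phi> 0 = 0" using init by (simp add: \<phi>_def)
  ultimately have "\<phi> 1 \<le> 0" by (simp add: mult_le_0_iff)
  moreover have "u g 1 \<bullet> u g 1 \<le> \<phi> 1"
    unfolding \<phi>_def by (rule member_le_sum[OF g _ fin]) auto
  ultimately show ?thesis by (metis inner_eq_zero_iff inner_ge_zero order_antisym order_trans)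
qed

context hypersurface_germ begin

lemma rho_p: "\<rho> p = 0"
  using eventually_nhds_x_imp_x[OF M_eq] p_in_M by simp

lemma rho_gradient: obtains n where "frechet_derivative \<rho> (at p) n \<noteq> 0"
proof (rule ccontr)
  assume "\<not> thesis"
  with that have "frechet_derivative \<rho> (at p) n = 0" for n by blast
  then have "dz N R p = 0" by (simp add: dz_def frechet_derivative_of_real[OF smooth_near_differentiable[OF smooth_rho]])
  then show False using dz_N by blast
qed

text \<open>On \<open>M\<close> the differential of each \<open>g\<close> consists of its
  \<open>dz\<close> derivatives, which are combinations of \<open>G\<close>. Along a curve in
  \<open>M\<close> starting at \<open>p\<close> this is a homogeneous linear differential inequality
  with zero initial value.\<close>

lemma eqM_0_of_closed_system:
  assumes fin: "finite G" and sm: "\<And>g. g \<in> G \<Longrightarrow> smooth_near p g" and init: "\<And>g. g \<in> G \<Longrightarrow> g p = 0"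
    and CR: "\<And>g j. g \<in> G \<Longrightarrow> eqM (dzbar j g) (\<lambda>z. 0)"
    and closed: "\<And>g j. g \<in> G \<Longrightarrow> mspan G (dz j g)" and g: "g \<in> G"
  shows "eqM g (\<lambda>z. 0)"
proof -
  let ?\<Sigma> = "\<lambda>z. \<Sum>g\<in>G. norm (g z)"
  have "\<forall>x\<in>G \<times> (UNIV :: 'n set). \<exists>C\<ge>0. \<forall>\<^sub>F z in nhds p. z \<in> M \<longrightarrow> norm (dz (snd x) (fst x) z) \<le> C * ?\<Sigma> z"
  proof
    fix x assume "x \<in> G \<times> (UNIV :: 'n set)"
    then have "mspan G (dz (snd x) (fst x))" by (intro closed) auto
    then show "\<exists>C\<ge>0. \<forall>\<^sub>F z in nhds p. z \<in> M \<longrightarrow> norm (dz (snd x) (fst x) z) \<le> C * ?\<Sigma> z"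
      by (rule mspan_bound[OF fin])
  qed
  from bchoice[OF this] obtain C where C': "\<forall>x\<in>G \<times> (UNIV :: 'n set). C x \<ge> 0 \<and>
    (\<forall>\<^sub>F z in nhds p. z \<in> M \<longrightarrow> norm (dz (snd x) (fst x) z) \<le> C x * ?\<Sigma> z)" ..
  have C: "C x \<ge> 0" "\<forall>\<^sub>F z in nhds p. z \<in> M \<longrightarrow> norm (dz (snd x) (fst x) z) \<le> C x * ?\<Sigma> z"
    if "x \<in> G \<times> (UNIV :: 'n set)" for x using bspec[OF C' that] by simp_all
  \<comment> \<open>The sum of finitely many nonnegative constants dominates each of them.\<close>
  define C0 where "C0 = (\<Sum>x\<in>G \<times> (UNIV :: 'n set). C x)"
  have C0: "C0 \<ge> 0" unfolding C0_def by (intro sum_nonneg C)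
  have ev1: "\<forall>\<^sub>F z in nhds p. \<forall>x\<in>G \<times> (UNIV :: 'n set). z \<in> M \<longrightarrow> norm (dz (snd x) (fst x) z) \<le> C x * ?\<Sigma> z"
    using C(2) fin by (intro eventually_ball_finite) auto
  have ev2: "\<forall>\<^sub>F z in nhds p. \<forall>x\<in>G \<times> (UNIV :: 'n set). z \<in> M \<longrightarrow> dzbar (snd x) (fst x) z = 0"
    using CR fin by (intro eventually_ball_finite) (auto simp: eqM_def)
  have ev3: "\<forall>\<^sub>F z in nhds p. \<forall>g\<in>G. smooth_near z g"
    using sm fin by (intro eventually_ball_finite) (auto intro: smooth_near_eventually)
  have "\<forall>\<^sub>F z in nhds p. (z \<in> M \<longleftrightarrow> \<rho> z = 0) \<and>
     (\<forall>g\<in>G. smooth_near z g \<and> (z \<in> M \<longrightarrow> (\<forall>v. norm (frechet_derivative g (at z) v) \<le> (real CARD('n) * C0 * norm v) * ?\<Sigma> z)))"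
    using ev1 ev2 ev3 M_eq
  proof eventually_elim
    case (elim z)
    have "norm (frechet_derivative g (at z) v) \<le> (real CARD('n) * C0 * norm v) * ?\<Sigma> z" if g: "g \<in> G" and z: "z \<in> M" for g v
    proof -
      have "frechet_derivative g (at z) v = (\<Sum>j\<in>UNIV. v $ j * dz j g z)"
      proof -
        have "g differentiable (at z)" using elim(3) g by (intro smooth_near_differentiable) blast
        moreover have "dzbar j g z = 0" for j using elim(2) g z by force
        ultimately show ?thesis by (simp add: frechet_derivative_wirtinger)
      qed
      also have "norm \<dots> \<le> (\<Sum>j\<in>(UNIV :: 'n set). norm v * (C0 * ?\<Sigma> z))"
      proof (rule sum_norm_le)
        fix j :: 'n
        have "norm (dz j g z) \<le> C (g, j) * ?\<Sigma> z" using elim g z by force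
        also have "\<dots> \<le> C0 * ?\<Sigma> z"
          unfolding C0_def using fin g C(1)
          by (intro mult_right_mono member_le_sum[of "(g, j)"] sum_nonneg) auto
        finally show "norm (v $ j * dz j g z) \<le> norm v * (C0 * ?\<Sigma> z)"
          unfolding norm_mult by (intro mult_mono Finite_Cartesian_Product.norm_nth_le) auto
      qed
      finally show ?thesis by (simp add: mult_ac)
    qed
    then show ?case using elim by blast
  qed
  then obtain W where W: "open W" "p \<in> W" "\<And>z. z \<in> W \<Longrightarrow> z \<in> M \<longleftrightarrow> \<rho> z = 0" "\<And>z g. z \<in> W \<Longrightarrow> g \<in> G \<Longrightarrow> smooth_near z g"
    "\<And>z g v. z \<in> W \<Longrightarrow> g \<in> G \<Longrightarrow> z \<in> M \<Longrightarrow> norm (frechet_derivative g (at z) v) \<le> (real CARD('n) * C0 * norm v) * ?\<Sigma> z"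
    unfolding eventually_nhds by blast
  obtain n where n: "frechet_derivative \<rho> (at p) n \<noteq> 0" by (rule rho_gradient)
  obtain B \<Omega> where B: "open \<Omega>" "p \<in> \<Omega>" "\<And>z. z \<in> \<Omega> \<Longrightarrow> \<rho> z = 0 \<Longrightarrow> \<exists>\<gamma> \<gamma>'. \<gamma> 0 = p \<and> \<gamma> 1 = z \<and>
    (\<forall>t\<in>{0..1}. \<gamma> t \<in> W \<and> \<rho> (\<gamma> t) = 0 \<and> (\<gamma> has_vector_derivative \<gamma>' t) (at t) \<and> norm (\<gamma>' t) \<le> B)"
    using hypersurface_curves[OF smooth_rho rho_p n W(1,2)] by blast
  have "g z = 0" if z: "z \<in> \<Omega> \<inter> W" "z \<in> M" for z
  proof -
    have "\<rho> z = 0" using z W(3) by blast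
    then obtain \<gamma> \<gamma>' where \<gamma>: "\<gamma> 0 = p" "\<gamma> 1 = z" "\<And>t. t \<in> {0..1} \<Longrightarrow> \<gamma> t \<in> W" "\<And>t. t \<in> {0..1} \<Longrightarrow> \<rho> (\<gamma> t) = 0"
      "\<And>t. t \<in> {0..1} \<Longrightarrow> (\<gamma> has_vector_derivative \<gamma>' t) (at t)" "\<And>t. t \<in> {0..1} \<Longrightarrow> norm (\<gamma>' t) \<le> B"
      using B(3) z by blast
    have B0: "B \<ge> 0" using \<gamma>(6)[of 0] norm_ge_zero[of "\<gamma>' 0"] by (simp del: norm_ge_zero)
    have "g (\<gamma> 1) = 0"
    proof (rule Gronwall_zero[OF fin _ _ _ _ g, of "\<lambda>g t. g (\<gamma> t)" "\<lambda>g t. frechet_derivative g (at (\<gamma> t)) (\<gamma>' t)" "real CARD('n) * C0 * B"])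
      fix g t assume g: "g \<in> G" and t: "t \<in> {0..(1::real)}"
      have sg: "(g has_derivative frechet_derivative g (at (\<gamma> t))) (at (\<gamma> t))"
        by (rule smooth_near_has_derivative[OF W(4)[OF \<gamma>(3)[OF t] g]])
      then have "((\<lambda>t. g (\<gamma> t)) has_derivative (\<lambda>x. frechet_derivative g (at (\<gamma> t)) (x *\<^sub>R \<gamma>' t))) (at t)"
        using has_derivative_compose[OF \<gamma>(5)[OF t, unfolded has_vector_derivative_def]] by blast
      then show "((\<lambda>t. g (\<gamma> t)) has_vector_derivative frechet_derivative g (at (\<gamma> t)) (\<gamma>' t)) (at t)"
        using has_derivative_linear[OF sg] by (simp add: has_vector_derivative_def linear_scale)
      have "\<gamma> t \<in> M" using W(3) \<gamma>(3,4) t by blast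
      from W(5)[OF \<gamma>(3)[OF t] g this]
      have "norm (frechet_derivative g (at (\<gamma> t)) (\<gamma>' t)) \<le> (real CARD('n) * C0 * norm (\<gamma>' t)) * ?\<Sigma> (\<gamma> t)" .
      also have "\<dots> \<le> (real CARD('n) * C0 * B) * ?\<Sigma> (\<gamma> t)"
        using \<gamma>(6)[OF t] C0 by (intro mult_right_mono mult_left_mono sum_nonneg) auto
      finally show "norm (frechet_derivative g (at (\<gamma> t)) (\<gamma>' t)) \<le> real CARD('n) * C0 * B * ?\<Sigma> (\<gamma> t)" .
    qed (use init \<gamma>(1) C0 B0 in auto)
    then show ?thesis using \<gamma>(2) by simp
  qed
  then show ?thesis
    unfolding eqM_def eventually_nhds using B W by (intro exI[of _ "\<Omega> \<inter> W"]) auto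
qed

end

context CR_system begin

text \<open>Prolongation makes \<open>S\<close> closed under \<open>dz\<close> up to
  \<open>mspan\<close>, so uniqueness for closed systems applies. The first derivatives are included
  because the extension of \<open>h\<close> by zero must be differentiable at points of
  \<open>M\<close>.\<close>

theorem jet_determination:
  assumes ft: "w \<noteq> []" "foldr Lb w (\<phi> j) p \<noteq> 0"
    and init: "\<And>w i. length w \<le> 2 * k \<Longrightarrow> foldr dz w (h i) p = 0"
  shows "eqM (h i) (\<lambda>z. 0)" "eqM (dz l (h i)) (\<lambda>z. 0)"
proof -
  obtain c s j\<^sub>0 where cs: "s > 0" "\<And>j b. 0 < b \<Longrightarrow> b < s \<Longrightarrow> (K c ^^ b) (\<phi> j) p = 0" "(K c ^^ s) (\<phi> j\<^sub>0) p \<noteq> 0"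
  proof (rule exists_finite_order_direction[OF ft])
    fix c s j assume "s > 0" "\<And>j b. 0 < b \<Longrightarrow> b < s \<Longrightarrow> (K c ^^ b) (\<phi> j) p = 0" "(K c ^^ s) (\<phi> j) p \<noteq> 0"
    then show thesis by (rule that)
  qed
  interpret CR_direction M \<rho> p N h k P Q c s j\<^sub>0
    by unfold_locales (use cs in auto)
  have eq0: "eqM g (\<lambda>z. 0)" if "g \<in> S" for g
  proof (rule eqM_0_of_closed_system[OF finite_JL JL_smooth _ _ _ that])
    show "g p = 0" if "g \<in> S" for g using that init by (auto simp: JL_def)
    show "eqM (dzbar j g) (\<lambda>z. 0)" if "g \<in> S" for g j using hol_dzbar[OF JL_hol[OF that]] .
    show "mspan S (dz j g)" if "g \<in> S" for g j using prolongation[OF JL_dz[OF that]] .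
  qed
  show "eqM (h i) (\<lambda>z. 0)" by (rule eq0[OF h_JL])
  \<comment> \<open>For \<open>k = 0\<close> the set \<open>S\<close> need not contain the first
    derivatives; they are reached through the module bound.\<close>
  have "mspan S (dz l (h i))" by (rule prolongation[OF JL_dz[OF h_JL]])
  then obtain C where "\<forall>\<^sub>F z in nhds p. z \<in> M \<longrightarrow> norm (dz l (h i) z) \<le> C * (\<Sum>g\<in>S. norm (g z))"
    using mspan_bound[OF finite_JL] by blast
  moreover have "\<forall>\<^sub>F z in nhds p. \<forall>g\<in>S. z \<in> M \<longrightarrow> g z = 0"
    using eq0 by (intro eventually_ball_finite finite_JL) (auto simp: eqM_def)
  ultimately show "eqM (dz l (h i)) (\<lambda>z. 0)"
    unfolding eqM_def
  proof eventually_elim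
    case (elim z)
    have "(\<Sum>g\<in>S. norm (g z)) = 0" if "z \<in> M" using elim that by (intro sum.neutral) auto
    with elim show ?case by auto
  qed
qed

end

section \<open>Identity theorems\<close>

definition cdifferentiable_on :: "(complex ^ 'n) set \<Rightarrow> (complex ^ 'n \<Rightarrow> complex) \<Rightarrow> bool" where
  "cdifferentiable_on U h \<longleftrightarrow> (\<forall>z\<in>U. \<exists>D. (h has_derivative D) (at z) \<and> (\<forall>c v. D (c *s v) = c * D v))"

lemma bounded_linear_complex_line: "bounded_linear (\<lambda>s. s *s (w :: complex ^ 'n))"
  by (intro linear_conv_bounded_linear[THEN iffD1] linearI) (auto simp: vec_eq_iff algebra_simps)

lemma cdifferentiable_line:
  fixes y w :: "complex ^ 'n"
  assumes h: "cdifferentiable_on U h"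
  shows "(\<lambda>s. h (y + s *s w)) holomorphic_on {s. y + s *s w \<in> U}"
  unfolding holomorphic_on_def
proof
  fix s assume "s \<in> {s. y + s *s w \<in> U}"
  then obtain D where D: "(h has_derivative D) (at (y + s *s w))" "\<And>c v. D (c *s v) = c * D v"
    using h unfolding cdifferentiable_on_def by blast
  have "((\<lambda>s. y + s *s w) has_derivative (\<lambda>s. 0 + s *s w)) (at s within {s. y + s *s w \<in> U})"
    by (intro has_derivative_add has_derivative_const bounded_linear_imp_has_derivative bounded_linear_complex_line)
  from has_derivative_compose[OF this D(1)]
  have "((\<lambda>s. h (y + s *s w)) has_field_derivative D w) (at s within {s. y + s *s w \<in> U})"
    by (simp add: has_field_derivative_def D(2) mult.commute[of _ "D w"] cong: if_cong)
  then show "(\<lambda>s. h (y + s *s w)) field_differentiable at s within {s. y + s *s w \<in> U}"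
    unfolding field_differentiable_def by blast
qed

lemma continuous_complex_line: "continuous_on A (\<lambda>s. y + s *s (w :: complex ^ 'n))"
  by (intro continuous_intros linear_continuous_on bounded_linear_complex_line)

text \<open>The one-variable theorem on the complex line through \<open>y\<close> and
  \<open>x\<close>: convexity of \<open>B\<close> makes the parameter domain convex, hence
  connected.\<close>

lemma identity_theorem_convex:
  fixes h :: "complex ^ 'n \<Rightarrow> complex"
  assumes B: "open B" "convex B" and h: "cdifferentiable_on B h"
    and y: "y \<in> B" "\<forall>\<^sub>F z in nhds y. h z = 0" and x: "x \<in> B"
  shows "h x = 0"
proof -
  define w where "w = x - y"
  define A where "A = {s. y + s *s w \<in> B}"
  define f where "f s = h (y + s *s w)" for s
  have hol: "f holomorphic_on A" unfolding f_def A_def by (rule cdifferentiable_line[OF h])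
  have oA: "open A"
    using open_vimage[OF B(1) continuous_complex_line[of UNIV y w]] by (simp add: A_def vimage_def)
  have "convex A"
  proof (rule convexI)
    fix s t and u v :: real assume st: "s \<in> A" "t \<in> A" and uv: "0 \<le> u" "0 \<le> v" "u + v = 1"
    have "y + (u *\<^sub>R s + v *\<^sub>R t) *s w = u *\<^sub>R (y + s *s w) + v *\<^sub>R (y + t *s w)"
    proof -
      have v: "v = 1 - u" using uv by simp
      show ?thesis unfolding v by (simp add: vec_eq_iff complex_eq_iff algebra_simps)
    qed
    then show "u *\<^sub>R s + v *\<^sub>R t \<in> A"
      using st uv convexD[OF B(2)] by (auto simp: A_def)
  qed
  then have cA: "connected A" by (rule convex_connected)
  obtain O' where O': "open O'" "y \<in> O'" "\<And>z. z \<in> O' \<Longrightarrow> h z = 0" using y(2) unfolding eventually_nhds by blast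
  define C where "C = A \<inter> {s. y + s *s w \<in> O'}"
  have oC: "open C"
    unfolding C_def using oA open_vimage[OF O'(1) continuous_complex_line[of UNIV y w]] by (auto simp: vimage_def)
  have 0: "0 \<in> C" using y O' by (simp add: C_def A_def)
  have "f 1 = 0"
  proof (rule analytic_continuation_open[OF oC oA _ cA _ hol holomorphic_on_const])
    show "C \<noteq> {}" "C \<subseteq> A" using 0 by (auto simp: C_def)
    show "f s = 0" if "s \<in> C" for s using that O' by (auto simp: C_def f_def)
    show "1 \<in> A" using x by (auto simp: A_def w_def)
  qed
  then show ?thesis by (simp add: f_def w_def)
qed

text \<open>The points near which \<open>h\<close> vanishes form an open set that is relatively
  closed in \<open>U\<close> by the convex case on balls.\<close>

lemma identity_theorem_connected:
  fixes h :: "complex ^ 'n \<Rightarrow> complex"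
  assumes U: "open U" "connected U" and h: "cdifferentiable_on U h"
    and y: "y \<in> U" "\<forall>\<^sub>F z in nhds y. h z = 0" and x: "x \<in> U"
  shows "h x = 0"
proof -
  define Z where "Z = {z \<in> U. \<forall>\<^sub>F z in nhds z. h z = 0}"
  have oZ: "open Z"
  proof (rule Topological_Spaces.openI)
    fix z assume z: "z \<in> Z"
    then obtain V where "open V" "z \<in> V" "\<And>z. z \<in> V \<Longrightarrow> h z = 0" by (auto simp: Z_def eventually_nhds)
    then have "open (V \<inter> U)" "z \<in> V \<inter> U" "V \<inter> U \<subseteq> Z"
      using U z unfolding Z_def eventually_nhds by auto
    then show "\<exists>T. open T \<and> z \<in> T \<and> T \<subseteq> Z" by blast
  qed
  have oU: "open (U - Z)"
  proof (rule Topological_Spaces.openI)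
    fix z assume z: "z \<in> U - Z"
    obtain r where r: "r > 0" "ball z r \<subseteq> U" using z U open_contains_ball by blast
    have "ball z r \<inter> Z = {}"
    proof (rule ccontr)
      assume "ball z r \<inter> Z \<noteq> {}"
      then obtain a where a: "a \<in> ball z r" "a \<in> Z" by blast
      have cd: "cdifferentiable_on (ball z r) h" using h r unfolding cdifferentiable_on_def by blast
      have "h b = 0" if "b \<in> ball z r" for b
        using identity_theorem_convex[OF open_ball convex_ball cd a(1) _ that] a(2) by (simp add: Z_def)
      then have "\<forall>\<^sub>F b in nhds z. h b = 0" unfolding eventually_nhds using r by (intro exI[of _ "ball z r"]) auto
      then show False using z by (simp add: Z_def)
    qed
    then show "\<exists>T. open T \<and> z \<in> T \<and> T \<subseteq> U - Z" using r by (intro exI[of _ "ball z r"]) auto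
  qed
  have "Z \<inter> U = {} \<or> (U - Z) \<inter> U = {}"
    by (rule connectedD[OF U(2) oZ oU]) auto
  moreover have "y \<in> Z \<inter> U" using y by (simp add: Z_def)
  ultimately have "x \<in> Z" using x by blast
  then show ?thesis using eventually_nhds_x_imp_x by (fastforce simp: Z_def)
qed

text \<open>Extended by zero across the hypersurface, \<open>H\<close> is holomorphic on a full neighbourhood of \<open>p\<close>.\<close>

lemma boundary_uniqueness:
  fixes h H :: "complex ^ 'n \<Rightarrow> complex" and \<rho> :: "complex ^ 'n \<Rightarrow> real"
  assumes U: "open U" "connected U" and h: "cdifferentiable_on U h"
    and \<rho>: "smooth_near p \<rho>" "\<rho> p = 0" "frechet_derivative \<rho> (at p) \<noteq> (\<lambda>v. 0)"
    and side: "\<forall>\<^sub>F z in nhds p. \<rho> z < 0 \<longrightarrow> z \<in> U \<and> H z = h z"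
    and flat: "\<forall>\<^sub>F z in nhds p. \<rho> z = 0 \<longrightarrow> H z = 0 \<and> (H has_derivative (\<lambda>v. 0)) (at z)"
    and x: "x \<in> U"
  shows "h x = 0"
proof -
  obtain W0 where W0: "open W0" "p \<in> W0" "smooth_on W0 \<rho>" using \<rho>(1) by (auto simp: smooth_near_def)
  obtain W1 where W1: "open W1" "p \<in> W1" "\<And>z. z \<in> W1 \<Longrightarrow> \<rho> z < 0 \<Longrightarrow> z \<in> U \<and> H z = h z"
    using side unfolding eventually_nhds by blast
  obtain W2 where W2: "open W2" "p \<in> W2" "\<And>z. z \<in> W2 \<Longrightarrow> \<rho> z = 0 \<Longrightarrow> H z = 0 \<and> (H has_derivative (\<lambda>v. 0)) (at z)"
    using flat unfolding eventually_nhds by blast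
  have "open (W0 \<inter> W1 \<inter> W2)" "p \<in> W0 \<inter> W1 \<inter> W2" using W0 W1 W2 by auto
  then obtain r where r: "r > 0" "ball p r \<subseteq> W0 \<inter> W1 \<inter> W2" using open_contains_ball by metis
  define B where "B = ball p r"
  have B: "open B" "convex B" "p \<in> B" "B \<subseteq> W0" "B \<subseteq> W1" "B \<subseteq> W2" using r by (auto simp: B_def)
  have cont: "continuous_on B \<rho>" using smooth_on_continuous[OF W0(3)] B continuous_on_subset by blast
  have oneg: "open {z \<in> B. \<rho> z < 0}" and opos: "open {z \<in> B. \<rho> z > 0}"
    using continuous_open_preimage[OF cont B(1), of "{..<0}"] continuous_open_preimage[OF cont B(1), of "{0<..}"]
    by (auto simp: vimage_def Int_def)
  define E where "E z = (if \<rho> z < 0 then H z else 0)" for z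
  have E: "cdifferentiable_on B E"
    unfolding cdifferentiable_on_def
  proof
    fix z assume z: "z \<in> B"
    consider "\<rho> z < 0" | "\<rho> z > 0" | "\<rho> z = 0" by linarith
    then show "\<exists>D. (E has_derivative D) (at z) \<and> (\<forall>c v. D (c *s v) = c * D v)"
    proof cases
      case 1
      then have "z \<in> U" using W1(3) B z by blast
      then obtain D where D: "(h has_derivative D) (at z)" "\<forall>c v. D (c *s v) = c * D v"
        using h unfolding cdifferentiable_on_def by blast
      have "(E has_derivative D) (at z)"
        by (rule has_derivative_transform_within_open[OF D(1) oneg]) (use 1 z W1(3) B in \<open>auto simp: E_def\<close>)
      then show ?thesis using D(2) by blast
    next
      case 2
      have "(E has_derivative (\<lambda>v. 0)) (at z)"
        by (rule has_derivative_transform_within_open[OF has_derivative_const opos]) (use 2 z in \<open>auto simp: E_def\<close>)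
      then show ?thesis by auto
    next
      case 3
      then have H: "H z = 0" "(H has_derivative (\<lambda>v. 0)) (at z)" using W2(3) B z by blast+
      \<comment> \<open>\<open>E\<close> takes the value of \<open>H\<close> or \<open>0\<close>,
        and \<open>H z = 0\<close>, so its increments at \<open>z\<close> are dominated by those of
        \<open>H\<close>.\<close>
      have "(E has_derivative (\<lambda>v. 0)) (at z)"
        unfolding has_derivative_at_alt
      proof (intro conjI allI impI)
        fix e :: real assume "e > 0"
        then obtain d where d: "d > 0" "\<And>y. norm (y - z) < d \<Longrightarrow> norm (H y - H z - 0) \<le> e * norm (y - z)"
          using H(2) unfolding has_derivative_at_alt by blast
        have "norm (E y - E z - 0) \<le> e * norm (y - z)" if "norm (y - z) < d" for y
          using d(2)[OF that] H(1) \<open>e > 0\<close> by (auto simp: E_def)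
        then show "\<exists>d>0. \<forall>y. norm (y - z) < d \<longrightarrow> norm (E y - E z - 0) \<le> e * norm (y - z)" using d(1) by blast
      qed auto
      then show ?thesis by auto
    qed
  qed
  obtain v where v0: "frechet_derivative \<rho> (at p) v \<noteq> 0" using \<rho>(3) by (auto simp: fun_eq_iff)
  have lin: "linear (frechet_derivative \<rho> (at p))"
    using smooth_near_differentiable[OF \<rho>(1)] linear_frechet_derivative by blast
  have "frechet_derivative \<rho> (at p) (- v) = - frechet_derivative \<rho> (at p) v"
    using lin by (rule linear_neg)
  with v0 have "frechet_derivative \<rho> (at p) v > 0 \<or> frechet_derivative \<rho> (at p) (- v) > 0" by linarith
  then obtain n where n: "frechet_derivative \<rho> (at p) n > 0" by blast
  \<comment> \<open>Along \<open>n\<close> the function \<open>\<rho>\<close> increases through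
    \<open>0\<close>, so \<open>B\<close> has points on both sides: \<open>yp\<close>, near which
    \<open>E\<close> is zero by definition, and \<open>yn\<close>, which lies in
    \<open>U\<close>.\<close>
  define c where "c t = \<rho> (p + t *\<^sub>R n)" for t
  have dc: "(c has_real_derivative frechet_derivative \<rho> (at p) n) (at 0)"
    unfolding has_real_derivative_iff_has_vector_derivative c_def[abs_def]
    by (rule line_has_vector_derivative) (use smooth_near_has_derivative[OF \<rho>(1)] in simp)
  have c0: "c 0 = 0" using \<rho>(2) by (simp add: c_def)
  have "open {t. p + t *\<^sub>R n \<in> B}" by (rule open_line_preimage[OF B(1)])
  moreover have "0 \<in> {t. p + t *\<^sub>R n \<in> B}" using B(3) by simp
  ultimately obtain a where a0: "a > 0" "ball 0 a \<subseteq> {t. p + t *\<^sub>R n \<in> B}"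
    using open_contains_ball by blast
  have a: "a > 0" "\<And>t. \<bar>t\<bar> < a \<Longrightarrow> p + t *\<^sub>R n \<in> B"
    using a0 by (auto simp: subset_eq dist_real_def)
  obtain d1 where d1: "d1 > 0" "\<And>t. 0 < t \<Longrightarrow> t < d1 \<Longrightarrow> c 0 < c (0 + t)"
    using DERIV_pos_inc_right[OF dc n] by blast
  obtain d2 where d2: "d2 > 0" "\<And>t. 0 < t \<Longrightarrow> t < d2 \<Longrightarrow> c (0 - t) < c 0"
    using DERIV_pos_inc_left[OF dc n] by blast
  define t where "t = min a (min d1 d2) / 2"
  have t: "0 < t" "t < a" "t < d1" "t < d2" using a d1 d2 by (auto simp: t_def)
  define yp where "yp = p + t *\<^sub>R n"
  define yn where "yn = p + (- t) *\<^sub>R n"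
  have yp: "yp \<in> B" "\<rho> yp > 0" using a(2)[of t] d1(2)[of t] t c0 by (auto simp: yp_def c_def)
  have yn: "yn \<in> B" "\<rho> yn < 0" using a(2)[of "-t"] d2(2)[of t] t c0 by (auto simp: yn_def c_def)
  have ev: "\<forall>\<^sub>F z in nhds yp. E z = 0"
    unfolding eventually_nhds using opos yp by (intro exI[of _ "{z \<in> B. \<rho> z > 0}"]) (auto simp: E_def)
  have E0: "E z = 0" if "z \<in> B" for z by (rule identity_theorem_convex[OF B(1,2) E yp(1) ev that])
  have "h z = 0" if "z \<in> B" "\<rho> z < 0" for z
    using E0[OF that(1)] that W1(3) B by (auto simp: E_def)
  then have "\<forall>\<^sub>F z in nhds yn. h z = 0"
    unfolding eventually_nhds using oneg yn by (intro exI[of _ "{z \<in> B. \<rho> z < 0}"]) auto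
  moreover have "yn \<in> U" using W1(3) yn B by blast
  ultimately show ?thesis using identity_theorem_connected[OF U h _ _ x] by blast
qed

section \<open>Words of vector fields\<close>

lemma dz_cong_on: "open O' \<Longrightarrow> (\<And>z. z \<in> O' \<Longrightarrow> f z = g z) \<Longrightarrow> z \<in> O' \<Longrightarrow> dz j f z = dz j g z"
  by (rule dz_cong) (auto simp: eventually_nhds)

lemma foldr_dz_cong_on:
  "open O' \<Longrightarrow> (\<And>z. z \<in> O' \<Longrightarrow> f z = g z) \<Longrightarrow> z \<in> O' \<Longrightarrow> foldr dz w f z = foldr dz w g z"
  by (induction w arbitrary: z) (auto intro: dz_cong_on)

lemma foldr_dz_move:
  fixes f :: "complex ^ 'n \<Rightarrow> complex"
  assumes "open O'" "smooth_on O' f"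
  shows "z \<in> O' \<Longrightarrow> foldr dz (a @ j # b) f z = dz j (foldr dz (a @ b) f) z"
proof (induction a arbitrary: z)
  case (Cons i a)
  have "dz i (foldr dz (a @ j # b) f) z = dz i (dz j (foldr dz (a @ b) f)) z"
    by (rule dz_cong_on[OF assms(1) Cons.IH Cons.prems])
  also have "\<dots> = dz j (dz i (foldr dz (a @ b) f)) z"
    by (rule dz_dz_commute(1)[OF foldr_dz_smooth[OF smooth_nearI[OF assms(1) Cons.prems assms(2)]]])
  finally show ?case by simp
qed simp

lemma foldr_dz_permute:
  fixes f :: "complex ^ 'n \<Rightarrow> complex"
  assumes O': "open O'" "smooth_on O' f"
  shows "mset w = mset w' \<Longrightarrow> z \<in> O' \<Longrightarrow> foldr dz w f z = foldr dz w' f z"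
proof (induction w arbitrary: w' z)
  case (Cons j w)
  then obtain a b where ab: "w' = a @ j # b" by (metis list.set_intros(1) mset_eq_setD split_list)
  then have "mset w = mset (a @ b)" using Cons.prems(1) by simp
  then have "dz j (foldr dz w f) z = dz j (foldr dz (a @ b) f) z"
    by (intro dz_cong_on[OF O'(1) Cons.IH Cons.prems(2)])
  then show ?case unfolding ab using foldr_dz_move[OF O' Cons.prems(2)] by simp
qed simp

lemma coords: "distinct (coords :: 'n::finite list)" "set (coords :: 'n list) = UNIV"
proof -
  have "\<exists>js. distinct js \<and> set js = (UNIV :: 'n set)" using finite_distinct_list[of "UNIV :: 'n set"] by auto
  then have "distinct (coords :: 'n list) \<and> set (coords :: 'n list) = UNIV"
    unfolding coords_def by (rule someI_ex)
  then show "distinct (coords :: 'n list)" "set (coords :: 'n list) = UNIV" by auto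
qed

text \<open>Derivatives are handled as words of letters; a multi-index becomes its word sorted in
  the order of \<open>js\<close>.\<close>

definition word_of :: "('a \<Rightarrow> nat) \<Rightarrow> 'a list \<Rightarrow> 'a list" where
  "word_of \<alpha> js = concat (map (\<lambda>j. replicate (\<alpha> j) j) js)"

lemma foldr_word_of: "foldr (\<lambda>j. Y j ^^ \<alpha> j) js f = foldr Y (word_of \<alpha> js) f"
  by (induction js) (auto simp: word_of_def foldr_replicate)

lemma length_word_of: "distinct js \<Longrightarrow> length (word_of \<alpha> js) = (\<Sum>j\<in>set js. \<alpha> j)"
  by (induction js) (auto simp: word_of_def)

lemma set_word_of: "set (word_of \<alpha> js) \<subseteq> set js"
  by (induction js) (auto simp: word_of_def)

text \<open>Together with the symmetry of mixed derivatives, this converts a hypothesis on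
  multi-indices into one on all words.\<close>

lemma mset_word_of_coords: "mset (word_of (count (mset w)) (coords :: 'n::finite list)) = mset w"
proof (rule multiset_eqI)
  fix i :: 'n
  have c: "count (mset (word_of \<alpha> js)) i = (if i \<in> set js then \<alpha> i else 0)" if "distinct js" for \<alpha> and js :: "'n list"
    using that by (induction js) (auto simp: word_of_def)
  then show "count (mset (word_of (count (mset w)) coords)) i = count (mset w) i"
    by (simp add: c coords)
qed

lemma dzbar_foldr_dz_eq_0:
  fixes f :: "complex ^ 'n \<Rightarrow> complex"
  assumes O': "open O'" and f: "smooth_on O' f" "\<And>z j. z \<in> O' \<Longrightarrow> dzbar j f z = 0"
  shows "z \<in> O' \<Longrightarrow> dzbar j (foldr dz w f) z = 0"
proof (induction w arbitrary: z)
  case (Cons i w)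
  have "dzbar j (dz i (foldr dz w f)) z = dz i (dzbar j (foldr dz w f)) z"
    by (rule dz_dz_commute(2)[symmetric, OF foldr_dz_smooth[OF smooth_nearI[OF O' Cons.prems f(1)]]])
  also have "\<dots> = dz i (\<lambda>z. 0) z" by (rule dz_cong_on[OF O' Cons.IH Cons.prems])
  finally show ?case by simp
qed (use f in simp)

context hypersurface_germ begin

definition LbW :: "(complex ^ 'n \<Rightarrow> complex) \<Rightarrow> nat \<Rightarrow> (complex ^ 'n \<Rightarrow> complex) set" where
  "LbW u n = {foldr Lb w u | w. length w < n}"

lemma LbW_smooth: "smooth_near p u \<Longrightarrow> g \<in> LbW u n \<Longrightarrow> smooth_near p g"
  unfolding LbW_def by (auto intro: tangential_foldr_smooth[of Lb, OF tangential_Lb])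

lemma LbW_mono: "n \<le> m \<Longrightarrow> LbW u n \<subseteq> LbW u m" unfolding LbW_def using less_le_trans by blast

lemma LbW_Lb: "g \<in> LbW u n \<Longrightarrow> Lb j g \<in> LbW u (Suc n)"
  unfolding LbW_def by (clarsimp, rename_tac w, rule_tac x = "j # w" in exI) auto

text \<open>Serves the independence of nondegeneracy from the frame: fields that are smooth
  combinations of the \<open>Lb\<close> raise the order of the \<open>Lb\<close>-derivatives of
  \<open>u\<close> by at most one per letter.\<close>

lemma mspan_LbW_foldr:
  assumes u: "smooth_near p u" and Y: "\<And>j. tangential (Y j)"
    and YL: "\<And>j g. smooth_near p g \<Longrightarrow> \<exists>a. (\<forall>i. smooth_near p (a i)) \<and> eqM (Y j g) (\<lambda>z. \<Sum>i\<in>UNIV. a i z * Lb i g z)"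
    and f: "mspan (LbW u n) f"
  shows "mspan (LbW u (n + length w)) (foldr Y w f)"
proof (induction w)
  case (Cons j w)
  have "mspan (LbW u (Suc (n + length w))) (Y j (foldr Y w f))"
  proof (rule mspan_derivation[OF Cons Y])
    fix g assume g: "g \<in> LbW u (n + length w)"
    note sg = LbW_smooth[OF u g]
    from YL[OF sg, of j] obtain a where a: "\<And>i. smooth_near p (a i)" "eqM (Y j g) (\<lambda>z. \<Sum>i\<in>UNIV. a i z * Lb i g z)" by blast
    have "mspan (LbW u (Suc (n + length w))) (\<lambda>z. \<Sum>i\<in>UNIV. a i z * Lb i g z)"
      by (rule mspan_sum[OF mspan.scale[OF a(1) mspan.gen[OF LbW_Lb[OF g]]]])
    then show "mspan (LbW u (Suc (n + length w))) (Y j g)"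
      by (rule mspan.eq[OF _ tangential_smooth[OF Y sg] eqM_sym[OF a(2)]])
  qed (use LbW_smooth[OF u] LbW_mono[of "n + length w" "Suc (n + length w)" u] in \<open>auto intro: mspan.gen\<close>)
  then show ?case by simp
qed (use f in simp)

text \<open>By the Leibniz rule only \<open>Lb\<close>-derivatives of \<open>u\<close> of order at
  most \<open>k\<close> occur.\<close>

lemma Lb_word_mult_eq_0:
  assumes u: "smooth_near p u" and a: "smooth_near p a"
    and z: "\<And>w. length w \<le> k \<Longrightarrow> foldr Lb w u p = 0" and w: "length w \<le> k"
  shows "foldr Lb w (\<lambda>z. a z * u z) p = 0"
proof -
  have g: "u \<in> LbW u 1" unfolding LbW_def by (intro CollectI exI[of _ "[]"]) simp
  have YL: "\<exists>a. (\<forall>i. smooth_near p (a i)) \<and> eqM (Lb j g) (\<lambda>z. \<Sum>i\<in>UNIV. a i z * Lb i g z)" for j g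
    by (rule exI[of _ "\<lambda>i z. if i = j then 1 else 0"])
       (auto simp: if_distrib[of "\<lambda>x. x * _"] cong: if_cong)
  have "mspan (LbW u (1 + length w)) (foldr Lb w (\<lambda>z. a z * u z))"
    by (rule mspan_LbW_foldr[OF u tangential_Lb YL mspan.scale[OF a mspan.gen[OF g]]])
  then show ?thesis by (rule mspan_eq_0_at) (use z w in \<open>auto simp: LbW_def\<close>)
qed

lemma eqM_foldr_Lb_at:
  assumes "smooth_near p f" "smooth_near p g" "eqM f g" shows "foldr Lb w f p = foldr Lb w g p"
  by (rule eqM_at[OF tangential_foldr_eqM[OF tangential_Lb assms]])

lemma foldr_Lb_hol_mult:
  assumes "hol m" "smooth_near p u"
  shows "eqM (foldr Lb w (\<lambda>z. m z * u z)) (\<lambda>z. m z * foldr Lb w u z)"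
proof (induction w)
  case (Cons j w)
  note sm = hol_smooth[OF assms(1)]
  note su = tangential_foldr_smooth[OF tangential_Lb assms(2)]
  have "eqM (Lb j (foldr Lb w (\<lambda>z. m z * u z))) (Lb j (\<lambda>z. m z * foldr Lb w u z))"
    by (rule tangential_eqM[OF tangential_Lb tangential_foldr_smooth[OF tangential_Lb smooth_near_mult[OF sm assms(2)]] smooth_near_mult[OF sm su] Cons])
  also have "eqM \<dots> (\<lambda>z. Lb j m z * foldr Lb w u z + m z * Lb j (foldr Lb w u) z)"
    by (rule tangential_mult[OF tangential_Lb sm su])
  also have "eqM \<dots> (\<lambda>z. 0 * foldr Lb w u z + m z * Lb j (foldr Lb w u) z)"
    by (rule eqM_add[OF eqM_mult[OF hol_Lb[OF assms(1)] eqM_refl] eqM_refl])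
  finally show ?case by simp
qed simp

end

context CR_family begin

text \<open>\<open>Lb\<close> kills the \<open>h i\<close> and raises the order of conjugates by
  one, so a word of length at most \<open>m\<close> only meets jets of order at most
  \<open>m\<close>. This lets coefficients be compared at \<open>p\<close> modulo \<open>h\<close>
  and its conjugate.\<close>

lemma Lb_word_vanish:
  assumes f: "mspan (JL 1 \<union> JbL 1) f" and jets: "\<And>w i. length w \<le> m \<Longrightarrow> foldr dz w (h i) p = 0"
    and w: "length w \<le> m"
  shows "foldr Lb w f p = 0"
proof -
  have "mspan (JL 1 \<union> JbL (Suc (length w))) (foldr Lb w f)"
  proof (induction w)
    case (Cons j w)
    have "mspan (JL 1 \<union> JbL (Suc (Suc (length w)))) (Lb j (foldr Lb w f))"
    proof (rule mspan_derivation[OF Cons tangential_Lb])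
      fix g assume "g \<in> JL 1 \<union> JbL (Suc (length w))"
      then have "mspan (JL 1) (Lb j g) \<or> mspan (JbL (Suc (Suc (length w)))) (Lb j g)"
        using mspan_JL_annihilated[OF mspan.gen tangential_Lb hol_Lb] mspan_JbL_Lb[OF mspan.gen] by blast
      then show "mspan (JL 1 \<union> JbL (Suc (Suc (length w)))) (Lb j g)"
        using mspan_mono by blast
    qed (use JL_smooth JbL_smooth JbL_mono[of "Suc (length w)" "Suc (Suc (length w))"] in \<open>auto intro: mspan.gen\<close>)
    then show ?case by simp
  qed (use f in simp)
  then show ?thesis
    by (rule mspan_eq_0_at) (use jets w jets[of "[]"] in \<open>auto simp: JL_def JbL_def\<close>)
qed

end

section \<open>Linearisation of the target equation\<close>

lemma frechet_derivative_nth: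
  fixes F :: "'a::real_normed_vector \<Rightarrow> complex ^ 'm"
  assumes "F differentiable (at z)"
  shows "frechet_derivative (\<lambda>z. F z $ k) (at z) = (\<lambda>v. frechet_derivative F (at z) v $ k)"
  using assms by (intro frechet_derivativeI bounded_linear.has_derivative[OF bounded_linear_vec_nth])
    (simp add: frechet_derivative_works)

lemma differentiable_of_real:
  fixes \<rho> :: "'a::real_normed_vector \<Rightarrow> real"
  assumes "\<rho> differentiable (at z)" shows "(\<lambda>z. complex_of_real (\<rho> z)) differentiable (at z)"
  using assms bounded_linear.has_derivative[OF bounded_linear_of_real] unfolding differentiable_def by blast

lemma dz_chain_real:
  fixes F :: "complex ^ 'n \<Rightarrow> complex ^ 'm" and \<rho> :: "complex ^ 'm \<Rightarrow> real"
  assumes F: "F differentiable (at z)" and \<rho>: "\<rho> differentiable (at (F z))"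
  defines "\<xi> \<equiv> \<lambda>k. dz k (\<lambda>w. complex_of_real (\<rho> w)) (F z)"
  shows "dz j (\<lambda>z. complex_of_real (\<rho> (F z))) z =
    (\<Sum>k\<in>UNIV. dz j (\<lambda>z. F z $ k) z * \<xi> k) + (\<Sum>k\<in>UNIV. cnj (dzbar j (\<lambda>z. F z $ k) z) * cnj (\<xi> k))"
proof -
  let ?R = "\<lambda>w. complex_of_real (\<rho> w)"
  let ?D = "frechet_derivative F (at z)"
  have R: "?R differentiable (at (F z))" by (rule differentiable_of_real[OF \<rho>])
  have "((\<lambda>z. ?R (F z)) has_derivative (\<lambda>v. frechet_derivative ?R (at (F z)) (?D v))) (at z)"
    using diff_chain_at[of F ?D z ?R "frechet_derivative ?R (at (F z))"] F R
    by (simp add: frechet_derivative_works o_def)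
  from frechet_derivativeI[OF this]
  have D: "frechet_derivative (\<lambda>z. ?R (F z)) (at z) v = (\<Sum>k\<in>UNIV. ?D v $ k * \<xi> k) + (\<Sum>k\<in>UNIV. cnj (?D v $ k) * cnj (\<xi> k))" for v
    by (simp add: frechet_derivative_wirtinger[OF R] \<xi>_def dzbar_of_real[OF \<rho>])
  show ?thesis
    unfolding dz_def[of j "\<lambda>z. ?R (F z)"] D dz_def[of j "\<lambda>z. F z $ _"] dzbar_def[of j "\<lambda>z. F z $ _"] frechet_derivative_nth[OF F]
    by (simp add: sum_distrib_left sum_distrib_right sum_subtractf[symmetric] sum.distrib[symmetric] sum_divide_distrib algebra_simps diff_divide_distrib add_divide_distrib)
qed

text \<open>The real Hadamard coefficients in the directions \<open>axis k 1\<close> and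
  \<open>axis k \<i>\<close> are combined as in a Wirtinger derivative; reality of
  \<open>\<rho>\<close> makes the second sum conjugate to the first.\<close>

lemma Hadamard_complex:
  fixes \<rho> :: "complex ^ 'n \<Rightarrow> real"
  assumes "smooth_near q \<rho>"
  obtains r and P :: "'n \<Rightarrow> (complex ^ 'n) \<times> (complex ^ 'n) \<Rightarrow> complex" where "r > 0"
    "\<And>k. smooth_on (ball q r \<times> ball q r) (P k)"
    "\<And>u v. u \<in> ball q r \<Longrightarrow> v \<in> ball q r \<Longrightarrow> complex_of_real (\<rho> u - \<rho> v) =
      (\<Sum>k\<in>UNIV. P k (u, v) * (u - v) $ k) + (\<Sum>k\<in>UNIV. cnj (P k (u, v)) * cnj ((u - v) $ k))"
    "\<And>k u. u \<in> ball q r \<Longrightarrow> P k (u, u) = dz k (\<lambda>w. complex_of_real (\<rho> w)) u"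
proof -
  obtain W where W: "open W" "q \<in> W" "smooth_on W \<rho>" using assms by (auto simp: smooth_near_def)
  obtain r where r: "r > 0" "ball q r \<subseteq> W" using W open_contains_ball by metis
  define B where "B = ball q r"
  have B: "convex B" "open B" "smooth_on B \<rho>" using r W smooth_on_subset by (auto simp: B_def)
  obtain Q where Q: "\<And>e. smooth_on (B \<times> B) (Q e)"
    "\<And>u v. u \<in> B \<Longrightarrow> v \<in> B \<Longrightarrow> \<rho> u - \<rho> v = (\<Sum>e\<in>Basis. ((u - v) \<bullet> e) *\<^sub>R Q e (u, v))"
    "\<And>e u. Q e (u, u) = frechet_derivative \<rho> (at u) e"
    by (rule Hadamard_lemma[OF B]) (rule that)
  define l where "l w x = (\<Sum>e\<in>Basis. (w \<bullet> e) *\<^sub>R Q e x)" for w x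
  have linl: "linear (\<lambda>w. l w x)" for x
    unfolding l_def by (intro linearI) (auto simp: inner_add_left algebra_simps sum.distrib sum_distrib_left)
  have sl: "smooth_on (B \<times> B) (l w)" for w
    unfolding l_def[abs_def] smooth_on_def
    using Q(1) B(2) by (intro allI k_smooth_on_sum open_Times k_smooth_on_linear[OF bounded_linear_scaleR_right]) (auto simp: smooth_on_def)
  define P where "P k x = (complex_of_real (l (axis k 1) x) - \<i> * complex_of_real (l (axis k \<i>) x)) / 2" for k x
  have oBB: "open (B \<times> B)" using B(2) by (simp add: open_Times)
  have "smooth_on (B \<times> B) (P k)" for k
  proof -
    have "smooth_on (B \<times> B) (\<lambda>x. (complex_of_real (l (axis k 1) x) - \<i> * complex_of_real (l (axis k \<i>) x)) * (1 / 2))"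
      by (intro smooth_on_mult smooth_on_diff smooth_on_const smooth_on_linear[OF bounded_linear_of_real] sl oBB)
    then show ?thesis by (simp add: P_def[abs_def])
  qed
  moreover have "complex_of_real (\<rho> u - \<rho> v) =
      (\<Sum>k\<in>UNIV. P k (u, v) * (u - v) $ k) + (\<Sum>k\<in>UNIV. cnj (P k (u, v)) * cnj ((u - v) $ k))"
    if uv: "u \<in> B" "v \<in> B" for u v
  proof -
    let ?w = "u - v"
    have "\<rho> u - \<rho> v = l ?w (u, v)" using Q(2)[OF uv] by (simp add: l_def)
    also have "\<dots> = l (\<Sum>k\<in>UNIV. Re (?w $ k) *\<^sub>R axis k 1 + Im (?w $ k) *\<^sub>R axis k \<i>) (u, v)"
      by (rule arg_cong[where f = "\<lambda>w. l w (u, v)"]) (rule vec_real_decomposition)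
    also have "\<dots> = (\<Sum>k\<in>UNIV. Re (?w $ k) * l (axis k 1) (u, v) + Im (?w $ k) * l (axis k \<i>) (u, v))"
      by (simp only: linear_sum[OF linl] linear_add[OF linl] linear_scale[OF linl] real_scaleR_def)
    finally have "complex_of_real (\<rho> u - \<rho> v) = (\<Sum>k\<in>UNIV. complex_of_real (Re (?w $ k) * l (axis k 1) (u, v) + Im (?w $ k) * l (axis k \<i>) (u, v)))"
      by simp
    also have "\<dots> = (\<Sum>k\<in>UNIV. P k (u, v) * ?w $ k + cnj (P k (u, v)) * cnj (?w $ k))"
      by (intro sum.cong refl) (simp add: P_def complex_eq_iff field_simps)
    finally show ?thesis by (simp add: sum.distrib)
  qed
  moreover have "P k (u, u) = dz k (\<lambda>w. complex_of_real (\<rho> w)) u" if "u \<in> B" for k u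
  proof -
    have d: "\<rho> differentiable (at u)" using smooth_on_has_derivative[OF B(3) that] differentiable_def by blast
    have "l w (u, u) = frechet_derivative \<rho> (at u) w" for w
      unfolding l_def Q(3) using linear_frechet_derivative[OF d]
      by (subst (2) euclidean_representation[symmetric]) (simp add: linear_sum linear_scale)
    then show ?thesis by (simp add: P_def dz_def frechet_derivative_of_real[OF d])
  qed
  ultimately show ?thesis using that[of r P] r(1) by (simp add: B_def)
qed

context CR_family begin

text \<open>Hadamard's lemma once more, now on pairs of points: \<open>(F, G)\<close> and
  \<open>(F, F)\<close> differ by \<open>0\<close> and \<open>-h\<close>, whose real coordinates are
  combinations of \<open>h\<close> and its conjugate.\<close>

lemma Hadamard_mspan:
  assumes F: "smooth_near p F" and G: "smooth_near p G" and FG: "F p = q" "G p = q"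
    and h: "\<And>i. h i = (\<lambda>z. F z $ i - G z $ i)"
    and B: "convex B" "open B" "q \<in> B" and P: "smooth_on (B \<times> B) (P :: (complex ^ 'n) \<times> (complex ^ 'n) \<Rightarrow> complex)"
  shows "mspan (JL 1 \<union> JbL 1) (\<lambda>z. P (F z, G z) - P (F z, F z))"
proof -
  let ?H = "JL 1 \<union> JbL 1"
  have BB: "convex (B \<times> B)" "open (B \<times> B)" using B by (simp_all add: convex_Times open_Times)
  obtain Q where Q: "\<And>e. smooth_on ((B \<times> B) \<times> (B \<times> B)) (Q e)"
    "\<And>u v. u \<in> B \<times> B \<Longrightarrow> v \<in> B \<times> B \<Longrightarrow> P u - P v = (\<Sum>e\<in>Basis. ((u - v) \<bullet> e) *\<^sub>R Q e (u, v))"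
    by (rule Hadamard_lemma[OF BB P]) (rule that)
  define Z where "Z z = ((F z, G z), (F z, F z))" for z
  have sZ: "smooth_near p Z" unfolding Z_def[abs_def] by (intro smooth_near_Pair F G)
  have "smooth_near (Z p) (Q e)" for e
    by (rule smooth_nearI[OF _ _ Q(1)]) (use BB B FG in \<open>auto simp: Z_def intro!: open_Times\<close>)
  then have sQ: "smooth_near p (\<lambda>z. Q e (Z z))" for e by (rule smooth_near_compose[OF sZ])
  have hm: "mspan ?H (h i)" "mspan ?H (\<lambda>z. cnj (h i z))" for i
    using h_JL[of i 0] by (auto intro!: mspan.gen simp: JbL_def)
  have t: "mspan ?H (\<lambda>z. complex_of_real ((fst (Z z) - snd (Z z)) \<bullet> e))" for e
  proof -
    let ?c = "\<lambda>i. snd e $ i"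
    \<comment> \<open>The real inner product of \<open>- h i\<close> and \<open>?c i\<close> is
      minus the real part of \<open>cnj (?c i) * h i\<close>.\<close>
    have "mspan ?H (\<lambda>z. \<Sum>i\<in>UNIV. (- cnj (?c i) / 2) * h i z + (- ?c i / 2) * cnj (h i z))"
      by (intro mspan_sum mspan.add mspan_cmult hm)
    also have "(\<lambda>z. \<Sum>i\<in>UNIV. (- cnj (?c i) / 2) * h i z + (- ?c i / 2) * cnj (h i z))
        = (\<lambda>z. complex_of_real ((fst (Z z) - snd (Z z)) \<bullet> e))"
    proof
      fix z
      have "(fst (Z z) - snd (Z z)) \<bullet> e = (\<Sum>i\<in>UNIV. (G z $ i - F z $ i) \<bullet> ?c i)"
        by (simp add: Z_def inner_prod_def inner_vec_def)
      moreover have "complex_of_real ((G z $ i - F z $ i) \<bullet> ?c i) = (- cnj (?c i) / 2) * h i z + (- ?c i / 2) * cnj (h i z)" for i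
        by (simp add: h inner_complex_def complex_eq_iff field_simps)
      ultimately show "(\<Sum>i\<in>UNIV. (- cnj (?c i) / 2) * h i z + (- ?c i / 2) * cnj (h i z)) = complex_of_real ((fst (Z z) - snd (Z z)) \<bullet> e)"
        by simp
    qed
    finally show ?thesis .
  qed
  have sF: "\<forall>\<^sub>F z in nhds p. F z \<in> B" "\<forall>\<^sub>F z in nhds p. G z \<in> B"
    using topological_tendstoD[OF smooth_near_tendsto[OF F] B(2)] topological_tendstoD[OF smooth_near_tendsto[OF G] B(2)] FG B(3)
    by auto
  have m: "mspan ?H (\<lambda>z. \<Sum>e\<in>Basis. Q e (Z z) * complex_of_real ((fst (Z z) - snd (Z z)) \<bullet> e))"
    by (rule mspan_sum[OF mspan.scale[OF sQ t]])
  have e: "eqM (\<lambda>z. \<Sum>e\<in>Basis. Q e (Z z) * complex_of_real ((fst (Z z) - snd (Z z)) \<bullet> e)) (\<lambda>z. P (F z, G z) - P (F z, F z))"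
  proof (rule eqM_near)
    show "\<forall>\<^sub>F z in nhds p. (\<Sum>e\<in>Basis. Q e (Z z) * complex_of_real ((fst (Z z) - snd (Z z)) \<bullet> e)) = P (F z, G z) - P (F z, F z)"
      using sF
    proof eventually_elim
      case (elim z)
      have "P (F z, G z) - P (F z, F z) = (\<Sum>e\<in>Basis. ((fst (Z z) - snd (Z z)) \<bullet> e) *\<^sub>R Q e (Z z))"
        using Q(2)[of "(F z, G z)" "(F z, F z)"] elim by (simp add: Z_def)
      then show ?case by (simp add: scaleR_conv_of_real mult.commute)
    qed
  qed
  have s: "smooth_near p (\<lambda>z. P (F z, G z) - P (F z, F z))"
  proof (intro smooth_near_diff)
    have 1: "smooth_near (F p, G p) P" "smooth_near (F p, F p) P"
      by (rule smooth_nearI[OF BB(2) _ P], use B FG in simp)+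
    show "smooth_near p (\<lambda>z. P (F z, G z))" by (rule smooth_near_compose[OF smooth_near_Pair[OF F G] 1(1)])
    show "smooth_near p (\<lambda>z. P (F z, F z))" by (rule smooth_near_compose[OF smooth_near_Pair[OF F F] 1(2)])
  qed
  show ?thesis by (rule mspan.eq[OF m s e])
qed

end

section \<open>Nondegeneracy in dual form\<close>

context hypersurface_germ begin

text \<open>The dual formulation: no nonzero functional annihilates the derivatives. It reduces
  nondegeneracy to scalar functions of the form \<open>\<Sum>i. \<mu> i * \<xi> i\<close>.\<close>

definition nondeg :: "nat \<Rightarrow> ('n \<Rightarrow> complex ^ 'n \<Rightarrow> complex) \<Rightarrow> bool" where
  "nondeg k \<xi> \<longleftrightarrow> (\<forall>\<mu>. (\<forall>w. length w \<le> k \<longrightarrow> (\<Sum>i\<in>UNIV. \<mu> i * foldr Lb w (\<xi> i) p) = 0) \<longrightarrow> (\<forall>i. \<mu> i = 0))"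

lemma foldr_Lb_sum_at:
  assumes "\<And>i. smooth_near p (\<xi> i)"
  shows "foldr Lb w (\<lambda>z. \<Sum>i\<in>UNIV. \<mu> i * \<xi> i z) p = (\<Sum>i\<in>(UNIV :: 'n set). \<mu> i * foldr Lb w (\<xi> i) p)"
  by (rule eqM_at[OF tangential_foldr_sum[OF tangential_Lb assms]])

text \<open>If \<open>\<mu>\<close> annihilates all \<open>Lb\<close>-words, then \<open>u\<close>
  has vanishing \<open>Lb\<close>-derivatives at \<open>p\<close>. Along \<open>M\<close> the given
  basis fields are smooth combinations of the \<open>Lb\<close>, so their words kill
  \<open>u\<close> at \<open>p\<close> too, and \<open>\<mu>\<close> annihilates a spanning
  set.\<close>

lemma nondegenerate_at_imp_nondeg:
  assumes V: "open V" "p \<in> V" and basis: "CR_basis_on M V \<rho> B"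
    and span: "vec.span {(\<chi> j. CR_multi B \<alpha> (dz j R) p) | \<alpha>. (\<Sum>k<CARD('n) - 1. \<alpha> k) \<le> k} = UNIV"
  shows "nondeg k (\<lambda>j. dz j R)"
  unfolding nondeg_def
proof (intro allI impI)
  fix \<mu> i assume \<mu>: "\<forall>w. length w \<le> k \<longrightarrow> (\<Sum>i\<in>UNIV. \<mu> i * foldr Lb w (dz i R) p) = 0"
  define n where "n = CARD('n) - 1"
  define u where "u z = (\<Sum>j\<in>UNIV. \<mu> j * dz j R z)" for z
  have sR: "smooth_near p (dz j R)" for j by (rule smooth_near_dz[OF smooth_R])
  have su: "smooth_near p u" unfolding u_def[abs_def] by (rule smooth_near_sum[OF smooth_near_mult[OF smooth_near_const sR]])
  have u0: "foldr Lb w u p = 0" if "length w \<le> k" for w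
    using \<mu> that foldr_Lb_sum_at[OF sR, of w \<mu>] by (simp add: u_def[abs_def])
  have sB: "smooth_near p (\<lambda>z. B l z $ j)" if "l < n" for l j
    using basis that V by (intro smooth_near_nth smooth_nearI[OF V]) (auto simp: CR_basis_on_def n_def)
  have "B l z \<in> tangent_01 \<rho> z" if l: "l < n" and z: "z \<in> M \<inter> V" for l z
  proof -
    have "vec.span ((\<lambda>k. B k z) ` {..<n}) = tangent_01 \<rho> z" using basis z by (simp add: CR_basis_on_def n_def)
    then show ?thesis using l vec.span_base[of "B l z" "(\<lambda>k. B k z) ` {..<n}"] by auto
  qed
  then have "eqM (\<lambda>z. \<Sum>j\<in>UNIV. B l z $ j * dzbar j R z) (\<lambda>z. 0)" if l: "l < n" for l
    unfolding eqM_def eventually_nhds using V l by (intro exI[of _ V]) (auto simp: tangent_01_def)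
  note tang = this
  \<comment> \<open>The family must be tangential for every natural index, hence the zero field
    outside the basis; words over \<open>[0..<n]\<close> never reach it.\<close>
  define Y where "Y l = (if l < n then apply_01 (B l) else (\<lambda>f z. 0))" for l
  have Yvf: "apply_01 a = vector_field (\<lambda>j z. 0) (\<lambda>j z. a z $ j)" "(\<lambda>f z. 0) = vector_field (\<lambda>j z. 0) (\<lambda>j z. 0)"
    for a :: "complex ^ 'n \<Rightarrow> complex ^ 'n"
    by (simp_all add: fun_eq_iff apply_01_def vector_field_def)
  have Y: "tangential (Y l)" for l
  proof (cases "l < n")
    case True
    show ?thesis unfolding tangential_def
    proof (intro exI conjI)
      show "Y l = vector_field (\<lambda>j z. 0) (\<lambda>j z. B l z $ j)" using True by (simp add: Y_def Yvf)
      show "eqM (Y l R) (\<lambda>z. 0)" using tang[OF True] True by (simp add: Y_def apply_01_def[abs_def])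
    qed (use True sB in auto)
  next
    case False
    show ?thesis unfolding tangential_def
    proof (intro exI conjI)
      show "Y l = vector_field (\<lambda>j z. 0) (\<lambda>j z. 0)" using False Yvf(2) by (simp add: Y_def)
      show "eqM (Y l R) (\<lambda>z. 0)" using False by (simp add: Y_def)
    qed auto
  qed
  have YL: "\<exists>a. (\<forall>i. smooth_near p (a i)) \<and> eqM (Y l g) (\<lambda>z. \<Sum>i\<in>UNIV. a i z * Lb i g z)" for l g
  proof (cases "l < n")
    case True
    have "eqM (Y l g) (\<lambda>z. \<Sum>i\<in>UNIV. B l z $ i * Lb i g z)"
      unfolding eqM_def
      using tang[OF True, unfolded eqM_def] dzbar_R smooth_near_nonzero[OF smooth_near_dz[OF smooth_R] dz_N]
    proof eventually_elim
      case (elim z)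
      show ?case
      proof
        assume z: "z \<in> M"
        \<comment> \<open>Tangency of \<open>B l\<close> cancels the extra \<open>dzbar N\<close>
          terms of the frame, so \<open>B l\<close> has the same coefficients with respect to the
          \<open>Lb\<close>.\<close>
        have "(\<Sum>i\<in>UNIV. B l z $ i * cnj (\<phi> i z)) = (\<Sum>i\<in>UNIV. - (B l z $ i * dzbar i R z) / cnj (dz N R z))"
          using elim by (intro sum.cong) (auto simp: \<phi>_def)
        also have "\<dots> = - (\<Sum>i\<in>UNIV. B l z $ i * dzbar i R z) / cnj (dz N R z)"
          by (simp add: sum_divide_distrib sum_negf)
        also have "\<dots> = 0" using elim z by simp
        finally have "(\<Sum>i\<in>UNIV. B l z $ i * cnj (\<phi> i z)) * dzbar N g z = 0" by simp
        then show "Y l g z = (\<Sum>i\<in>UNIV. B l z $ i * Lb i g z)"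
          using True by (simp add: Y_def apply_01_def Lb_def distrib_left sum.distrib sum_distrib_right mult.assoc)
      qed
    qed
    then show ?thesis using sB[OF True] by (intro exI[of _ "\<lambda>i z. B l z $ i"]) auto
  next
    case False
    then show ?thesis by (intro exI[of _ "\<lambda>i z. 0"]) (auto simp: Y_def)
  qed
  have multi: "CR_multi B \<alpha> f = foldr Y (word_of \<alpha> [0..<n]) f" for \<alpha> f
    unfolding CR_multi_def foldr_word_of n_def[symmetric]
    by (rule foldr_cong) (use set_word_of[of \<alpha> "[0..<n]"] in \<open>auto simp: Y_def\<close>)
  have len: "length (word_of \<alpha> [0..<n]) = (\<Sum>k<n. \<alpha> k)" for \<alpha> :: "nat \<Rightarrow> nat"
    by (subst length_word_of) (auto simp: atLeast0LessThan)
  have gu: "mspan (LbW u 1) u" unfolding LbW_def by (intro mspan.gen CollectI exI[of _ "[]"]) simp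
  have "(\<Sum>j\<in>UNIV. \<mu> j * v $ j) = 0"
    if v: "v \<in> {(\<chi> j. CR_multi B \<alpha> (dz j R) p) | \<alpha>. (\<Sum>k<CARD('n) - 1. \<alpha> k) \<le> k}" for v
  proof -
    obtain \<alpha> where \<alpha>: "v = (\<chi> j. CR_multi B \<alpha> (dz j R) p)" "(\<Sum>k<n. \<alpha> k) \<le> k" using v unfolding n_def by blast
    let ?w = "word_of \<alpha> [0..<n]"
    have "foldr Y ?w u p = 0"
      by (rule mspan_eq_0_at[OF mspan_LbW_foldr[OF su Y YL gu, of ?w]]) (use u0 \<alpha>(2) len in \<open>auto simp: LbW_def\<close>)
    moreover have "foldr Y ?w u p = (\<Sum>j\<in>UNIV. \<mu> j * foldr Y ?w (dz j R) p)"
      unfolding u_def[abs_def] by (rule eqM_at[OF tangential_foldr_sum[OF Y sR]])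
    ultimately show ?thesis by (simp add: \<alpha>(1) multi)
  qed
  moreover have "vec.subspace {v :: complex ^ 'n. (\<Sum>j\<in>UNIV. \<mu> j * v $ j) = 0}"
    by (rule vec.subspaceI) (auto simp: algebra_simps sum.distrib mult.left_commute[of "\<mu> _"] sum_distrib_left[symmetric])
  ultimately have "vec.span {(\<chi> j. CR_multi B \<alpha> (dz j R) p) | \<alpha>. (\<Sum>k<CARD('n) - 1. \<alpha> k) \<le> k} \<subseteq> {v. (\<Sum>j\<in>UNIV. \<mu> j * v $ j) = 0}"
    by (intro vec.span_minimal) auto
  then have "axis i 1 \<in> {v. (\<Sum>j\<in>UNIV. \<mu> j * v $ j) = 0}" using span by blast
  then show "\<mu> i = 0" by (simp add: axis_def if_distrib[of "\<lambda>x. _ * x"] cong: if_cong)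
qed

text \<open>Otherwise a constant combination \<open>\<psi>\<close> of \<open>\<phi> j\<close> and
  \<open>\<phi> N\<close> has all \<open>Lb\<close>-derivatives zero at \<open>p\<close>, its value
  included; multiplied by \<open>- dz N R\<close> it becomes a combination of the gradient with the
  coefficients \<open>\<mu>\<close>, against nondegeneracy. An index other than \<open>N\<close>
  exists by the dimension.\<close>

lemma nondeg_imp_finite_type:
  assumes nd: "nondeg k (\<lambda>j. dz j R)" and dim: "CARD('n) \<ge> 2"
  shows "\<exists>w j. w \<noteq> [] \<and> foldr Lb w (\<phi> j) p \<noteq> 0"
proof (rule ccontr)
  assume "\<not> ?thesis"
  then have z: "foldr Lb w (\<phi> j) p = 0" if "w \<noteq> []" for w j using that by blast
  have "\<exists>j. j \<noteq> N"
  proof (rule ccontr)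
    assume "\<not> ?thesis"
    then have "(UNIV :: 'n set) = {N}" by auto
    then have "CARD('n) = 1" by (metis card.empty card.insert empty_iff finite.emptyI One_nat_def)
    then show False using dim by simp
  qed
  then obtain j where j: "j \<noteq> N" by blast
  \<comment> \<open>The second entry removes the value of \<open>\<phi> j\<close> at
    \<open>p\<close>, because \<open>\<phi> N p = -1\<close>.\<close>
  define \<mu> where "\<mu> i = (if i = j then 1 else 0) + (if i = N then \<phi> j p else 0)" for i
  define \<psi> where "\<psi> z = (\<Sum>i\<in>UNIV. \<mu> i * \<phi> i z)" for z
  have s\<psi>: "smooth_near p \<psi>" unfolding \<psi>_def[abs_def] by (rule smooth_near_sum[OF smooth_near_mult[OF smooth_near_const smooth_phi]])
  have "\<phi> N p = -1" using eventually_nhds_x_imp_x[OF phi_N] .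
  then have \<psi>p: "\<psi> p = 0"
    by (simp add: \<psi>_def \<mu>_def distrib_right sum.distrib if_distrib[of "\<lambda>x. x * _"] cong: if_cong)
  have \<psi>0: "foldr Lb w \<psi> p = 0" for w
  proof (cases "w = []")
    case False
    then show ?thesis using foldr_Lb_sum_at[OF smooth_phi, of w \<mu>] z[OF False] by (simp add: \<psi>_def[abs_def])
  qed (use \<psi>p in simp)
  have sa: "smooth_near p (\<lambda>z. - dz N R z)" by (intro smooth_near_minus smooth_near_dz smooth_R)
  have sR: "smooth_near p (dz i R)" for i by (rule smooth_near_dz[OF smooth_R])
  have eq: "eqM (\<lambda>z. - dz N R z * \<psi> z) (\<lambda>z. \<Sum>i\<in>UNIV. \<mu> i * dz i R z)"
  proof (rule eqM_near, rule eventually_mono[OF smooth_near_nonzero[OF sR dz_N]])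
    fix z assume "dz N R z \<noteq> 0"
    then show "- dz N R z * \<psi> z = (\<Sum>i\<in>UNIV. \<mu> i * dz i R z)"
      by (simp add: \<psi>_def \<phi>_def sum_distrib_left sum_negf)
  qed
  have "(\<Sum>i\<in>UNIV. \<mu> i * foldr Lb w (dz i R) p) = 0" for w
  proof -
    have "foldr Lb w (\<lambda>z. - dz N R z * \<psi> z) p = 0"
      by (rule Lb_word_mult_eq_0[OF s\<psi> sa \<psi>0 order_refl])
    then show ?thesis
      using eqM_foldr_Lb_at[OF smooth_near_mult[OF sa s\<psi>] smooth_near_sum[OF smooth_near_mult[OF smooth_near_const sR]] eq, of w]
        foldr_Lb_sum_at[OF sR, of w \<mu>] by simp
  qed
  then have "\<mu> j = 0" using nd unfolding nondeg_def by blast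
  then show False using j by (simp add: \<mu>_def)
qed

text \<open>By the chain rule the derivative of \<open>F\<close> carries the gradient of
  \<open>\<rho>'\<close> along \<open>F\<close> to \<open>\<kappa>\<close> times that of
  \<open>\<rho>\<close> on \<open>M\<close>. A functional \<open>\<mu>\<close> on the target is the
  image of some \<open>v\<close>; entries of the derivative are \<open>hol\<close> and pass through
  \<open>Lb\<close>, so \<open>v\<close> annihilates the source derivatives and is
  \<open>0\<close>.\<close>

lemma nondeg_pushforward:
  fixes F :: "complex ^ 'n \<Rightarrow> complex ^ 'n" and \<rho>' :: "complex ^ 'n \<Rightarrow> real"
  assumes nd: "nondeg k (\<lambda>j. dz j R)"
    and F: "smooth_near p F" "\<And>i. hol (\<lambda>z. F z $ i)"
    and surj: "surj (frechet_derivative F (at p))"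
    and \<rho>': "smooth_near (F p) \<rho>'" "frechet_derivative \<rho>' (at (F p)) \<noteq> (\<lambda>v. 0)"
    and M': "\<forall>\<^sub>F z in nhds p. z \<in> M \<longrightarrow> \<rho>' (F z) = 0"
  shows "nondeg k (\<lambda>i z. dz i (\<lambda>w. complex_of_real (\<rho>' w)) (F z))"
  unfolding nondeg_def
proof (intro allI impI)
  define \<xi> where "\<xi> i z = dz i (\<lambda>w. complex_of_real (\<rho>' w)) (F z)" for i z
  fix \<mu> i assume "\<forall>w. length w \<le> k \<longrightarrow> (\<Sum>i\<in>UNIV. \<mu> i * foldr Lb w (\<lambda>z. dz i (\<lambda>w. complex_of_real (\<rho>' w)) (F z)) p) = 0"
  then have \<mu>: "(\<Sum>i\<in>UNIV. \<mu> i * foldr Lb w (\<xi> i) p) = 0" if "length w \<le> k" for w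
    using that by (simp add: \<xi>_def[abs_def])
  have s\<xi>: "smooth_near p (\<xi> i)" for i
    unfolding \<xi>_def[abs_def] by (rule smooth_near_compose[OF F(1) smooth_near_dz[OF smooth_near_of_real[OF \<rho>'(1)]]])
  define r where "r z = complex_of_real (\<rho>' (F z))" for z
  have sr: "smooth_near p r"
    unfolding r_def[abs_def] by (rule smooth_near_of_real[OF smooth_near_compose[OF F(1) \<rho>'(1)]])
  have ev\<rho>': "\<forall>\<^sub>F z in nhds p. smooth_near (F z) \<rho>'"
    using filterlim_iff[THEN iffD1, OF smooth_near_tendsto[OF F(1)]] smooth_near_eventually[OF \<rho>'(1)] by blast
  have chain: "eqM (dz j r) (\<lambda>z. \<Sum>i\<in>UNIV. dz j (\<lambda>z. F z $ i) z * \<xi> i z)" for j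
  proof -
    have "\<forall>\<^sub>F z in nhds p. \<forall>i\<in>UNIV. z \<in> M \<longrightarrow> dzbar j (\<lambda>z. F z $ i) z = 0"
      using hol_dzbar[OF F(2)] by (intro eventually_ball_finite) (auto simp: eqM_def)
    then show ?thesis
      unfolding eqM_def r_def using ev\<rho>' smooth_near_eventually[OF F(1)]
    proof eventually_elim
      case (elim z)
      then show ?case
        using dz_chain_real[OF smooth_near_differentiable smooth_near_differentiable, of z F \<rho>' j] by (auto simp: \<xi>_def)
    qed
  qed
  have r0: "eqM r (\<lambda>z. 0)" unfolding eqM_def r_def using M' by eventually_elim auto
  have Lr: "eqM (L j r) (\<lambda>z. 0)" for j
    using tangential_eqM[OF tangential_L sr smooth_near_const r0, of j] tangential_const[OF tangential_L, of j 0] by simp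
  \<comment> \<open>Dividing the \<open>N\<close> components makes the factor of proportionality a
    smooth germ.\<close>
  define \<kappa> where "\<kappa> z = dz N r z / dz N R z" for z
  have s\<kappa>: "smooth_near p \<kappa>"
    unfolding \<kappa>_def[abs_def] by (intro smooth_near_divide smooth_near_dz sr smooth_R dz_N)
  have proportional: "eqM (dz j r) (\<lambda>z. \<kappa> z * dz j R z)" for j
    unfolding eqM_def using Lr[of j, unfolded eqM_def]
    by eventually_elim (auto simp: L_def \<kappa>_def \<phi>_def add_eq_0_iff2 mult.commute)
  define D where "D = frechet_derivative F (at p)"
  have dF: "F differentiable (at p)" by (rule smooth_near_differentiable[OF F(1)])
  \<comment> \<open>Otherwise the differential of \<open>\<rho>'\<close> composed with
    \<open>F\<close> vanishes at \<open>p\<close>, impossible since that of \<open>F\<close> is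
    onto.\<close>
  have \<kappa>p: "\<kappa> p \<noteq> 0"
  proof
    assume "\<kappa> p = 0"
    then have dzr: "dz j r p = 0" for j using eqM_at[OF proportional[of j]] by simp
    have d\<rho>: "\<rho>' differentiable (at (F p))" by (rule smooth_near_differentiable[OF \<rho>'(1)])
    have dr: "(\<lambda>z. \<rho>' (F z)) differentiable (at p)"
      by (rule smooth_near_differentiable[OF smooth_near_compose[OF F(1) \<rho>'(1)]])
    have "dzbar j r p = 0" for j using dzr[of j] dzbar_of_real[OF dr, of j] by (simp add: r_def[abs_def])
    then have "frechet_derivative r (at p) v = 0" for v
      using dzr frechet_derivative_wirtinger[OF smooth_near_differentiable[OF sr]] by simp
    then have "frechet_derivative (\<lambda>z. \<rho>' (F z)) (at p) v = 0" for v
      by (simp add: r_def[abs_def] frechet_derivative_of_real[OF dr])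
    moreover have "frechet_derivative (\<lambda>z. \<rho>' (F z)) (at p) = (\<lambda>v. frechet_derivative \<rho>' (at (F p)) (D v))"
      using diff_chain_at[of F D p \<rho>' "frechet_derivative \<rho>' (at (F p))"] dF d\<rho>
      by (intro frechet_derivativeI) (simp add: frechet_derivative_works o_def D_def)
    ultimately have "frechet_derivative \<rho>' (at (F p)) (D v) = 0" for v by metis
    then have "frechet_derivative \<rho>' (at (F p)) v = 0" for v using surj D_def by (metis surjD)
    then show False using \<rho>'(2) by auto
  qed
  obtain v where v: "(\<chi> i. \<mu> i) = D v" using surj D_def by (metis surjD)
  \<comment> \<open>The derivative of \<open>F\<close> in direction \<open>v\<close>: it equals
    \<open>\<mu>\<close> at \<open>p\<close> and is \<open>hol\<close>, so the \<open>Lb\<close>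
    treat it as constant.\<close>
  define m where "m i z = (\<Sum>j\<in>UNIV. v $ j * dz j (\<lambda>z. F z $ i) z)" for i z
  have hm: "hol (m i)" for i unfolding m_def[abs_def] by (rule hol_sum[OF hol_cmult[OF hol_dz[OF F(2)]]])
  have mp: "m i p = \<mu> i" for i
  proof -
    have "\<mu> i = D v $ i" using v by (metis vec_lambda_beta)
    also have "\<dots> = frechet_derivative (\<lambda>z. F z $ i) (at p) v" by (simp add: D_def frechet_derivative_nth[OF dF])
    also have "\<dots> = m i p"
      using frechet_derivative_wirtinger[OF smooth_near_differentiable[OF hol_smooth[OF F(2)]], of i v] eqM_at[OF hol_dzbar[OF F(2)]]
      by (simp add: m_def)
    finally show ?thesis by simp
  qed
  define u where "u z = (\<Sum>j\<in>UNIV. v $ j * dz j R z)" for z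
  have sR: "smooth_near p (dz j R)" for j by (rule smooth_near_dz[OF smooth_R])
  have su: "smooth_near p u" unfolding u_def[abs_def] by (rule smooth_near_sum[OF smooth_near_mult[OF smooth_near_const sR]])
  have "eqM (\<lambda>z. \<kappa> z * u z) (\<lambda>z. \<Sum>j\<in>UNIV. v $ j * (\<kappa> z * dz j R z))"
    by (simp add: u_def sum_distrib_left mult.left_commute)
  also have "eqM \<dots> (\<lambda>z. \<Sum>j\<in>UNIV. v $ j * dz j r z)"
    by (rule eqM_sum[OF eqM_mult[OF eqM_refl eqM_sym[OF proportional]]])
  also have "eqM \<dots> (\<lambda>z. \<Sum>j\<in>UNIV. v $ j * (\<Sum>i\<in>UNIV. dz j (\<lambda>z. F z $ i) z * \<xi> i z))"
    by (rule eqM_sum[OF eqM_mult[OF eqM_refl chain]])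
  also have "(\<lambda>z. \<Sum>j\<in>UNIV. v $ j * (\<Sum>i\<in>UNIV. dz j (\<lambda>z. F z $ i) z * \<xi> i z)) = (\<lambda>z. \<Sum>i\<in>UNIV. 1 * (m i z * \<xi> i z))"
    unfolding m_def sum_distrib_left sum_distrib_right by (subst sum.swap) (simp add: mult.assoc)
  finally have eq: "eqM (\<lambda>z. \<kappa> z * u z) (\<lambda>z. \<Sum>i\<in>UNIV. 1 * (m i z * \<xi> i z))" .
  have sm\<xi>: "smooth_near p (\<lambda>z. m i z * \<xi> i z)" for i by (rule smooth_near_mult[OF hol_smooth[OF hm] s\<xi>])
  have s\<kappa>u: "smooth_near p (\<lambda>z. \<kappa> z * u z)" by (rule smooth_near_mult[OF s\<kappa> su])
  have \<kappa>u0: "foldr Lb w (\<lambda>z. \<kappa> z * u z) p = 0" if "length w \<le> k" for w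
  proof -
    have "foldr Lb w (\<lambda>z. \<kappa> z * u z) p = foldr Lb w (\<lambda>z. \<Sum>i\<in>UNIV. 1 * (m i z * \<xi> i z)) p"
      by (rule eqM_foldr_Lb_at[OF s\<kappa>u smooth_near_sum[OF smooth_near_mult[OF smooth_near_const sm\<xi>]] eq])
    also have "\<dots> = (\<Sum>i\<in>UNIV. 1 * foldr Lb w (\<lambda>z. m i z * \<xi> i z) p)" by (rule foldr_Lb_sum_at[OF sm\<xi>])
    also have "\<dots> = (\<Sum>i\<in>UNIV. \<mu> i * foldr Lb w (\<xi> i) p)"
      using eqM_at[OF foldr_Lb_hol_mult[OF hm s\<xi>]] by (simp add: mp)
    finally show ?thesis using \<mu>[OF that] by simp
  qed
  have s\<kappa>i: "smooth_near p (\<lambda>z. inverse (\<kappa> z))" by (rule smooth_near_inverse[OF s\<kappa> \<kappa>p])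
  have "eqM (\<lambda>z. inverse (\<kappa> z) * (\<kappa> z * u z)) u"
    by (rule eqM_near[OF eventually_mono[OF smooth_near_nonzero[OF s\<kappa> \<kappa>p]]]) simp
  then have "foldr Lb w u p = 0" if "length w \<le> k" for w
    using eqM_foldr_Lb_at[OF smooth_near_mult[OF s\<kappa>i s\<kappa>u] su] Lb_word_mult_eq_0[OF s\<kappa>u s\<kappa>i \<kappa>u0 that] by simp
  then have "\<forall>w. length w \<le> k \<longrightarrow> (\<Sum>j\<in>UNIV. v $ j * foldr Lb w (dz j R) p) = 0"
    using foldr_Lb_sum_at[OF sR, of _ "\<lambda>j. v $ j"] by (simp add: u_def[abs_def])
  then have "v $ j = 0" for j using nd unfolding nondeg_def by blast
  then have "m i p = 0" by (simp add: m_def)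
  then show "\<mu> i = 0" by (simp add: mp)
qed

end

section \<open>Boundary values of holomorphic maps\<close>

lemma cdifferentiable_on_nth:
  fixes f :: "complex ^ 'n \<Rightarrow> complex ^ 'm"
  assumes "holomorphic_map_on U f" shows "cdifferentiable_on U (\<lambda>z. f z $ i)"
  unfolding cdifferentiable_on_def
proof
  fix z assume "z \<in> U"
  then obtain D where D: "(f has_derivative D) (at z)" "\<And>c v. D (c *s v) = c *s D v"
    using assms unfolding holomorphic_map_on_def by blast
  show "\<exists>D. ((\<lambda>z. f z $ i) has_derivative D) (at z) \<and> (\<forall>c v. D (c *s v) = c * D v)"
    using bounded_linear.has_derivative[OF bounded_linear_vec_nth D(1), of i] D(2)
    by (intro exI[of _ "\<lambda>v. D v $ i"]) simp
qed

lemma cdifferentiable_on_diff: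
  assumes "cdifferentiable_on U f" "cdifferentiable_on U g" shows "cdifferentiable_on U (\<lambda>z. f z - g z)"
  unfolding cdifferentiable_on_def
proof
  fix z assume z: "z \<in> U"
  obtain D where D: "(f has_derivative D) (at z)" "\<And>c v. D (c *s v) = c * D v"
    using assms(1) z unfolding cdifferentiable_on_def by blast
  obtain E where E: "(g has_derivative E) (at z)" "\<And>c v. E (c *s v) = c * E v"
    using assms(2) z unfolding cdifferentiable_on_def by blast
  show "\<exists>D. ((\<lambda>z. f z - g z) has_derivative D) (at z) \<and> (\<forall>c v. D (c *s v) = c * D v)"
    using has_derivative_diff[OF D(1) E(1)] D(2) E(2)
    by (intro exI[of _ "\<lambda>v. D v - E v"]) (simp add: algebra_simps)
qed

lemma cdifferentiable_on_dzbar: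
  assumes "cdifferentiable_on U h" "z \<in> U" shows "dzbar j h z = 0"
proof -
  obtain D where D: "(h has_derivative D) (at z)" "\<And>c v. D (c *s v) = c * D v"
    using assms unfolding cdifferentiable_on_def by blast
  have "axis j \<i> = \<i> *s (axis j 1 :: complex ^ 'a)" by (simp add: vec_eq_iff axis_def)
  then have "D (axis j \<i>) = \<i> * D (axis j 1)" using D(2) by simp
  then show ?thesis unfolding dzbar_def frechet_derivativeI[OF D(1)] by simp
qed

lemma zero_on_closure:
  fixes g :: "'a::topological_space \<Rightarrow> 'b::{t1_space, zero}"
  assumes "open V" "continuous_on V g" "\<And>y. y \<in> U \<Longrightarrow> y \<in> V \<Longrightarrow> g y = 0" "z \<in> V" "z \<in> closure U"
  shows "g z = 0"
proof (rule ccontr)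
  assume "g z \<noteq> 0"
  have "open (V \<inter> g -` (- {0}))" by (rule continuous_open_preimage[OF assms(2,1)]) auto
  moreover have "z \<in> V \<inter> g -` (- {0})" using assms(4) \<open>g z \<noteq> 0\<close> by simp
  ultimately have "(V \<inter> g -` (- {0})) \<inter> U \<noteq> {}" using assms(5) open_Int_closure_eq_empty by blast
  then show False using assms(3) by auto
qed

text \<open>\<open>F\<close> is a smooth extension near one boundary point; it is tied to
  \<open>f\<close> on \<open>U \<inter> V\<close> only and arbitrary beyond the boundary.\<close>

locale boundary_map =
  fixes U :: "(complex ^ 'n) set" and f F :: "complex ^ 'n \<Rightarrow> complex ^ 'n" and V :: "(complex ^ 'n) set"
  assumes open_U: "open U" and hol_f: "holomorphic_map_on U f"
    and open_V: "open V" and smooth_F: "smooth_on V F"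
    and F_eq: "\<And>z. z \<in> U \<Longrightarrow> z \<in> V \<Longrightarrow> F z = f z"
begin

lemma smooth_component: "smooth_on V (\<lambda>z. F z $ i)"
  by (rule smooth_on_linear[OF bounded_linear_vec_nth open_V smooth_F])

text \<open>The Cauchy-Riemann equations on \<open>U \<inter> V\<close> pass to its boundary points
  in \<open>V\<close> by continuity.\<close>

lemma dzbar_component:
  assumes "z \<in> V" "z \<in> closure U" shows "dzbar j (foldr dz w (\<lambda>z. F z $ i)) z = 0"
proof -
  have oUV: "open (U \<inter> V)" using open_U open_V by blast
  have s: "smooth_on (U \<inter> V) (\<lambda>z. F z $ i)" by (rule smooth_on_subset[OF smooth_component]) auto
  have c: "dzbar j (\<lambda>z. F z $ i) z = 0" if "z \<in> U \<inter> V" for z j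
  proof -
    have "dzbar j (\<lambda>z. F z $ i) z = dzbar j (\<lambda>z. f z $ i) z"
      by (rule dzbar_cong) (use oUV that F_eq in \<open>auto simp: eventually_nhds\<close>)
    then show ?thesis using cdifferentiable_on_dzbar[OF cdifferentiable_on_nth[OF hol_f]] that by auto
  qed
  have "continuous_on V (dzbar j (foldr dz w (\<lambda>z. F z $ i)))"
    unfolding continuous_on_eq_continuous_at[OF open_V]
    using smooth_near_isCont[OF smooth_near_dzbar[OF foldr_dz_smooth[OF smooth_nearI[OF open_V _ smooth_component]]]]
    by blast
  then show ?thesis
    by (rule zero_on_closure[OF open_V _ _ assms]) (use dzbar_foldr_dz_eq_0[OF oUV s c] in auto)
qed

text \<open>Derivatives of \<open>F\<close> are continuous at \<open>p\<close> and agree with those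
  of \<open>f\<close> on \<open>U \<inter> V\<close>, so they give the limit from within
  \<open>U\<close>.\<close>

lemma boundary_value_jet:
  assumes "p \<in> V" "p \<in> frontier U"
  shows "boundary_value U (dz_multi_map \<alpha> f) p $ i = foldr dz (word_of \<alpha> coords) (\<lambda>z. F z $ i) p"
proof -
  let ?D = "\<lambda>z. \<chi> i. foldr dz (word_of \<alpha> coords) (\<lambda>z. F z $ i) z"
  have oUV: "open (U \<inter> V)" using open_U open_V by blast
  have eq: "dz_multi_map \<alpha> f z = ?D z" if "z \<in> U \<inter> V" for z
    unfolding dz_multi_map_def dz_multi_def foldr_word_of
    by (simp add: vec_eq_iff, intro allI foldr_dz_cong_on[OF oUV _ that]) (use F_eq in auto)
  have "isCont (foldr dz (word_of \<alpha> coords) (\<lambda>z. F z $ i)) p" for i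
    by (rule smooth_near_isCont[OF foldr_dz_smooth[OF smooth_nearI[OF open_V assms(1) smooth_component]]])
  then have "((\<lambda>z. foldr dz (word_of \<alpha> coords) (\<lambda>z. F z $ i) z) \<longlongrightarrow> foldr dz (word_of \<alpha> coords) (\<lambda>z. F z $ i) p) (at p within U)" for i
    unfolding isCont_def using tendsto_within_subset by blast
  then have lim0: "(?D \<longlongrightarrow> ?D p) (at p within U)" by (intro vec_tendstoI) simp
  have ev: "\<forall>\<^sub>F z in at p within U. ?D z = dz_multi_map \<alpha> f z"
    unfolding eventually_at_topological using open_V assms(1) eq by (intro exI[of _ V]) auto
  have lim: "(dz_multi_map \<alpha> f \<longlongrightarrow> ?D p) (at p within U)" by (rule Lim_transform_eventually[OF lim0 ev])
  have "p \<notin> U" "p \<in> closure U" using assms(2) open_U by (auto simp: frontier_def interior_open)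
  then have "at p within U \<noteq> bot" by (simp add: trivial_limit_within closure_def)
  from tendsto_Lim[OF this lim] show ?thesis by (simp add: boundary_value_def)
qed

end

context hypersurface_germ begin

lemma tangential_foldr_diff:
  assumes Y: "\<And>j. tangential (Y j)" and s: "smooth_near p f" "smooth_near p g"
  shows "eqM (foldr Y w (\<lambda>z. f z - g z)) (\<lambda>z. foldr Y w f z - foldr Y w g z)"
proof (induction w)
  case (Cons j w)
  note t = tangential_foldr_smooth[of Y, OF Y]
  from eqM_trans[OF tangential_eqM[OF Y t[OF smooth_near_diff[OF s]] smooth_near_diff[OF t[OF s(1)] t[OF s(2)]] Cons]
      tangential_diff[OF Y t[OF s(1)] t[OF s(2)]]]
  show ?case by simp
qed simp

text \<open>The derivative of \<open>F\<close> is injective on the tangent space, because \<open>E\<close> inverts \<open>F\<close> along \<open>M\<close>; being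
  complex linear, it is then injective.\<close>

lemma surj_derivative:
  fixes F E :: "complex ^ 'n \<Rightarrow> complex ^ 'n"
  assumes F: "smooth_near p F" "\<And>i. hol (\<lambda>z. F z $ i)" and E: "smooth_near (F p) E"
    and EF: "\<forall>\<^sub>F z in nhds p. z \<in> M \<longrightarrow> E (F z) = z"
  shows "surj (frechet_derivative F (at p))"
proof -
  define D where "D = frechet_derivative F (at p)"
  define d where "d = frechet_derivative \<rho> (at p)"
  have dF: "F differentiable (at p)" by (rule smooth_near_differentiable[OF F(1)])
  have FD: "(F has_derivative D) (at p)" unfolding D_def by (rule smooth_near_has_derivative[OF F(1)])
  have linD: "linear D" by (rule has_derivative_linear[OF FD])
  have lind: "linear d" unfolding d_def by (rule linear_frechet_derivative[OF smooth_near_differentiable[OF smooth_rho]])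
  have Dc: "D (c *s v) = c *s D v" for c v
  proof -
    have "D u $ i = (\<Sum>j\<in>UNIV. u $ j * dz j (\<lambda>z. F z $ i) p)" for u i
    proof -
      have "D u $ i = frechet_derivative (\<lambda>z. F z $ i) (at p) u" by (simp add: D_def frechet_derivative_nth[OF dF])
      also have "\<dots> = (\<Sum>j\<in>UNIV. u $ j * dz j (\<lambda>z. F z $ i) p)"
        using frechet_derivative_wirtinger[OF smooth_near_differentiable[OF hol_smooth[OF F(2)]], of i u] eqM_at[OF hol_dzbar[OF F(2)]]
        by simp
      finally show ?thesis .
    qed
    then show ?thesis by (simp add: vec_eq_iff sum_distrib_left mult.assoc)
  qed
  obtain n where n: "frechet_derivative \<rho> (at p) n \<noteq> 0" by (rule rho_gradient)
  have tang: "v = 0" if "d v = 0" "D v = 0" for v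
  proof -
    define e where "e = frechet_derivative E (at (F p))"
    have e: "(E has_derivative e) (at (F p))" unfolding e_def by (rule smooth_near_has_derivative[OF E])
    have "((\<lambda>z. E (F z)) has_derivative (\<lambda>v. e (D v))) (at p)"
      using diff_chain_at[OF FD e] by (simp add: o_def)
    then have der: "((\<lambda>z. E (F z) - z) has_derivative (\<lambda>v. e (D v) - v)) (at p)"
      by (rule has_derivative_diff) (rule has_derivative_ident)
    have "\<forall>\<^sub>F z in nhds p. \<rho> z = 0 \<longrightarrow> E (F z) - z = 0"
      using EF M_eq by eventually_elim auto
    from derivative_tangential_eq_0[OF this rho_p smooth_rho der n] that(1)
    have "e (D v) - v = 0" unfolding d_def by simp
    moreover have "e 0 = 0" using has_derivative_linear[OF e] by (rule linear_0)
    ultimately show ?thesis using that(2) by simp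
  qed
  have inj0: "v = 0" if v: "D v = 0" for v
  proof -
    \<comment> \<open>With this factor \<open>d (c *s v) = 0\<close>, so \<open>c *s v\<close> is a
      tangent vector in the kernel of \<open>D\<close>; and if \<open>c = 0\<close>, then
      \<open>v\<close> itself is tangent.\<close>
    define c where "c = complex_of_real (d (\<i> *s v)) - complex_of_real (d v) * \<i>"
    define a where "a = d (\<i> *s v)"
    define b where "b = d v"
    have cv: "c *s v = a *\<^sub>R v - b *\<^sub>R (\<i> *s v)"
      unfolding c_def a_def[symmetric] b_def[symmetric]
      by (simp add: vec_eq_iff complex_eq_iff algebra_simps)
    have D0: "D (c *s v) = 0" unfolding Dc v by simp
    have d0: "d (c *s v) = 0"
      unfolding cv linear_diff[OF lind] linear_scale[OF lind] by (simp add: a_def b_def)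
    have "c *s v = 0" by (rule tang[OF d0 D0])
    then have "c = 0 \<or> v = 0" by (auto simp: vec_eq_iff)
    moreover have "v = 0" if "c = 0"
    proof -
      have "d v = 0" using that by (simp add: c_def complex_eq_iff)
      then show ?thesis by (rule tang[OF _ v])
    qed
    ultimately show ?thesis by blast
  qed
  have "inj D" using linD inj0 by (simp add: linear_injective_0)
  then show ?thesis using linear_injective_imp_surjective[OF linD] by (simp add: D_def)
qed

end

lemma exists_dz_nonzero:
  fixes \<rho> :: "complex ^ 'n \<Rightarrow> real"
  assumes "\<rho> differentiable (at p)" "frechet_derivative \<rho> (at p) \<noteq> (\<lambda>v. 0)"
  shows "\<exists>N. dz N (\<lambda>z. complex_of_real (\<rho> z)) p \<noteq> 0"
proof (rule ccontr)
  assume "\<not> ?thesis"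
  then have "frechet_derivative (\<lambda>z. complex_of_real (\<rho> z)) (at p) v = 0" for v
    using frechet_derivative_wirtinger[OF differentiable_of_real[OF assms(1)], of v] dzbar_of_real[OF assms(1)] by simp
  then have "frechet_derivative \<rho> (at p) v = 0" for v by (simp add: frechet_derivative_of_real[OF assms(1)])
  then show False using assms(2) by auto
qed

theorem theorem1:
  fixes M M' U :: "(complex ^ 'n) set"
    and f g f_ext g_ext :: "complex ^ 'n \<Rightarrow> complex ^ 'n"
    and p\<^sub>0 :: "complex ^ 'n"
    and k\<^sub>0 :: nat
  assumes "CARD('n) \<ge> 2"
    and "smooth_real_hypersurface M"
    and "smooth_real_hypersurface M'"
    and "open U" and "connected U" and "hypersurface_in_boundary M U"
    and "holomorphic_map_on U f" and "holomorphic_map_on U g"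
    and "smooth_extension_to U M f f_ext" and "smooth_extension_to U M g g_ext"
    and "maps_diffeomorphically_into f_ext M M'"
    and "maps_diffeomorphically_into g_ext M M'"
    and "p\<^sub>0 \<in> M" and "nondegenerate_at k\<^sub>0 M p\<^sub>0"
    and "\<And>\<alpha> :: 'n \<Rightarrow> nat. (\<Sum>j\<in>UNIV. \<alpha> j) \<le> 2 * k\<^sub>0 \<Longrightarrow>
           boundary_value U (dz_multi_map \<alpha> f) p\<^sub>0 = boundary_value U (dz_multi_map \<alpha> g) p\<^sub>0"
  shows "\<forall>z\<in>U. f z = g z"
proof -

  \<comment> \<open>Local extensions of the maps and the germ of the source hypersurface\<close>
  have fr: "M \<subseteq> frontier U" using assms(6) by (simp add: hypersurface_in_boundary_def)
  then have cl: "M \<subseteq> closure U" by (auto simp: frontier_def)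
  obtain VF F where VF: "open VF" "p\<^sub>0 \<in> VF" "smooth_on VF F" "\<And>z. z \<in> (U \<union> M) \<inter> VF \<Longrightarrow> F z = f_ext z"
    using assms(9,13) unfolding smooth_extension_to_def smooth_on_subset_def by blast
  obtain VG G where VG: "open VG" "p\<^sub>0 \<in> VG" "smooth_on VG G" "\<And>z. z \<in> (U \<union> M) \<inter> VG \<Longrightarrow> G z = g_ext z"
    using assms(10,13) unfolding smooth_extension_to_def smooth_on_subset_def by blast
  have fe: "\<And>z. z \<in> U \<Longrightarrow> f_ext z = f z" "\<And>z. z \<in> U \<Longrightarrow> g_ext z = g z"
    using assms(9,10) by (auto simp: smooth_extension_to_def)
  interpret bF: boundary_map U f F VF by unfold_locales (use assms VF fe in auto)
  interpret bG: boundary_map U g G VG by unfold_locales (use assms VG fe in auto)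
  have sF: "smooth_near p\<^sub>0 F" and sG: "smooth_near p\<^sub>0 G" using VF VG smooth_nearI by blast+

  obtain V \<rho> L where \<rho>: "local_defining_function M p\<^sub>0 V \<rho>" "CR_basis_on M V \<rho> L"
    "vec.span {(\<chi> j. CR_multi L \<alpha> (dz j (\<lambda>w. complex_of_real (\<rho> w))) p\<^sub>0) | \<alpha>. (\<Sum>k<CARD('n) - 1. \<alpha> k) \<le> k\<^sub>0} = UNIV"
    using assms(14) unfolding nondegenerate_at_def by blast
  have V: "open V" "p\<^sub>0 \<in> V" "smooth_on V \<rho>" "M \<inter> V = {z \<in> V. \<rho> z = 0}" "frechet_derivative \<rho> (at p\<^sub>0) \<noteq> (\<lambda>v. 0)"
    using \<rho>(1) by (auto simp: local_defining_function_def)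
  have s\<rho>: "smooth_near p\<^sub>0 \<rho>" using V smooth_nearI by blast
  obtain N where N: "dz N (\<lambda>z. complex_of_real (\<rho> z)) p\<^sub>0 \<noteq> 0"
    using exists_dz_nonzero[OF smooth_near_differentiable[OF s\<rho>] V(5)] by blast
  interpret hypersurface_germ M \<rho> p\<^sub>0 N
  proof
    show "\<forall>\<^sub>F z in nhds p\<^sub>0. (z \<in> M) = (\<rho> z = 0)"
      unfolding eventually_nhds using V by (intro exI[of _ V]) blast
  qed (use assms(13) s\<rho> N in auto)

  have eqM_I: "eqM a b" if "open W" "p\<^sub>0 \<in> W" "\<And>z. z \<in> W \<Longrightarrow> z \<in> M \<Longrightarrow> a z = b z" for W a b
    unfolding eqM_def eventually_nhds using that by (intro exI[of _ W]) auto
  have holF: "hol (\<lambda>z. F z $ i)" for i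
    unfolding hol_def
  proof (intro conjI allI)
    show "eqM (dzbar j (foldr dz w (\<lambda>z. F z $ i))) (\<lambda>z. 0)" for w j
      by (rule eqM_I[OF VF(1,2)]) (use bF.dzbar_component cl in auto)
  qed (rule smooth_near_nth[OF sF])
  have holG: "hol (\<lambda>z. G z $ i)" for i
    unfolding hol_def
  proof (intro conjI allI)
    show "eqM (dzbar j (foldr dz w (\<lambda>z. G z $ i))) (\<lambda>z. 0)" for w j
      by (rule eqM_I[OF VG(1,2)]) (use bG.dzbar_component cl in auto)
  qed (rule smooth_near_nth[OF sG])
  define h where "h i z = F z $ i - G z $ i" for i z
  have h_eq: "h i = (\<lambda>z. F z $ i + (-1) * G z $ i)" for i by (simp add: h_def[abs_def])
  interpret CR_family M \<rho> p\<^sub>0 N h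
    by unfold_locales (simp only: h_eq hol_add[OF holF hol_cmult[OF holG]])

  \<comment> \<open>Passage from the jet hypothesis on multi-indices to all words\<close>
  have jets: "foldr dz w (h i) p\<^sub>0 = 0" if w: "length w \<le> 2 * k\<^sub>0" for w i
  proof -
    let ?\<alpha> = "count (mset w)"
    have "(\<Sum>j\<in>UNIV. ?\<alpha> j) = length w"
      using length_word_of[OF coords(1), of ?\<alpha>] mset_word_of_coords[of w] by (metis coords(2) size_mset)
    then have bv: "boundary_value U (dz_multi_map ?\<alpha> f) p\<^sub>0 = boundary_value U (dz_multi_map ?\<alpha> g) p\<^sub>0"
      using assms(15) w by simp
    have p: "p\<^sub>0 \<in> frontier U" using fr assms(13) by blast
    have "foldr dz (word_of ?\<alpha> coords) (\<lambda>z. F z $ i) p\<^sub>0 = foldr dz (word_of ?\<alpha> coords) (\<lambda>z. G z $ i) p\<^sub>0"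
      using bF.boundary_value_jet[OF VF(2) p, of ?\<alpha> i] bG.boundary_value_jet[OF VG(2) p, of ?\<alpha> i] bv by simp
    moreover have "foldr dz (word_of ?\<alpha> coords) (\<lambda>z. F z $ i) p\<^sub>0 = foldr dz w (\<lambda>z. F z $ i) p\<^sub>0"
      by (rule foldr_dz_permute[OF VF(1) bF.smooth_component mset_word_of_coords VF(2)])
    moreover have "foldr dz (word_of ?\<alpha> coords) (\<lambda>z. G z $ i) p\<^sub>0 = foldr dz w (\<lambda>z. G z $ i) p\<^sub>0"
      by (rule foldr_dz_permute[OF VG(1) bG.smooth_component mset_word_of_coords VG(2)])
    ultimately have eq: "foldr dz w (\<lambda>z. F z $ i) p\<^sub>0 = foldr dz w (\<lambda>z. G z $ i) p\<^sub>0" by simp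
    have "near (foldr dz w (h i)) (\<lambda>z. foldr dz w (\<lambda>z. F z $ i) z + foldr dz w (\<lambda>z. (-1) * G z $ i) z)"
      unfolding h_eq by (rule foldr_dz_add[OF hol_smooth[OF holF] hol_smooth[OF hol_cmult[OF holG]]])
    also have "near \<dots> (\<lambda>z. foldr dz w (\<lambda>z. F z $ i) z + (-1) * foldr dz w (\<lambda>z. G z $ i) z)"
      by (rule near_add[OF near_refl foldr_dz_cmult[OF hol_smooth[OF holG]]])
    finally have n: "near (foldr dz w (h i)) (\<lambda>z. foldr dz w (\<lambda>z. F z $ i) z + (-1) * foldr dz w (\<lambda>z. G z $ i) z)" .
    show ?thesis using eventually_nhds_x_imp_x[OF n[unfolded near_def]] eq by simp
  qed
  have FG: "F p\<^sub>0 = G p\<^sub>0" using jets[of "[]"] by (simp add: h_def vec_eq_iff)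
  have FM: "F z = f_ext z" if "z \<in> M" "z \<in> VF" for z using VF(4) that by blast
  have GM: "G z = g_ext z" if "z \<in> M" "z \<in> VG" for z using VG(4) that by blast

  \<comment> \<open>The equation of the target hypersurface along both maps\<close>
  define q where "q = F p\<^sub>0"
  have "q \<in> M'" using FM[OF assms(13) VF(2)] assms(11,13) by (auto simp: q_def maps_diffeomorphically_into_def)
  then obtain V' \<rho>' where \<rho>': "local_defining_function M' q V' \<rho>'"
    using assms(3) unfolding smooth_real_hypersurface_def by blast
  have V': "open V'" "q \<in> V'" "smooth_on V' \<rho>'" "M' \<inter> V' = {z \<in> V'. \<rho>' z = 0}" "frechet_derivative \<rho>' (at q) \<noteq> (\<lambda>v. 0)"
    using \<rho>' by (auto simp: local_defining_function_def)
  have s\<rho>': "smooth_near q \<rho>'" using V' smooth_nearI by blast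
  have evF: "\<forall>\<^sub>F z in nhds p\<^sub>0. F z \<in> W" and evG: "\<forall>\<^sub>F z in nhds p\<^sub>0. G z \<in> W" if "open W" "q \<in> W" for W
    using topological_tendstoD[OF smooth_near_tendsto[OF sF]] topological_tendstoD[OF smooth_near_tendsto[OF sG]] that FG
    by (auto simp: q_def)
  have evVF: "\<forall>\<^sub>F z in nhds p\<^sub>0. z \<in> VF" and evVG: "\<forall>\<^sub>F z in nhds p\<^sub>0. z \<in> VG"
    using VF VG by (auto intro: eventually_nhds_in_open)
  have zF: "\<forall>\<^sub>F z in nhds p\<^sub>0. z \<in> M \<longrightarrow> \<rho>' (F z) = 0"
    using evF[OF V'(1,2)] evVF
  proof eventually_elim
    case (elim z)
    show ?case
    proof
      assume "z \<in> M"
      then have "F z \<in> M' \<inter> V'" using elim FM assms(11) by (auto simp: maps_diffeomorphically_into_def)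
      then show "\<rho>' (F z) = 0" using V'(4) by blast
    qed
  qed
  have zG: "\<forall>\<^sub>F z in nhds p\<^sub>0. z \<in> M \<longrightarrow> \<rho>' (G z) = 0"
    using evG[OF V'(1,2)] evVG
  proof eventually_elim
    case (elim z)
    show ?case
    proof
      assume "z \<in> M"
      then have "G z \<in> M' \<inter> V'" using elim GM assms(12) by (auto simp: maps_diffeomorphically_into_def)
      then show "\<rho>' (G z) = 0" using V'(4) by blast
    qed
  qed

  have qM: "q \<in> f_ext ` M" using FM[OF assms(13) VF(2)] assms(13) by (auto simp: q_def)
  have "smooth_on_subset (f_ext ` M) (inv_into M f_ext)"
    using assms(11) by (simp add: maps_diffeomorphically_into_def)
  from bspec[OF this[unfolded smooth_on_subset_def] qM]
  obtain VE E where E: "open VE" "q \<in> VE" "smooth_on VE E" "\<And>w. w \<in> f_ext ` M \<inter> VE \<Longrightarrow> E w = inv_into M f_ext w"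
    by blast
  have sE: "smooth_near (F p\<^sub>0) E" using E smooth_nearI unfolding q_def by blast
  have inj: "inj_on f_ext M" using assms(11) by (simp add: maps_diffeomorphically_into_def)
  have EF: "\<forall>\<^sub>F z in nhds p\<^sub>0. z \<in> M \<longrightarrow> E (F z) = z"
    using evF[OF E(1,2)] evVF
  proof eventually_elim
    case (elim z)
    then show ?case using E(4)[of "F z"] FM inj by (auto simp: inv_into_f_f)
  qed
  have surj: "surj (frechet_derivative F (at p\<^sub>0))" by (rule surj_derivative[OF sF holF sE EF])

  \<comment> \<open>Transport of nondegeneracy to the coefficients of the linearised
    equation\<close>
  have ndR: "nondeg k\<^sub>0 (\<lambda>j. dz j R)" by (rule nondegenerate_at_imp_nondeg[OF V(1,2) \<rho>(2,3)])
  define \<xi> where "\<xi> i z = dz i (\<lambda>w. complex_of_real (\<rho>' w)) (F z)" for i z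
  have nd\<xi>: "nondeg k\<^sub>0 \<xi>"
    unfolding \<xi>_def[abs_def]
    by (rule nondeg_pushforward[OF ndR sF holF surj _ _ zF]) (use s\<rho>' V'(5) in \<open>auto simp: q_def\<close>)
  obtain r P where P: "r > 0" "\<And>k. smooth_on (ball q r \<times> ball q r) (P k)"
    "\<And>u v. u \<in> ball q r \<Longrightarrow> v \<in> ball q r \<Longrightarrow> complex_of_real (\<rho>' u - \<rho>' v) =
      (\<Sum>k\<in>UNIV. P k (u, v) * (u - v) $ k) + (\<Sum>k\<in>UNIV. cnj (P k (u, v)) * cnj ((u - v) $ k))"
    "\<And>k u. u \<in> ball q r \<Longrightarrow> P k (u, u) = dz k (\<lambda>w. complex_of_real (\<rho>' w)) u"
    by (rule Hadamard_complex[OF s\<rho>']) (rule that)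
  have qB: "q \<in> ball q r" using P(1) by simp
  have oBB: "open (ball q r \<times> ball q r)" by (intro open_Times open_ball)
  define PF where "PF i z = P i (F z, G z)" for i z
  have sPF: "smooth_near p\<^sub>0 (PF i)" for i
    unfolding PF_def[abs_def]
    by (rule smooth_near_compose[OF smooth_near_Pair[OF sF sG] smooth_nearI[OF oBB _ P(2)]]) (use qB FG in \<open>simp add: q_def\<close>)
  have sP2: "smooth_near p\<^sub>0 (\<lambda>z. P i (F z, F z))" for i
    by (rule smooth_near_compose[OF smooth_near_Pair[OF sF sF] smooth_nearI[OF oBB _ P(2)]]) (use qB in \<open>simp add: q_def\<close>)
  have s\<xi>: "smooth_near p\<^sub>0 (\<xi> i)" for i
    unfolding \<xi>_def[abs_def]
    by (rule smooth_near_compose[OF sF]) (use s\<rho>' in \<open>auto simp: q_def intro: smooth_near_dz smooth_near_of_real\<close>)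
  \<comment> \<open>Replacing \<open>G\<close> by \<open>F\<close> in the second argument changes
    \<open>PF i\<close> by an element of the module generated by \<open>h\<close> and its conjugate,
    invisible at \<open>p\<^sub>0\<close> to words of this length; on the diagonal \<open>P\<close>
    is the gradient of \<open>\<rho>'\<close>.\<close>
  have P\<xi>: "foldr Lb w (PF i) p\<^sub>0 = foldr Lb w (\<xi> i) p\<^sub>0" if w: "length w \<le> k\<^sub>0" for w i
  proof -
    have "mspan (JL 1 \<union> JbL 1) (\<lambda>z. PF i z - P i (F z, F z))"
      unfolding PF_def
      by (rule Hadamard_mspan[OF sF sG _ _ _ convex_ball open_ball qB P(2)]) (use FG in \<open>auto simp: q_def h_def[abs_def]\<close>)
    then have "foldr Lb w (\<lambda>z. PF i z - P i (F z, F z)) p\<^sub>0 = 0"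
      by (rule Lb_word_vanish[OF _ jets]) (use w in auto)
    then have "foldr Lb w (PF i) p\<^sub>0 = foldr Lb w (\<lambda>z. P i (F z, F z)) p\<^sub>0"
      using eqM_at[OF tangential_foldr_diff[of Lb, OF tangential_Lb sPF[of i] sP2[of i], of w]] by simp
    also have "\<dots> = foldr Lb w (\<xi> i) p\<^sub>0"
    proof (rule eqM_foldr_Lb_at[OF sP2 s\<xi> eqM_near])
      show "\<forall>\<^sub>F z in nhds p\<^sub>0. P i (F z, F z) = \<xi> i z"
        using evF[OF open_ball qB] by eventually_elim (simp add: P(4) \<xi>_def)
    qed
    finally show ?thesis .
  qed
  interpret CR_system M \<rho> p\<^sub>0 N h k\<^sub>0 PF "\<lambda>i z. cnj (PF i z)"
  proof
    show "smooth_near p\<^sub>0 (PF i)" "smooth_near p\<^sub>0 (\<lambda>z. cnj (PF i z))" for i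
      by (rule sPF, rule smooth_near_cnj[OF sPF])
    show "eqM (\<lambda>z. (\<Sum>i\<in>UNIV. PF i z * h i z) + (\<Sum>i\<in>UNIV. cnj (PF i z) * cnj (h i z))) (\<lambda>z. 0)"
      unfolding eqM_def using zF zG evF[OF open_ball qB] evG[OF open_ball qB]
    proof eventually_elim
      case (elim z)
      then show ?case using P(3)[of "F z" "G z"] by (auto simp: PF_def h_def)
    qed
    show "\<mu> i = 0" if "\<And>w. length w \<le> k\<^sub>0 \<Longrightarrow> (\<Sum>i\<in>UNIV. \<mu> i * foldr Lb w (PF i) p\<^sub>0) = 0" for \<mu> i
      using nd\<xi> that P\<xi> unfolding nondeg_def by simp
  qed

  \<comment> \<open>Vanishing along the hypersurface and continuation into the domain\<close>
  obtain w j where ft: "w \<noteq> []" "foldr Lb w (\<phi> j) p\<^sub>0 \<noteq> 0"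
    using nondeg_imp_finite_type[OF ndR assms(1)] by blast
  have zero: "eqM (h i) (\<lambda>z. 0)" "eqM (dz l (h i)) (\<lambda>z. 0)" for i l
    by (rule jet_determination[OF ft jets], assumption)+

  \<comment> \<open>The side on which \<open>U\<close> lies comes with its own defining function,
    possibly different from the \<open>\<rho>\<close> of nondegeneracy; both have \<open>M\<close>
    as zero set.\<close>
  obtain Vb \<rho>b where \<rho>b: "local_defining_function M p\<^sub>0 Vb \<rho>b" "{z \<in> Vb. \<rho>b z < 0} \<subseteq> U"
    using assms(6,13) unfolding hypersurface_in_boundary_def by blast
  have Vb: "open Vb" "p\<^sub>0 \<in> Vb" "smooth_on Vb \<rho>b" "M \<inter> Vb = {z \<in> Vb. \<rho>b z = 0}" "\<rho>b p\<^sub>0 = 0"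
    "frechet_derivative \<rho>b (at p\<^sub>0) \<noteq> (\<lambda>v. 0)"
    using \<rho>b(1) by (auto simp: local_defining_function_def)
  have evVb: "\<forall>\<^sub>F z in nhds p\<^sub>0. z \<in> Vb" using Vb by (auto intro: eventually_nhds_in_open)
  have "f x $ i - g x $ i = 0" if x: "x \<in> U" for x i
  proof (rule boundary_uniqueness[OF assms(4,5) _ _ Vb(5,6) _ _ x, of _ "h i"])
    show "cdifferentiable_on U (\<lambda>x. f x $ i - g x $ i)"
      by (intro cdifferentiable_on_diff cdifferentiable_on_nth assms)
    show "smooth_near p\<^sub>0 \<rho>b" using Vb smooth_nearI by blast
    show "\<forall>\<^sub>F z in nhds p\<^sub>0. \<rho>b z < 0 \<longrightarrow> z \<in> U \<and> h i z = f z $ i - g z $ i"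
      using evVb evVF evVG
    proof eventually_elim
      case (elim z)
      then show ?case using \<rho>b(2) bF.F_eq bG.F_eq by (auto simp: h_def)
    qed
    have e1: "\<forall>\<^sub>F z in nhds p\<^sub>0. \<forall>j\<in>UNIV. z \<in> M \<longrightarrow> dz j (h i) z = 0 \<and> dzbar j (h i) z = 0"
    proof (intro eventually_ball_finite ballI)
      fix j
      have "eqM (dz j (h i)) (\<lambda>z. 0)" by (rule zero(2))
      moreover have "eqM (dzbar j (h i)) (\<lambda>z. 0)" by (rule hol_dzbar[OF hol_h])
      ultimately show "\<forall>\<^sub>F z in nhds p\<^sub>0. z \<in> M \<longrightarrow> dz j (h i) z = 0 \<and> dzbar j (h i) z = 0"
        unfolding eqM_def by eventually_elim auto
    qed simp
    show "\<forall>\<^sub>F z in nhds p\<^sub>0. \<rho>b z = 0 \<longrightarrow> h i z = 0 \<and> (h i has_derivative (\<lambda>v. 0)) (at z)"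
      using evVb e1 zero(1)[of i, unfolded eqM_def] smooth_near_eventually[OF hol_smooth[OF hol_h[of i]]]
    proof eventually_elim
      case (elim z)
      show ?case
      proof
        assume "\<rho>b z = 0"
        then have z: "z \<in> M" using Vb(4) elim(1) by blast
        have "frechet_derivative (h i) (at z) = (\<lambda>v. 0)"
          using frechet_derivative_wirtinger[OF smooth_near_differentiable[OF elim(4)]] elim(2) z by (auto simp: fun_eq_iff)
        then show "h i z = 0 \<and> (h i has_derivative (\<lambda>v. 0)) (at z)"
          using smooth_near_has_derivative[OF elim(4)] elim(3) z by simp
      qed
    qed
  qed
  then show ?thesis by (simp add: vec_eq_iff)
qed

end
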